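(* Suppose that $(\Omega,\mathcal{F},\mathbb{P})$ is non-atomic, that the Standing Assumption on $(U,B,\xi)$ stated in the context holds, and that Problem $(P_{x_0})$ is well-defined for the initial values $x_0$ considered. (1) If $g(\lambda)=+\infty$ for all $\lambda>0$ (Case 3), then Problem $(P_{x_0})$ is infinite (its supremum is $+\infty$) for every $x_0\in I\setminus\{\mathbb{E}[\xi\underline{x}_B]\}$. (2) Suppose that either $g(\lambda)<+\infty$ for all $\lambda>0$ (Case 1; put $\lambda_0=0$), or there is $\lambda_0\in(0,+\infty)$ such that $g<+\infty$ on $(\lambda_0,+\infty)$ and $g=+\infty$ on $(0,\lambda_0)$ (Case 2). Let $x_0\in I$. Then: (a) If there is a real number $\lambda^*\ge\lambda_0$ with $g(\lambda^* )=x_0$, then $X^*=\underline{X}_B(\lambda^*\xi)$ is an optimal solution of $(P_{x_0})$. (b) If $g(\lambda^* )<x_0\le g(\lambda^*-)$ for some discontinuity point $\lambda^*>\lambda_0$ of $g$, then with positive probability $\mathcal{X}_B(\lambda^*\xi)$ is not a singleton. Moreover, if $x_0=g(\lambda^*-)$, then $X^*=\overline{X}_B(\lambda^*\xi)$ is an optimal solution; if $x_0<g(\lambda^*-)$, there are infinitely many optimal solutions. (c1) In Case 1: if $x_0\ge g(\lambda_0)=g(0)$, then $(P_{x_0})$ has a bliss solution. (c2) In Case 2: let $\theta=\mathbb{E}[\xi\overline{X}_B(\lambda_0\xi)]\in(-\infty,+\infty]$. If $x_0=\theta$, then $\overline{X}_B(\lambda_0\xi)$ is an optimal solution. If $g(\lambda_0)<x_0<\theta$,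 there are infinitely many optimal solutions. If $x_0>\theta$, then $(P_{x_0})$ has no finite optimal solution (no optimal solution $X$ with $\mathbb{E}[U(X,B)]<+\infty$), and there is a sequence $\{\hat X_k\}_{k\ge1}$ of random variables converging almost surely to $\overline{X}_B(\lambda_0\xi)$ with $\mathbb{E}[\xi\hat X_k]=x_0$ for all $k$ and $$\sup_{X:\ \mathbb{E}[\xi X]\le x_0,\ U(X,B)>-\infty}\mathbb{E}[U(X,B)]=\lim_{k\to+\infty}\mathbb{E}[U(\hat X_k,B)]=\mathbb{E}\big[U(\overline{X}_B(\lambda_0\xi),B)\big]+\lambda_0(x_0-\theta).$$
   Context: Setting: $(\Omega,\mathcal{F},\mathbb{P})$ is a probability space, $\xi:\Omega\to(0,+\infty)$ is a random variable, $(E,\mathcal{E})$ is a measurable space, $B:(\Omega,\mathcal{F})\to(E,\mathcal{E})$ is an $E$-valued random variable, and $U:\mathbb{R}\times E\to\mathbb{R}\cup\{-\infty\}$. For $b\in E$ let $\underline{x}_b=\inf\{x\in\mathbb{R}:U(x,b)>-\infty\}$ and $\overline{x}_b=\inf\{x\in\mathbb{R}:U(x,b)=U(+\infty,b)\}\in(-\infty,+\infty]$, where $U(+\infty,b)=\lim_{x\to+\infty}U(x,b)$. Non-atomic: every $A\in\mathcal F$ with $\mathbb{P}(A)>0$ contains $A'\in\mathcal F$ with $0<\mathbb{P}(A')<\mathbb{P}(A)$. Standing Assumption: $U(x,\cdot)$ is measurable on $(E,\mathcal{E})$ for every $x\in\mathbb{R}$, and for each $b\in E$: (a) $-\infty<\underline{x}_b<+\infty$,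 and $\mathbb{E}[\xi\underline{x}_B]>-\infty$ (i.e. $\mathbb{E}[\xi\underline{x}_B^-]<+\infty$); (b) $U(\cdot,b)$ is nondecreasing and upper semicontinuous on $[\underline{x}_b,+\infty)$; (c) $\limsup_{x\to+\infty}U(x,b)/x=0$. For $x_0\in\mathbb{R}$, Problem $(P_{x_0})$ is: maximize $\mathbb{E}[U(X,B)]$ over all admissible $X$, i.e. all real-valued random variables $X$ with $\mathbb{E}[\xi X]\le x_0$ and $U(X,B)>-\infty$ a.s. It is well-defined if for every admissible $X$, $\mathbb{E}[U(X,B)^+]<+\infty$ or $\mathbb{E}[U(X,B)^-]<+\infty$ (where $x^+=\max\{x,0\}$, $x^-=-\min\{x,0\}$). A feasible solution is an admissible $X$ with $\mathbb{E}[U(X,B)]>-\infty$; an optimal solution is an admissible $X$ attaining the supremum; solutions that are a.s. equal are identified. A bliss solution is an admissible $X$ with $X\ge\overline{x}_B$ a.s. The feasible set is $I=\{x_0\in\mathbb{R}:(P_{x_0})\text{ has a feasible solution}\}$. Conjugate set: for $b\in E$ and $0\le y<+\infty$ let $V_b(y)=\sup_{x\in\mathbb{R}}[U(x,b)-yx]$, and let $\mathcal{X}_b(y)\subset\mathbb{R}\cup\{\pm\infty\}$ be defined by: a real $x$ belongs to $\mathcal{X}_b(y)$ iff $U(x,b)-yx=V_b(y)$; and $+\infty$ (resp. $-\infty$) belongs to $\mathcal{X}_b(y)$ iff there are real numbers $x_n\uparrow+\infty$ (resp. $x_n\downarrow-\infty$) with $U(x_n,b)-yx_n\to V_b(y)$.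 Also $\mathcal{X}_b(+\infty)=\{\underline{x}_b\}$. These sets are non-empty; put $\overline{X}_b(y)=\sup\mathcal{X}_b(y)$ and $\underline{X}_b(y)=\inf\mathcal{X}_b(y)$ for $y\in[0,+\infty]$. $\mathcal{X}_B(\lambda\xi)$, $\overline X_B(\lambda\xi)$, $\underline X_B(\lambda\xi)$ denote these objects evaluated at $b=B(\omega)$, $y=\lambda\xi(\omega)$. Define $g(\lambda)=\mathbb{E}[\xi\underline{X}_B(\lambda\xi)]\in(-\infty,+\infty]$ for $\lambda\in[0,+\infty]$ (well-defined by the Standing Assumption; $g$ is nonincreasing and right-continuous), and $g(\lambda-)=\lim_{\lambda'\uparrow\lambda}g(\lambda')$. *)

theory Defs
  imports "HOL-Probability.Probability"
begin

section \<open>Expectations in the extended reals\<close>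

definition pos_expectation :: "'a measure \<Rightarrow> ('a \<Rightarrow> ereal) \<Rightarrow> ennreal" where
  "pos_expectation M f = (\<integral>\<^sup>+ \<omega>. e2ennreal (max 0 (f \<omega>)) \<partial>M)"

definition neg_expectation :: "'a measure \<Rightarrow> ('a \<Rightarrow> ereal) \<Rightarrow> ennreal" where
  "neg_expectation M f = (\<integral>\<^sup>+ \<omega>. e2ennreal (max 0 (- f \<omega>)) \<partial>M)"

definition expectation_exists :: "'a measure \<Rightarrow> ('a \<Rightarrow> ereal) \<Rightarrow> bool" where
  "expectation_exists M f \<longleftrightarrow> pos_expectation M f < \<infinity> \<or> neg_expectation M f < \<infinity>"

text \<open>
  Meaningful for measurable \<open>f\<close> with \<open>expectation_exists M f\<close>.  Otherwise the value is
  \<open>\<infinity> - \<infinity>\<close>, which is \<open>\<infinity>\<close> in type \<^typ>\<open>ereal\<close>.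
\<close>
definition ext_expectation :: "'a measure \<Rightarrow> ('a \<Rightarrow> ereal) \<Rightarrow> ereal" where
  "ext_expectation M f = enn2ereal (pos_expectation M f) - enn2ereal (neg_expectation M f)"

definition nonatomic :: "'a measure \<Rightarrow> bool" where
  "nonatomic M \<longleftrightarrow>
     (\<forall>A\<in>sets M. measure M A > 0 \<longrightarrow>
        (\<exists>A'\<in>sets M. A' \<subseteq> A \<and> 0 < measure M A' \<and> measure M A' < measure M A))"


section \<open>State-dependent utility functions\<close>

definition dom_inf :: "(real \<Rightarrow> 'e \<Rightarrow> ereal) \<Rightarrow> 'e \<Rightarrow> ereal" where
  "dom_inf U b = (INF x\<in>{x. U x b > -\<infinity>}. ereal x)"

definition utility_at_infinity :: "(real \<Rightarrow> 'e \<Rightarrow> ereal) \<Rightarrow> 'e \<Rightarrow> ereal" where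
  "utility_at_infinity U b = Lim at_top (\<lambda>x. U x b)"

definition bliss_point :: "(real \<Rightarrow> 'e \<Rightarrow> ereal) \<Rightarrow> 'e \<Rightarrow> ereal" where
  "bliss_point U b = (INF x\<in>{x. U x b = utility_at_infinity U b}. ereal x)"

definition usc_on :: "real set \<Rightarrow> (real \<Rightarrow> ereal) \<Rightarrow> bool" where
  "usc_on S f \<longleftrightarrow> (\<forall>x\<in>S. Limsup (at x within S) f \<le> f x)"

text \<open>
  The sample space is \<open>space M\<close> and the state space is \<open>space N\<close>; nothing is required of \<open>U\<close>
  for \<open>b\<close> outside \<open>space N\<close>.
\<close>
definition utility_model ::
  "'a measure \<Rightarrow> 'e measure \<Rightarrow> ('a \<Rightarrow> real) \<Rightarrow> ('a \<Rightarrow> 'e) \<Rightarrow> (real \<Rightarrow> 'e \<Rightarrow> ereal) \<Rightarrow> bool" where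
  "utility_model M N \<xi> B U \<longleftrightarrow>
     prob_space M \<and>
     \<xi> \<in> borel_measurable M \<and> (\<forall>\<omega>\<in>space M. \<xi> \<omega> > 0) \<and>
     B \<in> measurable M N \<and>
     (\<forall>x. \<forall>b\<in>space N. U x b \<noteq> \<infinity>)"

definition standing_assumption ::
  "'a measure \<Rightarrow> 'e measure \<Rightarrow> ('a \<Rightarrow> real) \<Rightarrow> ('a \<Rightarrow> 'e) \<Rightarrow> (real \<Rightarrow> 'e \<Rightarrow> ereal) \<Rightarrow> bool" where
  "standing_assumption M N \<xi> B U \<longleftrightarrow>
     (\<forall>x. (\<lambda>b. U x b) \<in> borel_measurable N) \<and>
     (\<forall>b\<in>space N. -\<infinity> < dom_inf U b \<and> dom_inf U b < \<infinity>) \<and>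
     neg_expectation M (\<lambda>\<omega>. ereal (\<xi> \<omega>) * dom_inf U (B \<omega>)) < \<infinity> \<and>
     (\<forall>b\<in>space N. mono_on {x. dom_inf U b \<le> ereal x} (\<lambda>x. U x b) \<and>
                  usc_on {x. dom_inf U b \<le> ereal x} (\<lambda>x. U x b)) \<and>
     (\<forall>b\<in>space N. Limsup at_top (\<lambda>x. U x b / ereal x) = 0)"


section \<open>The optimization problem\<close>

definition expected_utility ::
  "'a measure \<Rightarrow> ('a \<Rightarrow> 'e) \<Rightarrow> (real \<Rightarrow> 'e \<Rightarrow> ereal) \<Rightarrow> ('a \<Rightarrow> real) \<Rightarrow> ereal" where
  "expected_utility M B U X = ext_expectation M (\<lambda>\<omega>. U (X \<omega>) (B \<omega>))"

definition admissible ::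
  "'a measure \<Rightarrow> ('a \<Rightarrow> real) \<Rightarrow> ('a \<Rightarrow> 'e) \<Rightarrow> (real \<Rightarrow> 'e \<Rightarrow> ereal) \<Rightarrow> real \<Rightarrow> ('a \<Rightarrow> real) \<Rightarrow> bool" where
  "admissible M \<xi> B U x0 X \<longleftrightarrow>
     X \<in> borel_measurable M \<and>
     ext_expectation M (\<lambda>\<omega>. ereal (\<xi> \<omega> * X \<omega>)) \<le> ereal x0 \<and>
     (AE \<omega> in M. U (X \<omega>) (B \<omega>) > -\<infinity>)"

definition well_defined_problem ::
  "'a measure \<Rightarrow> ('a \<Rightarrow> real) \<Rightarrow> ('a \<Rightarrow> 'e) \<Rightarrow> (real \<Rightarrow> 'e \<Rightarrow> ereal) \<Rightarrow> real \<Rightarrow> bool" where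
  "well_defined_problem M \<xi> B U x0 \<longleftrightarrow>
     (\<forall>X. admissible M \<xi> B U x0 X \<longrightarrow> expectation_exists M (\<lambda>\<omega>. U (X \<omega>) (B \<omega>)))"

definition problem_value ::
  "'a measure \<Rightarrow> ('a \<Rightarrow> real) \<Rightarrow> ('a \<Rightarrow> 'e) \<Rightarrow> (real \<Rightarrow> 'e \<Rightarrow> ereal) \<Rightarrow> real \<Rightarrow> ereal" where
  "problem_value M \<xi> B U x0 =
     (SUP X\<in>{X. admissible M \<xi> B U x0 X}. expected_utility M B U X)"

definition feasible_set ::
  "'a measure \<Rightarrow> ('a \<Rightarrow> real) \<Rightarrow> ('a \<Rightarrow> 'e) \<Rightarrow> (real \<Rightarrow> 'e \<Rightarrow> ereal) \<Rightarrow> real set" where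
  "feasible_set M \<xi> B U =
     {x0. \<exists>X. admissible M \<xi> B U x0 X \<and> expected_utility M B U X > -\<infinity>}"

definition optimal_solution ::
  "'a measure \<Rightarrow> ('a \<Rightarrow> real) \<Rightarrow> ('a \<Rightarrow> 'e) \<Rightarrow> (real \<Rightarrow> 'e \<Rightarrow> ereal) \<Rightarrow> real \<Rightarrow> ('a \<Rightarrow> real) \<Rightarrow> bool" where
  "optimal_solution M \<xi> B U x0 X \<longleftrightarrow>
     admissible M \<xi> B U x0 X \<and> expected_utility M B U X = problem_value M \<xi> B U x0"

text \<open>
  An extended-real-valued \<open>X\<close> is a solution if it is finite almost surely and its real version
  is a solution; the values on the exceptional null set are immaterial.
\<close>
definition optimal_solution_ext ::
  "'a measure \<Rightarrow> ('a \<Rightarrow> real) \<Rightarrow> ('a \<Rightarrow> 'e) \<Rightarrow> (real \<Rightarrow> 'e \<Rightarrow> ereal) \<Rightarrow> real \<Rightarrow> ('a \<Rightarrow> ereal) \<Rightarrow> bool" where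
  "optimal_solution_ext M \<xi> B U x0 X \<longleftrightarrow>
     (AE \<omega> in M. \<bar>X \<omega>\<bar> \<noteq> \<infinity>) \<and> optimal_solution M \<xi> B U x0 (\<lambda>\<omega>. real_of_ereal (X \<omega>))"

text \<open>Solutions are counted up to almost sure equality.\<close>
definition infinitely_many_optimal_solutions ::
  "'a measure \<Rightarrow> ('a \<Rightarrow> real) \<Rightarrow> ('a \<Rightarrow> 'e) \<Rightarrow> (real \<Rightarrow> 'e \<Rightarrow> ereal) \<Rightarrow> real \<Rightarrow> bool" where
  "infinitely_many_optimal_solutions M \<xi> B U x0 \<longleftrightarrow>
     infinite ({X. optimal_solution M \<xi> B U x0 X} // {(X, Y). AE \<omega> in M. X \<omega> = Y \<omega>})"

definition bliss_solution ::
  "'a measure \<Rightarrow> ('a \<Rightarrow> real) \<Rightarrow> ('a \<Rightarrow> 'e) \<Rightarrow> (real \<Rightarrow> 'e \<Rightarrow> ereal) \<Rightarrow> real \<Rightarrow> ('a \<Rightarrow> real) \<Rightarrow> bool" where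
  "bliss_solution M \<xi> B U x0 X \<longleftrightarrow>
     admissible M \<xi> B U x0 X \<and> (AE \<omega> in M. ereal (X \<omega>) \<ge> bliss_point U (B \<omega>))"


section \<open>Conjugate sets\<close>

text \<open>The arguments \<open>y\<close> and \<open>l\<close> below are meant to range over \<open>[0, \<infinity>]\<close>.\<close>

definition conjugate :: "(real \<Rightarrow> 'e \<Rightarrow> ereal) \<Rightarrow> 'e \<Rightarrow> ereal \<Rightarrow> ereal" where
  "conjugate U b y = (SUP x::real. U x b - y * ereal x)"

definition conjugate_set :: "(real \<Rightarrow> 'e \<Rightarrow> ereal) \<Rightarrow> 'e \<Rightarrow> ereal \<Rightarrow> ereal set" where
  "conjugate_set U b y =
     (if y = \<infinity> then {dom_inf U b}
      else {ereal x |x. U x b - y * ereal x = conjugate U b y} \<union>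
           {z. z = \<infinity> \<and> (\<exists>x :: nat \<Rightarrow> real. incseq x \<and> filterlim x at_top sequentially \<and>
                  (\<lambda>n. U (x n) b - y * ereal (x n)) \<longlonglongrightarrow> conjugate U b y)} \<union>
           {z. z = -\<infinity> \<and> (\<exists>x :: nat \<Rightarrow> real. decseq x \<and> filterlim x at_bot sequentially \<and>
                  (\<lambda>n. U (x n) b - y * ereal (x n)) \<longlonglongrightarrow> conjugate U b y)})"

definition conj_upper :: "(real \<Rightarrow> 'e \<Rightarrow> ereal) \<Rightarrow> 'e \<Rightarrow> ereal \<Rightarrow> ereal" where
  "conj_upper U b y = Sup (conjugate_set U b y)"

definition conj_lower :: "(real \<Rightarrow> 'e \<Rightarrow> ereal) \<Rightarrow> 'e \<Rightarrow> ereal \<Rightarrow> ereal" where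
  "conj_lower U b y = Inf (conjugate_set U b y)"

definition upper_cost ::
  "'a measure \<Rightarrow> ('a \<Rightarrow> real) \<Rightarrow> ('a \<Rightarrow> 'e) \<Rightarrow> (real \<Rightarrow> 'e \<Rightarrow> ereal) \<Rightarrow> ereal \<Rightarrow> ereal" where
  "upper_cost M \<xi> B U l =
     ext_expectation M (\<lambda>\<omega>. ereal (\<xi> \<omega>) * conj_upper U (B \<omega>) (l * ereal (\<xi> \<omega>)))"

definition lower_cost ::
  "'a measure \<Rightarrow> ('a \<Rightarrow> real) \<Rightarrow> ('a \<Rightarrow> 'e) \<Rightarrow> (real \<Rightarrow> 'e \<Rightarrow> ereal) \<Rightarrow> ereal \<Rightarrow> ereal" where
  "lower_cost M \<xi> B U l =
     ext_expectation M (\<lambda>\<omega>. ereal (\<xi> \<omega>) * conj_lower U (B \<omega>) (l * ereal (\<xi> \<omega>)))"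

definition case1 ::
  "'a measure \<Rightarrow> ('a \<Rightarrow> real) \<Rightarrow> ('a \<Rightarrow> 'e) \<Rightarrow> (real \<Rightarrow> 'e \<Rightarrow> ereal) \<Rightarrow> real \<Rightarrow> bool" where
  "case1 M \<xi> B U l0 \<longleftrightarrow>
     l0 = 0 \<and> (\<forall>l::real. l > 0 \<longrightarrow> lower_cost M \<xi> B U (ereal l) < \<infinity>)"

definition case2 ::
  "'a measure \<Rightarrow> ('a \<Rightarrow> real) \<Rightarrow> ('a \<Rightarrow> 'e) \<Rightarrow> (real \<Rightarrow> 'e \<Rightarrow> ereal) \<Rightarrow> real \<Rightarrow> bool" where
  "case2 M \<xi> B U l0 \<longleftrightarrow>
     l0 > 0 \<and>
     (\<forall>l::real. l > l0 \<longrightarrow> lower_cost M \<xi> B U (ereal l) < \<infinity>) \<and>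
     (\<forall>l::real. 0 < l \<and> l < l0 \<longrightarrow> lower_cost M \<xi> B U (ereal l) = \<infinity>)"

text \<open>
  The multiplier \<open>l\<close> is real here: at \<open>l = \<infinity>\<close> the cost is the expectation of
  \<open>\<xi> \<omega> * dom_inf U (B \<omega>)\<close>, which is finite whenever the problem is feasible.
\<close>
definition case3 ::
  "'a measure \<Rightarrow> ('a \<Rightarrow> real) \<Rightarrow> ('a \<Rightarrow> 'e) \<Rightarrow> (real \<Rightarrow> 'e \<Rightarrow> ereal) \<Rightarrow> bool" where
  "case3 M \<xi> B U \<longleftrightarrow> (\<forall>l::real. l > 0 \<longrightarrow> lower_cost M \<xi> B U (ereal l) = \<infinity>)"

end

theory Submission
  imports Defs "HOL-Real_Asymp.Real_Asymp"
begin

text \<open>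
  Everything is Lagrangian duality with the budget multiplier \<open>l\<close>. If \<open>X'\<close> maximizes
  \<open>U(x, B) - l \<xi> x\<close> over \<open>x\<close> in almost every state, then
  \<open>U(X, B) \<le> U(X', B) + l \<xi> (X - X')\<close> for every competitor \<open>X\<close>, and integration gives
  \<open>E U(X, B) \<le> E U(X', B) + l (E(\<xi> X) - E(\<xi> X'))\<close> (\<open>weak_duality\<close>). Hence such an \<open>X'\<close> that spends
  exactly \<open>x0\<close> is optimal (\<open>optimal_if_dual_optimal\<close>). The selections \<open>conj_lower\<close> and
  \<open>conj_upper\<close> are the least and the greatest statewise maximizers, so a budget equal to their
  cost is dealt with at once. For a budget strictly between the two costs, one uses the greatest
  maximizer on a set \<open>A\<close> and the least one elsewhere. Nonatomicity supplies sets \<open>A\<close> on which the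
  extra cost is exactly what is left of the budget, and in fact infinitely many essentially
  different ones (\<open>infinitely_many_between\<close>). At a jump \<open>l\<close> of the cost function \<open>g\<close> this covers
  the whole gap, because \<open>g(l-)\<close> is the cost of the greatest maximizer: the least maximizers at
  slopes \<open>y' < y\<close> decrease to the greatest maximizer at \<open>y\<close> as \<open>y'\<close> increases to \<open>y\<close>
  (\<open>conj_lower_at_left\<close>), and the costs converge by dominated convergence.

  Multipliers \<open>l\<close> with \<open>g(l) = \<infinity>\<close> are used in the opposite direction. Starting from \<open>Y\<close>, move
  to the least maximizer at \<open>l\<close> on a set where this costs exactly \<open>d\<close> more; the same
  inequality shows that the expected utility grows by at least \<open>l d\<close>
  (\<open>expensive_improvement\<close>). If \<open>g = \<infinity>\<close> everywhere, then \<open>l\<close> can be taken arbitrarily large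
  and the value is infinite, provided that some solution leaves a positive part of the budget
  unspent; the latter can be arranged unless the budget only just covers the lower ends of the
  domains (\<open>solution_below_budget\<close>). If \<open>g = \<infinity>\<close> exactly below \<open>l0\<close>, then applying the step to the
  greatest maximizer at \<open>l0\<close>, with \<open>d = x0 - \<theta>\<close> and with \<open>l\<close> increasing to \<open>l0\<close>, yields the
  maximizing sequence: its members lie between the maximizers at \<open>l0\<close> and at \<open>l\<close>, hence converge,
  and their expected utilities approach the upper bound of weak duality. That bound is not
  attained with a finite value, since equality forces a solution to consist of maximizers at
  \<open>l0\<close>, whose cost is at most \<open>\<theta> < x0\<close> (\<open>no_finite_optimum\<close>).
\<close>

section \<open>Maximizers of a tilted utility in one state\<close>

text \<open>
  The condition that \<open>x\<close> maximizes \<open>U z b - y * z\<close>, with the linear term moved to one side so that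
  only a real number is added to a value of \<open>U\<close>.
\<close>
definition maximizer :: "(real \<Rightarrow> 'e \<Rightarrow> ereal) \<Rightarrow> 'e \<Rightarrow> real \<Rightarrow> real \<Rightarrow> bool" where
  "maximizer U b y x \<longleftrightarrow> (\<forall>z. U z b \<le> U x b + ereal (y * (z - x)))"

locale state_utility =
  fixes U :: "real \<Rightarrow> 'e \<Rightarrow> ereal" and b :: 'e
  assumes U_finite: "U x b \<noteq> \<infinity>"
    and dom_inf_finite: "-\<infinity> < dom_inf U b" "dom_inf U b < \<infinity>"
    and mono_on_dom: "mono_on {x. dom_inf U b \<le> ereal x} (\<lambda>x. U x b)"
    and usc_on_dom: "usc_on {x. dom_inf U b \<le> ereal x} (\<lambda>x. U x b)"
    and sublinear: "Limsup at_top (\<lambda>x. U x b / ereal x) = 0"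
begin

definition dom_bound :: real where
  "dom_bound = real_of_ereal (dom_inf U b)"

lemma dom_inf_eq: "dom_inf U b = ereal dom_bound"
  using dom_inf_finite unfolding dom_bound_def by (cases "dom_inf U b") auto

lemma below_dom_bound:
  assumes "x < dom_bound" shows "U x b = -\<infinity>"
proof (rule ccontr)
  assume "U x b \<noteq> -\<infinity>"
  then have "dom_inf U b \<le> ereal x"
    unfolding dom_inf_def by (intro INF_lower) auto
  with assms show False by (simp add: dom_inf_eq)
qed

lemma dom_bound_le:
  assumes "U x b > -\<infinity>" shows "dom_bound \<le> x"
  using below_dom_bound[of x] assms by (metis less_irrefl not_le)

lemma U_mono: "x \<le> z \<Longrightarrow> U x b \<le> U z b"
proof (cases "x < dom_bound")
  case False
  assume "x \<le> z"
  with False show ?thesis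
    using mono_on_dom by (auto simp: dom_inf_eq mono_on_def)
qed (simp add: below_dom_bound)

lemma above_dom_bound:
  assumes "dom_bound < x" shows "U x b > -\<infinity>"
proof -
  have "dom_inf U b < ereal x" using assms by (simp add: dom_inf_eq)
  then obtain x' where "U x' b > -\<infinity>" "x' < x"
    unfolding dom_inf_def INF_less_iff by auto
  then show ?thesis using U_mono[of x' x] by auto
qed

text \<open>
  To the left of \<open>dom_bound\<close> the utility is constantly \<open>-\<infinity>\<close>; elsewhere upper semicontinuity
  of a nondecreasing function amounts to continuity from the right.
\<close>
lemma U_right_continuous:
  assumes "U x b < c" shows "\<exists>z>x. U z b < c"
proof (cases "x < dom_bound")
  case True
  then show ?thesis
    using below_dom_bound[of "(x + dom_bound) / 2"] assms
    by (intro exI[of _ "(x + dom_bound) / 2"]) (auto simp: below_dom_bound)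
next
  case False
  then have x: "dom_bound \<le> x" by simp
  let ?S = "{z. dom_inf U b \<le> ereal z}"
  have "Limsup (at x within ?S) (\<lambda>x. U x b) < c"
    using usc_on_dom x assms unfolding usc_on_def
    by (metis dom_inf_eq ereal_less_eq(3) le_less_trans mem_Collect_eq)
  then have "\<forall>\<^sub>F z in at x within ?S. U z b < c"
    by (rule Limsup_lessD)
  then obtain d where d: "d > 0" "\<And>z. z \<in> ?S \<Longrightarrow> z \<noteq> x \<Longrightarrow> dist z x < d \<Longrightarrow> U z b < c"
    unfolding eventually_at by auto
  have "U (x + d/2) b < c"
    using d(1) x by (intro d(2)) (auto simp: dom_inf_eq dist_real_def)
  then show ?thesis using d(1) by (intro exI[of _ "x + d/2"]) auto
qed

text \<open>
  The form in which semicontinuity enters all limit arguments below. If the bound failed at the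
  limit, it would fail already at some point \<open>z > x\<close>, and by monotonicity at every \<open>X n < z\<close>.
\<close>
lemma U_le_limit:
  assumes lim: "X \<longlonglongrightarrow> x" "C \<longlonglongrightarrow> c" and le: "\<And>n. w \<le> U (X n) b + ereal (C n)"
  shows "w \<le> U x b + ereal c"
proof (rule ccontr)
  assume "\<not> ?thesis"
  then have "U x b + ereal c < w" by simp
  then have "U x b < w - ereal c"
    by (cases "U x b"; cases w) (auto simp: algebra_simps)
  then obtain z where z: "x < z" "U z b < w - ereal c"
    using U_right_continuous by blast
  have "(\<lambda>n. U z b + ereal (C n)) \<longlonglongrightarrow> U z b + ereal c"
    by (intro tendsto_add_ereal_general1 tendsto_const tendsto_ereal lim) simp
  moreover have "\<forall>\<^sub>F n in sequentially. w \<le> U z b + ereal (C n)"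
    using order_tendstoD(2)[OF lim(1) z(1)]
  proof eventually_elim
    case (elim n)
    have "U (X n) b + ereal (C n) \<le> U z b + ereal (C n)"
      using elim by (intro add_right_mono U_mono) simp
    then show ?case using le[of n] by order
  qed
  ultimately have "w \<le> U z b + ereal c"
    by (intro tendsto_lowerbound[where F=sequentially]) auto
  with z(2) show False
    by (cases "U z b"; cases w) auto
qed

lemma maximizer_finite:
  assumes "maximizer U b y x" shows "U x b > -\<infinity>"
proof (rule ccontr)
  assume "\<not> ?thesis"
  then have "U x b = -\<infinity>" by simp
  then have "U (dom_bound + 1) b \<le> -\<infinity>"
    using assms[unfolded maximizer_def, rule_format, of "dom_bound + 1"] by simp
  then show False using above_dom_bound[of "dom_bound + 1"] by simp
qed

lemma maximizer_ge_dom_bound: "maximizer U b y x \<Longrightarrow> dom_bound \<le> x"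
  using maximizer_finite dom_bound_le by blast

text \<open>
  The graph of the set-valued map from slopes to maximizers is closed.
\<close>
lemma maximizer_limit:
  assumes "X \<longlonglongrightarrow> x" "Y \<longlonglongrightarrow> y" "\<And>n. maximizer U b (Y n) (X n)"
  shows "maximizer U b y x"
  unfolding maximizer_def
proof
  fix z
  show "U z b \<le> U x b + ereal (y * (z - x))"
    using assms(3) unfolding maximizer_def
    by (intro U_le_limit[of X x "\<lambda>n. Y n * (z - X n)"] assms tendsto_intros) auto
qed

lemma closed_maximizers: "closed {x. maximizer U b y x}"
  unfolding closed_sequential_limits using maximizer_limit[of _ _ "\<lambda>_. y"] by auto

text \<open>
  A higher price never increases demand: add the two inequalities that express the optimality of
  each point against the other.
\<close>
lemma maximizer_antimono:
  assumes "maximizer U b y x" "maximizer U b y' x'" "y < y'"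
  shows "x' \<le> x"
proof -
  from maximizer_finite[OF assms(1)] obtain u where u: "U x b = ereal u"
    using U_finite[of x] by (cases "U x b") auto
  from maximizer_finite[OF assms(2)] obtain u' where u': "U x' b = ereal u'"
    using U_finite[of x'] by (cases "U x' b") auto
  have "u' \<le> u + y * (x' - x)" "u \<le> u' + y' * (x - x')"
    using assms(1,2) u u' unfolding maximizer_def
    by (metis ereal_less_eq(3) plus_ereal.simps(1))+
  then have "0 \<le> (y' - y) * (x - x')" by (simp add: algebra_simps)
  with assms(3) show ?thesis by (simp add: zero_le_mult_iff)
qed

text \<open>
  Approximate maximizers that stay below a bound \<open>K\<close> lie in a compact interval, since their
  utility is not \<open>-\<infinity>\<close>, so they accumulate at a maximizer. The closed constraint \<open>T\<close> is what
  makes the lemma usable twice: with no constraint it gives existence, and with \<open>T = {..c}\<close> it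
  gives measurability.
\<close>
lemma near_maximizers_attained:
  assumes T: "closed T"
    and near: "\<And>e. e > 0 \<Longrightarrow> \<exists>x\<in>T. x \<le> K \<and> (\<forall>z. U z b \<le> U x b + ereal (y * (z - x) + e))"
  shows "\<exists>x\<in>T. maximizer U b y x"
proof -
  have "\<forall>n::nat. \<exists>x\<in>T. x \<le> K \<and> (\<forall>z. U z b \<le> U x b + ereal (y * (z - x) + 1 / (real n + 1)))"
    by (intro allI near) auto
  then obtain X where X: "\<And>n. X n \<in> T" "\<And>n. X n \<le> K"
    "\<And>n z. U z b \<le> U (X n) b + ereal (y * (z - X n) + 1 / (real n + 1))"
    by metis
  have "X n \<ge> dom_bound" for n
  proof (rule dom_bound_le, rule ccontr)
    assume "\<not> U (X n) b > -\<infinity>"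
    then have "U (dom_bound + 1) b \<le> -\<infinity>" using X(3)[of "dom_bound + 1" n] by simp
    then show False using above_dom_bound[of "dom_bound + 1"] by simp
  qed
  then have "\<And>n. X n \<in> {dom_bound..K}" using X(2) by auto
  then obtain x r where r: "strict_mono r" "(X \<circ> r) \<longlonglongrightarrow> x"
    using compact_Icc[of dom_bound K] unfolding compact_def by meson
  have "x \<in> T"
    using T r(2) X(1) unfolding closed_sequential_limits by (metis comp_def)
  moreover have "maximizer U b y x"
    unfolding maximizer_def
  proof
    fix z
    have "(\<lambda>n. 1 / (real n + 1)) \<longlonglongrightarrow> 0"
      using LIMSEQ_inverse_real_of_nat by (simp add: inverse_eq_divide add.commute)
    from LIMSEQ_subseq_LIMSEQ[OF this r(1)]
    have "(\<lambda>n. y * (z - (X \<circ> r) n) + 1 / (real (r n) + 1)) \<longlonglongrightarrow> y * (z - x) + 0"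
      by (intro tendsto_intros r(2)) (simp add: comp_def)
    then show "U z b \<le> U x b + ereal (y * (z - x))"
      using X(3)[of z "r _"] by (intro U_le_limit[OF r(2)]) auto
  qed
  ultimately show ?thesis by blast
qed

text \<open>
  Sublinear growth: every line of positive slope eventually dominates the utility.
\<close>
lemma growth_bound:
  assumes "y > 0" shows "\<exists>K. \<forall>x>K. U x b < ereal (c + y * x)"
proof -
  have "\<forall>\<^sub>F x in at_top. U x b / ereal x < ereal (y / 2)"
    using sublinear assms by (intro Limsup_lessD) (simp add: zero_ereal_def)
  then obtain K where K: "\<And>x. x > K \<Longrightarrow> U x b / ereal x < ereal (y / 2)"
    unfolding eventually_at_top_dense by auto
  let ?K = "max K (max 0 (- 2 * c / y))"
  have "U x b < ereal (c + y * x)" if x: "x > ?K" for x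
  proof (cases "U x b")
    case (real u)
    have "x > 0" "u / x < y / 2" "- 2 * c / y < x" using K[of x] x real by auto
    then have "u < y / 2 * x" "- 2 * c < x * y" using assms by (auto simp: field_simps)
    then have "u < c + y * x" by (simp add: field_simps)
    then show ?thesis using real by simp
  qed (use U_finite in auto)
  then show ?thesis by blast
qed

text \<open>
  The tilted utility has a finite supremum, and by sublinear growth the points whose value is
  within \<open>1\<close> of it are bounded above, uniformly in the tolerance.
\<close>
lemma near_maximizer_exists:
  assumes "y > 0"
  shows "\<exists>K. \<forall>e>0. \<exists>x\<le>K. \<forall>z. U z b \<le> U x b + ereal (y * (z - x) + e)"
proof -
  define p where "p = dom_bound + 1"
  obtain u where u: "U p b = ereal u"
    using above_dom_bound[of p] U_finite[of p] by (cases "U p b") (auto simp: p_def)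
  obtain K where K: "\<And>x. x > K \<Longrightarrow> U x b < ereal ((u - y * p - 1) + y * x)"
    using growth_bound[OF assms] by metis
  let ?F = "\<lambda>x. U x b + ereal (- y * x)"
  define V where "V = (SUP x. ?F x)"
  have "?F p \<le> V" unfolding V_def by (rule SUP_upper) simp
  then have V_lower: "ereal (u - y * p) \<le> V" by (simp add: u)
  have *: "?F x \<le> max (U (max K p) b + ereal (- y * dom_bound)) (ereal (u - y * p - 1))" for x
  proof (cases "x > K")
    case True
    then have "?F x \<le> ereal (u - y * p - 1)" using K[OF True] by (cases "U x b") auto
    then show ?thesis by (simp add: le_max_iff_disj)
  next
    case False
    show ?thesis
    proof (cases "x < dom_bound")
      case True then show ?thesis by (simp add: below_dom_bound)
    next
      assume "\<not> x < dom_bound"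
      then have "?F x \<le> U (max K p) b + ereal (- y * dom_bound)"
        using False assms by (intro add_mono U_mono) auto
      then show ?thesis by (simp add: le_max_iff_disj)
    qed
  qed
  then have "V \<le> max (U (max K p) b + ereal (- y * dom_bound)) (ereal (u - y * p - 1))"
    unfolding V_def by (rule SUP_least)
  also have "\<dots> < \<infinity>" using U_finite[of "max K p"] by (auto simp: max_def)
  finally obtain v where v: "V = ereal v" using V_lower by (cases V) auto
  have "\<exists>x\<le>K. \<forall>z. U z b \<le> U x b + ereal (y * (z - x) + e)" if "e > 0" for e
  proof -
    \<comment> \<open>Tolerances above \<open>1\<close> are capped, so that one bound \<open>K\<close> serves all of them.\<close>
    have "ereal (v - min e 1) < V" using v that by simp
    then obtain x where x: "ereal (v - min e 1) < ?F x" unfolding V_def less_SUP_iff by auto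
    then obtain w where w: "U x b = ereal w" using U_finite[of x] by (cases "U x b") auto
    have w_gt: "v - min e 1 < w - y * x" using x w by simp
    have "x \<le> K"
    proof (rule ccontr)
      assume "\<not> x \<le> K"
      then have "w < u - y * p - 1 + y * x" using K[of x] w by simp
      moreover have "u - y * p \<le> v" using V_lower v by simp
      ultimately show False using w_gt by simp
    qed
    moreover have "U z b \<le> U x b + ereal (y * (z - x) + e)" for z
    proof -
      have "?F z \<le> ereal v" unfolding v[symmetric] V_def by (rule SUP_upper) simp
      then show ?thesis using w w_gt U_finite[of z]
        by (cases "U z b") (auto simp: algebra_simps)
    qed
    ultimately show ?thesis by blast
  qed
  then show ?thesis by blast
qed

lemma maximizer_exists: "y > 0 \<Longrightarrow> \<exists>x. maximizer U b y x"
  using near_maximizer_exists[of y] near_maximizers_attained[of UNIV _ y] by auto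

text \<open>
  Any maximizer at the smaller slope \<open>y / 2\<close> bounds them all.
\<close>
lemma bdd_above_maximizers:
  assumes "y > 0" shows "bdd_above {x. maximizer U b y x}"
proof -
  obtain x' where "maximizer U b (y / 2) x'" using maximizer_exists[of "y / 2"] assms by auto
  then show ?thesis
    using maximizer_antimono[of "y / 2" x' y] assms by (intro bdd_aboveI[of _ x']) auto
qed

lemma bdd_below_maximizers: "bdd_below {x. maximizer U b y x}"
  using maximizer_ge_dom_bound by (intro bdd_belowI[of _ dom_bound]) auto

lemma least_maximizer:
  assumes "\<exists>x. maximizer U b y x"
  obtains x where "maximizer U b y x" "\<And>z. maximizer U b y z \<Longrightarrow> x \<le> z"
proof -
  have "Inf {x. maximizer U b y x} \<in> {x. maximizer U b y x}"
    using assms by (intro closed_contains_Inf bdd_below_maximizers closed_maximizers) auto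
  then show ?thesis using cInf_lower[OF _ bdd_below_maximizers] that by auto
qed

lemma greatest_maximizer:
  assumes "y > 0"
  obtains x where "maximizer U b y x" "\<And>z. maximizer U b y z \<Longrightarrow> z \<le> x"
proof -
  have "Sup {x. maximizer U b y x} \<in> {x. maximizer U b y x}"
    using assms maximizer_exists[OF assms]
    by (intro closed_contains_Sup bdd_above_maximizers closed_maximizers) auto
  then show ?thesis using cSup_upper[OF _ bdd_above_maximizers[OF assms]] that by auto
qed

lemma maximizer_iff_conjugate:
  "maximizer U b y x \<longleftrightarrow> U x b - ereal y * ereal x = conjugate U b (ereal y)"
proof
  assume m: "maximizer U b y x"
  show "U x b - ereal y * ereal x = conjugate U b (ereal y)"
    unfolding conjugate_def
  proof (rule antisym)
    show "(SUP x. U x b - ereal y * ereal x) \<le> U x b - ereal y * ereal x"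
    proof (rule SUP_least)
      fix z
      have "U z b \<le> U x b + ereal (y * (z - x))" using m unfolding maximizer_def by blast
      then show "U z b - ereal y * ereal z \<le> U x b - ereal y * ereal x"
        by (cases "U z b"; cases "U x b") (auto simp: algebra_simps)
    qed
  qed (rule SUP_upper, simp)
next
  assume eq: "U x b - ereal y * ereal x = conjugate U b (ereal y)"
  show "maximizer U b y x"
    unfolding maximizer_def
  proof
    fix z
    have "U z b - ereal y * ereal z \<le> U x b - ereal y * ereal x"
      unfolding eq conjugate_def by (rule SUP_upper) simp
    then show "U z b \<le> U x b + ereal (y * (z - x))"
      by (cases "U z b"; cases "U x b") (auto simp: algebra_simps)
  qed
qed

lemma conjugate_gt_MInf: "conjugate U b (ereal y) > -\<infinity>"
proof -
  have "-\<infinity> < U (dom_bound + 1) b - ereal y * ereal (dom_bound + 1)"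
    using above_dom_bound[of "dom_bound + 1"] by (cases "U (dom_bound + 1) b") auto
  also have "\<dots> \<le> conjugate U b (ereal y)" unfolding conjugate_def by (rule SUP_upper) simp
  finally show ?thesis .
qed

lemma MInf_notin_conjugate_set: "-\<infinity> \<notin> conjugate_set U b (ereal y)"
proof
  assume "-\<infinity> \<in> conjugate_set U b (ereal y)"
  then obtain X where X: "filterlim X at_bot sequentially"
    "(\<lambda>n. U (X n) b - ereal y * ereal (X n)) \<longlonglongrightarrow> conjugate U b (ereal y)"
    unfolding conjugate_set_def by auto
  have "\<forall>\<^sub>F n in sequentially. X n < dom_bound"
    using X(1) unfolding filterlim_at_bot_dense by auto
  then have "\<forall>\<^sub>F n in sequentially. U (X n) b - ereal y * ereal (X n) = -\<infinity>"
    by eventually_elim (simp add: below_dom_bound)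
  then have "(\<lambda>n. U (X n) b - ereal y * ereal (X n)) \<longlonglongrightarrow> -\<infinity>"
    by (rule tendsto_eventually)
  with X(2) have "conjugate U b (ereal y) = -\<infinity>" by (rule LIMSEQ_unique)
  then show False using conjugate_gt_MInf[of y] by simp
qed

text \<open>
  Along any sequence tending to \<open>\<infinity>\<close> the tilted utility drops below every constant.
\<close>
lemma PInf_notin_conjugate_set:
  assumes "y > 0" shows "\<infinity> \<notin> conjugate_set U b (ereal y)"
proof
  assume "\<infinity> \<in> conjugate_set U b (ereal y)"
  then obtain X where X: "filterlim X at_top sequentially"
    "(\<lambda>n. U (X n) b - ereal y * ereal (X n)) \<longlonglongrightarrow> conjugate U b (ereal y)"
    unfolding conjugate_set_def by auto
  have "conjugate U b (ereal y) \<le> ereal c" for c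
  proof -
    obtain K where K: "\<And>x. x > K \<Longrightarrow> U x b < ereal (c + y * x)"
      using growth_bound[OF assms] by metis
    have "\<forall>\<^sub>F n in sequentially. K < X n"
      using X(1) unfolding filterlim_at_top_dense by auto
    then have "\<forall>\<^sub>F n in sequentially. U (X n) b - ereal y * ereal (X n) \<le> ereal c"
    proof eventually_elim
      case (elim n)
      then show ?case using K[of "X n"] by (cases "U (X n) b") auto
    qed
    then show ?thesis by (intro tendsto_upperbound[OF X(2)]) auto
  qed
  then have "conjugate U b (ereal y) = -\<infinity>"
    by (metis ereal_bot)
  then show False using conjugate_gt_MInf[of y] by simp
qed

lemma conjugate_set_eq:
  assumes "y > 0" shows "conjugate_set U b (ereal y) = ereal ` {x. maximizer U b y x}"
proof (rule set_eqI)
  fix z show "z \<in> conjugate_set U b (ereal y) \<longleftrightarrow> z \<in> ereal ` {x. maximizer U b y x}"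
    using PInf_notin_conjugate_set[OF assms] MInf_notin_conjugate_set[of y]
    by (cases z) (auto simp: conjugate_set_def maximizer_iff_conjugate)
qed

lemma conj_lower_eq:
  assumes "maximizer U b y x" "\<And>z. maximizer U b y z \<Longrightarrow> x \<le> z"
  shows "conj_lower U b (ereal y) = ereal x"
  unfolding conj_lower_def
proof (rule antisym)
  have "ereal x \<in> conjugate_set U b (ereal y)"
    using assms(1) by (auto simp: conjugate_set_def maximizer_iff_conjugate)
  then show "Inf (conjugate_set U b (ereal y)) \<le> ereal x" by (rule Inf_lower)
  show "ereal x \<le> Inf (conjugate_set U b (ereal y))"
  proof (rule Inf_greatest)
    fix z assume z: "z \<in> conjugate_set U b (ereal y)"
    then show "ereal x \<le> z"
      using MInf_notin_conjugate_set[of y] assms(2)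
      by (cases z) (auto simp: conjugate_set_def maximizer_iff_conjugate)
  qed
qed

text \<open>
  For \<open>y > 0\<close> only the first case occurs. The second one is needed at \<open>y = 0\<close>, where the
  conjugate set consists of \<open>\<infinity>\<close> alone if the utility does not attain its supremum.
\<close>
lemma conj_lower_cases:
  obtains x where "maximizer U b y x" "\<And>z. maximizer U b y z \<Longrightarrow> x \<le> z"
    "conj_lower U b (ereal y) = ereal x"
  | "\<not> (\<exists>x. maximizer U b y x)" "conj_lower U b (ereal y) = \<infinity>"
proof (cases "\<exists>x. maximizer U b y x")
  case True
  from least_maximizer[OF this] conj_lower_eq that(1) show ?thesis by metis
next
  case False
  have "z = \<infinity>" if "z \<in> conjugate_set U b (ereal y)" for z
    using that MInf_notin_conjugate_set[of y] False
    by (cases z) (auto simp: conjugate_set_def maximizer_iff_conjugate)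
  then have "\<infinity> \<le> conj_lower U b (ereal y)"
    unfolding conj_lower_def by (intro Inf_greatest) auto
  with that(2) False show ?thesis by simp
qed

lemma conj_lower_pos:
  assumes "y > 0"
  obtains x where "maximizer U b y x" "\<And>z. maximizer U b y z \<Longrightarrow> x \<le> z"
    "conj_lower U b (ereal y) = ereal x"
  using conj_lower_cases[of y] maximizer_exists[OF assms] by metis

lemma conj_upper_pos:
  assumes "y > 0"
  obtains x where "maximizer U b y x" "\<And>z. maximizer U b y z \<Longrightarrow> z \<le> x"
    "conj_upper U b (ereal y) = ereal x"
proof -
  obtain x where x: "maximizer U b y x" "\<And>z. maximizer U b y z \<Longrightarrow> z \<le> x"
    using greatest_maximizer[OF assms] by metis
  have "Sup (ereal ` {x. maximizer U b y x}) = ereal x"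
    using x by (intro Sup_eqI) auto
  with x that show ?thesis by (simp add: conj_upper_def conjugate_set_eq[OF assms])
qed

lemma conj_lower_le_iff:
  "conj_lower U b (ereal y) \<le> ereal c \<longleftrightarrow> (\<exists>x\<le>c. maximizer U b y x)"
  by (rule conj_lower_cases[of y]) (auto intro: order_trans)

lemma dom_inf_le_conj_lower: "dom_inf U b \<le> conj_lower U b (ereal y)"
  by (rule conj_lower_cases[of y]) (auto simp: dom_inf_eq maximizer_ge_dom_bound)

lemma conj_lower_antimono:
  assumes "0 \<le> y" "y \<le> y'" shows "conj_lower U b (ereal y') \<le> conj_lower U b (ereal y)"
proof (cases "y = y'")
  case False
  show ?thesis
  proof (rule conj_lower_cases[of y])
    fix x assume x: "maximizer U b y x" "conj_lower U b (ereal y) = ereal x"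
    show ?thesis
      by (rule conj_lower_cases[of y'])
        (use x maximizer_antimono[OF x(1)] False assms maximizer_exists[of y'] in \<open>auto\<close>)
  qed auto
qed simp

end

context state_utility begin

lemma is_singleton_conjugate_set:
  assumes "y > 0"
  shows "is_singleton (conjugate_set U b (ereal y)) \<longleftrightarrow>
    conj_lower U b (ereal y) = conj_upper U b (ereal y)"
proof -
  obtain x where x: "maximizer U b y x" "\<And>z. maximizer U b y z \<Longrightarrow> x \<le> z"
    "conj_lower U b (ereal y) = ereal x" using conj_lower_pos[OF assms] by metis
  obtain x' where x': "maximizer U b y x'" "\<And>z. maximizer U b y z \<Longrightarrow> z \<le> x'"
    "conj_upper U b (ereal y) = ereal x'" using conj_upper_pos[OF assms] by metis
  show ?thesis
    unfolding is_singleton_def conjugate_set_eq[OF assms] x(3) x'(3)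
  proof
    assume "\<exists>z. ereal ` {x. maximizer U b y x} = {z}"
    then obtain z where z: "ereal ` {x. maximizer U b y x} = {z}" by blast
    have "ereal x \<in> {z}" "ereal x' \<in> {z}" using x(1) x'(1) z by blast+
    then show "ereal x = ereal x'" by simp
  next
    assume "ereal x = ereal x'"
    then have "{x. maximizer U b y x} = {x}" using x(1,2) x'(2) by (auto intro: antisym)
    then show "\<exists>z. ereal ` {x. maximizer U b y x} = {z}" by auto
  qed
qed

lemma conj_upper_le_conj_lower:
  assumes "0 \<le> y'" "y' < y" shows "conj_upper U b (ereal y) \<le> conj_lower U b (ereal y')"
proof -
  have "y > 0" using assms by simp
  obtain x where x: "maximizer U b y x" "conj_upper U b (ereal y) = ereal x"
    using conj_upper_pos[OF \<open>y > 0\<close>] by metis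
  show ?thesis
    by (rule conj_lower_cases[of y']) (use x maximizer_antimono[OF _ x(1) assms(2)] in auto)
qed

text \<open>
  If the least maximizers at slopes increasing to \<open>y\<close> all stayed above some \<open>e\<close> greater than the
  greatest maximizer at \<open>y\<close>, they would accumulate at a maximizer at \<open>y\<close> that is at least \<open>e\<close>.
\<close>
lemma conj_lower_at_left:
  assumes "y > 0"
  shows "((\<lambda>y. conj_lower U b (ereal y)) \<longlongrightarrow> conj_upper U b (ereal y)) (at_left y)"
proof -
  obtain xu where xu: "maximizer U b y xu" "\<And>z. maximizer U b y z \<Longrightarrow> z \<le> xu"
    "conj_upper U b (ereal y) = ereal xu" using conj_upper_pos[OF assms] by metis
  show ?thesis unfolding xu(3)
  proof (rule order_tendstoI)
    fix a assume a: "a < ereal xu"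
    have "\<forall>\<^sub>F y' in at_left y. y' \<in> {0<..<y}" using assms by (rule eventually_at_left_real)
    then show "\<forall>\<^sub>F y' in at_left y. a < conj_lower U b (ereal y')"
    proof eventually_elim
      case (elim y')
      then show ?case using conj_upper_le_conj_lower[of y' y] a xu(3) by (auto intro: less_le_trans)
    qed
  next
    fix a assume a: "ereal xu < a"
    have "\<exists>y1. 0 < y1 \<and> y1 < y \<and> conj_lower U b (ereal y1) < a"
    proof (rule ccontr)
      assume "\<not> ?thesis"
      then have above: "\<And>y1. 0 < y1 \<Longrightarrow> y1 < y \<Longrightarrow> a \<le> conj_lower U b (ereal y1)"
        using not_le by blast
      obtain e where e: "xu < e" "ereal e < a" using ereal_dense2[OF a] by auto
      define Y where "Y n = y - y / (real n + 2)" for n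
      have Y: "Y n < y" "0 < Y n" "Y 0 \<le> Y n" for n
      proof -
        define q where "q = y / (real n + 2)"
        have "q \<le> y / 2" using assms unfolding q_def by (intro divide_left_mono) auto
        moreover have "0 < q" using assms by (auto simp: q_def)
        moreover have "Y n = y - q" "Y 0 = y / 2" by (simp_all add: Y_def q_def)
        ultimately show "Y n < y" "0 < Y n" "Y 0 \<le> Y n" using assms by linarith+
      qed
      have Ylim: "Y \<longlonglongrightarrow> y" unfolding Y_def by real_asymp
      have "\<exists>x. maximizer U b (Y n) x \<and> conj_lower U b (ereal (Y n)) = ereal x" for n
        by (rule conj_lower_pos[OF Y(2)]) auto
      then obtain X where X: "\<And>n. maximizer U b (Y n) (X n)"
        "\<And>n. conj_lower U b (ereal (Y n)) = ereal (X n)" by metis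
      have "X n \<in> {e..X 0}" for n
      proof -
        have "ereal (X n) \<le> ereal (X 0)"
          using conj_lower_antimono[of "Y 0" "Y n"] Y X(2) by (metis less_le)
        moreover have "ereal e \<le> ereal (X n)"
          using less_le_trans[OF e(2) above[OF Y(2)[of n] Y(1)[of n]]] X(2)[of n] by simp
        ultimately show ?thesis by simp
      qed
      then obtain x r where r: "x \<in> {e..X 0}" "strict_mono r" "(X \<circ> r) \<longlonglongrightarrow> x"
        using compact_Icc[of e "X 0", unfolded compact_def, rule_format, of X] by blast
      have "maximizer U b y x"
        by (rule maximizer_limit[OF r(3) LIMSEQ_subseq_LIMSEQ[OF Ylim r(2)]]) (simp add: X(1))
      then show False using xu(2) r(1) e(1) by fastforce
    qed
    then obtain y1 where y1: "0 < y1" "y1 < y" "conj_lower U b (ereal y1) < a" by blast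
    have "\<forall>\<^sub>F y' in at_left y. y' \<in> {y1<..<y}" using y1(2) by (rule eventually_at_left_real)
    then show "\<forall>\<^sub>F y' in at_left y. conj_lower U b (ereal y') < a"
    proof eventually_elim
      case (elim y')
      then have "conj_lower U b (ereal y') \<le> conj_lower U b (ereal y1)"
        using y1(1) by (intro conj_lower_antimono) auto
      with y1(3) show ?case by order
    qed
  qed
qed

text \<open>
  If maximizers at arbitrarily large slopes stayed above some \<open>e > dom_bound\<close>, then moving to a
  fixed point \<open>p\<close> strictly between the two would save at least \<open>y * (e - p)\<close>, which exceeds any
  possible loss of utility.
\<close>
lemma conj_lower_at_top: "((\<lambda>y. conj_lower U b (ereal y)) \<longlongrightarrow> dom_inf U b) at_top"
proof (rule order_tendstoI)
  fix a assume "a < dom_inf U b"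
  then show "\<forall>\<^sub>F y in at_top. a < conj_lower U b (ereal y)"
    using dom_inf_le_conj_lower by (intro always_eventually allI) (rule less_le_trans)
next
  fix a assume a: "dom_inf U b < a"
  have "\<exists>y1>0. conj_lower U b (ereal y1) < a"
  proof (rule ccontr)
    assume "\<not> ?thesis"
    then have above: "\<And>y1. 0 < y1 \<Longrightarrow> a \<le> conj_lower U b (ereal y1)" using not_le by blast
    obtain e where e: "dom_bound < e" "ereal e < a"
      using ereal_dense2[of "ereal dom_bound" a] a dom_inf_eq by auto
    define p where "p = (dom_bound + e) / 2"
    have p: "dom_bound < p" "p < e" using e(1) by (auto simp: p_def)
    obtain u where u: "U p b = ereal u"
      using above_dom_bound[OF p(1)] U_finite[of p] by (cases "U p b") auto
    have "\<exists>x. maximizer U b (real n + 1) x \<and> conj_lower U b (ereal (real n + 1)) = ereal x" for n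
      by (rule conj_lower_pos[of "real n + 1"]) auto
    then obtain X where X: "\<And>n::nat. maximizer U b (real n + 1) (X n)"
      "\<And>n::nat. conj_lower U b (ereal (real n + 1)) = ereal (X n)"
      by metis
    obtain w where w: "U (X 0) b = ereal w"
      using maximizer_finite[OF X(1)] U_finite by (metis ereal_cases less_irrefl)
    have "u \<le> w + (real n + 1) * (p - e)" for n :: nat
    proof -
      have "ereal (X n) \<le> ereal (X 0)"
        using conj_lower_antimono[of "real 0 + 1" "real n + 1"] X(2)[of n] X(2)[of 0] by simp
      then have "U (X n) b \<le> ereal w" using U_mono[of "X n" "X 0"] w by simp
      then obtain r where r: "U (X n) b = ereal r" "r \<le> w"
        using maximizer_finite[OF X(1)[of n]] by (cases "U (X n) b") auto
      have "e \<le> X n"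
        using above[of "real n + 1"] e(2) X(2)[of n] by (metis add_nonneg_pos ereal_less_eq(3)
            less_imp_le less_le_trans of_nat_0_le_iff zero_less_one)
      then have "(real n + 1) * (p - X n) \<le> (real n + 1) * (p - e)"
        by (intro mult_left_mono) auto
      moreover have "ereal u \<le> U (X n) b + ereal ((real n + 1) * (p - X n))"
        using X(1)[of n] u unfolding maximizer_def by metis
      then have "u \<le> r + (real n + 1) * (p - X n)" using r(1) by simp
      ultimately show ?thesis using r(2) by linarith
    qed
    moreover have "filterlim (\<lambda>n::nat. w + (real n + 1) * (p - e)) at_bot sequentially"
      using p(2) by real_asymp
    then have "\<forall>\<^sub>F n in sequentially. w + (real n + 1) * (p - e) < u"
      unfolding filterlim_at_bot_dense by auto
    then obtain n where "w + (real n + 1) * (p - e) < u"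
      unfolding eventually_sequentially by auto
    ultimately show False by (meson not_le)
  qed
  then obtain y1 where y1: "0 < y1" "conj_lower U b (ereal y1) < a" by blast
  have "\<forall>\<^sub>F y in at_top. y1 \<le> y" by (rule eventually_ge_at_top)
  then show "\<forall>\<^sub>F y in at_top. conj_lower U b (ereal y) < a"
  proof eventually_elim
    case (elim y)
    then have "conj_lower U b (ereal y) \<le> conj_lower U b (ereal y1)"
      using y1(1) by (intro conj_lower_antimono) auto
    with y1(2) show ?case by order
  qed
qed

lemma utility_at_infinity_eq: "utility_at_infinity U b = (SUP x. U x b)"
  unfolding utility_at_infinity_def
proof (rule tendsto_Lim)
  show "((\<lambda>x. U x b) \<longlongrightarrow> (SUP x. U x b)) at_top"
  proof (rule order_tendstoI)
    fix a assume "a < (SUP x. U x b)"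
    then obtain x where x: "a < U x b" unfolding less_SUP_iff by auto
    have "\<forall>\<^sub>F z in at_top. x \<le> z" by (rule eventually_ge_at_top)
    then show "\<forall>\<^sub>F z in at_top. a < U z b"
      by eventually_elim (use x U_mono less_le_trans in blast)
  next
    fix a assume "(SUP x. U x b) < a"
    then show "\<forall>\<^sub>F z in at_top. U z b < a"
      by (intro always_eventually allI) (meson SUP_upper UNIV_I le_less_trans)
  qed
qed simp

text \<open>
  At slope \<open>0\<close> the maximizers are the points where \<open>U\<close> has reached its limit at infinity.
\<close>
lemma bliss_point_eq: "bliss_point U b = conj_lower U b 0"
proof -
  have m: "maximizer U b 0 x \<longleftrightarrow> U x b = utility_at_infinity U b" for x
  proof
    assume "maximizer U b 0 x"
    then have "\<And>z. U z b \<le> U x b" by (simp add: maximizer_def)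
    then show "U x b = utility_at_infinity U b"
      unfolding utility_at_infinity_eq by (intro antisym SUP_upper SUP_least) auto
  next
    assume "U x b = utility_at_infinity U b"
    then have "\<And>z. U z b \<le> U x b" unfolding utility_at_infinity_eq by (metis SUP_upper UNIV_I)
    then show "maximizer U b 0 x" by (simp add: maximizer_def)
  qed
  show ?thesis
  proof (rule conj_lower_cases[of 0])
    fix x assume x: "maximizer U b 0 x" "\<And>z. maximizer U b 0 z \<Longrightarrow> x \<le> z"
      "conj_lower U b (ereal 0) = ereal x"
    have "bliss_point U b = ereal x"
      unfolding bliss_point_def m[symmetric]
      using x(1,2) by (intro INF_eqI) auto
    with x(3) show ?thesis by (simp add: zero_ereal_def)
  next
    assume "\<not> (\<exists>x. maximizer U b 0 x)" "conj_lower U b (ereal 0) = \<infinity>"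
    then show ?thesis
      unfolding bliss_point_def m[symmetric] by (simp add: zero_ereal_def top_ereal_def)
  qed
qed

text \<open>
  Right continuity and monotonicity recover \<open>U\<close> at an arbitrary point from its values at the
  rationals. This is what makes \<open>U(X, B)\<close> measurable although \<open>U\<close> is only assumed to be
  measurable in its second argument.
\<close>
lemma U_eq_INF: "U x b = (INF q\<in>\<rat>. if x < q then U q b else \<infinity>)"
proof (rule antisym)
  show "U x b \<le> (INF q\<in>\<rat>. if x < q then U q b else \<infinity>)"
    by (rule INF_greatest) (auto intro: U_mono)
  show "(INF q\<in>\<rat>. if x < q then U q b else \<infinity>) \<le> U x b"
  proof (rule ccontr)
    assume "\<not> ?thesis"
    then have "U x b < (INF q\<in>\<rat>. if x < q then U q b else \<infinity>)" by simp
    then obtain z where z: "x < z" "U z b < (INF q\<in>\<rat>. if x < q then U q b else \<infinity>)"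
      using U_right_continuous by blast
    obtain q where q: "q \<in> \<rat>" "x < q" "q < z" using Rats_dense_in_real[OF z(1)] by auto
    then have "(INF q\<in>\<rat>. if x < q then U q b else \<infinity>) \<le> U q b" by (intro INF_lower2[OF q(1)]) auto
    also have "\<dots> \<le> U z b" using q by (intro U_mono) auto
    finally show False using z(2) by simp
  qed
qed

lemma dom_inf_eq_INF: "dom_inf U b = (INF q\<in>\<rat>. if U q b > -\<infinity> then ereal q else \<infinity>)"
proof (rule antisym)
  show "dom_inf U b \<le> (INF q\<in>\<rat>. if U q b > -\<infinity> then ereal q else \<infinity>)"
    using dom_bound_le by (intro INF_greatest) (auto simp: dom_inf_eq)
  show "(INF q\<in>\<rat>. if U q b > -\<infinity> then ereal q else \<infinity>) \<le> dom_inf U b"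
  proof (rule dense_ge)
    fix a assume "dom_inf U b < a"
    then obtain z where z: "dom_bound < z" "ereal z < a"
      using ereal_dense2[of "ereal dom_bound" a] dom_inf_eq by auto
    obtain q where q: "q \<in> \<rat>" "dom_bound < q" "q < z" using Rats_dense_in_real[OF z(1)] by auto
    have "(INF q\<in>\<rat>. if U q b > -\<infinity> then ereal q else \<infinity>) \<le> ereal q"
      using above_dom_bound[OF q(2)] by (intro INF_lower2[OF q(1)]) auto
    also have "ereal q \<le> a" using q(3) z(2) by (meson ereal_less_eq(3) less_imp_le order_trans)
    finally show "(INF q\<in>\<rat>. if U q b > -\<infinity> then ereal q else \<infinity>) \<le> a" .
  qed
qed

text \<open>
  Describes the event that the least maximizer is at most \<open>c\<close> by countably many comparisons
  of utilities. Replacing a maximizer by a slightly larger rational number costs arbitrarily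
  little, as \<open>U\<close> is nondecreasing; the point \<open>c\<close> itself has to be added, since a
  maximizer equal to \<open>c\<close> cannot be moved to the right.
\<close>
lemma maximizer_atMost_iff_countable:
  assumes "0 \<le> y"
  shows "(\<exists>x\<le>c. maximizer U b y x) \<longleftrightarrow>
    (\<forall>n::nat. \<exists>x\<in>insert c \<rat>. x \<le> c \<and>
      (\<forall>z\<in>\<rat>. U z b \<le> U x b + ereal (y * (z - x) + 1 / (real n + 1))))"
    (is "?L \<longleftrightarrow> (\<forall>n. ?R n)")
proof
  assume ?L
  then obtain x where x: "x \<le> c" "maximizer U b y x" by blast
  show "\<forall>n. ?R n"
  proof
    fix n :: nat
    define d where "d = 1 / ((real n + 1) * (y + 1))"
    have "y * d = y / (y + 1) * (1 / (real n + 1))" using assms by (simp add: d_def)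
    also have "\<dots> \<le> 1 * (1 / (real n + 1))" using assms by (intro mult_right_mono) auto
    finally have d: "d > 0" "y * d \<le> 1 / (real n + 1)" using assms by (auto simp: d_def)
    have "\<exists>x'\<in>insert c \<rat>. x \<le> x' \<and> x' \<le> c \<and> x' \<le> x + d"
    proof (cases "x = c")
      case False
      then have "x < min c (x + d)" using x(1) d(1) by simp
      from Rats_dense_in_real[OF this] show ?thesis by force
    qed (use d(1) in auto)
    then obtain x' where x': "x' \<in> insert c \<rat>" "x \<le> x'" "x' \<le> c" "x' \<le> x + d" by blast
    have "U z b \<le> U x' b + ereal (y * (z - x') + 1 / (real n + 1))" for z
    proof -
      have "y * (x' - x) \<le> y * d" using x'(4) assms by (intro mult_left_mono) auto
      then have "y * (z - x) \<le> y * (z - x') + 1 / (real n + 1)"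
        using d(2) by (simp add: algebra_simps)
      then have "U x b + ereal (y * (z - x)) \<le> U x' b + ereal (y * (z - x') + 1 / (real n + 1))"
        using U_mono[OF x'(2)] by (intro add_mono) auto
      then show ?thesis using x(2) unfolding maximizer_def by (meson order_trans)
    qed
    then show "?R n" using x'(1,3) by blast
  qed
next
  assume R: "\<forall>n. ?R n"
  have "\<exists>x\<in>{..c}. maximizer U b y x"
  proof (rule near_maximizers_attained[where K = c])
    fix e :: real assume e: "e > 0"
    obtain n :: nat where n: "1 / (real n + 1) < e / 2"
      using reals_Archimedean[of "e / 2"] e by (auto simp: inverse_eq_divide add.commute)
    obtain x where x: "x \<le> c"
      "\<And>z. z \<in> \<rat> \<Longrightarrow> U z b \<le> U x b + ereal (y * (z - x) + 1 / (real n + 1))"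
      using R by blast
    have "U z b \<le> U x b + ereal (y * (z - x) + e)" for z
    proof -
      define d where "d = e / (2 * (y + 1))"
      have d: "d > 0" "y * d \<le> e / 2" using assms e by (auto simp: d_def field_simps)
      obtain q where q: "q \<in> \<rat>" "z < q" "q < z + d" using Rats_dense_in_real[of z "z + d"] d(1) by auto
      have "y * (q - z) \<le> y * d" using q(3) assms by (intro mult_left_mono) auto
      then have "y * (q - x) + 1 / (real n + 1) \<le> y * (z - x) + e"
        using d(2) n by (simp add: algebra_simps)
      then have "U x b + ereal (y * (q - x) + 1 / (real n + 1)) \<le> U x b + ereal (y * (z - x) + e)"
        by (intro add_left_mono) auto
      then show ?thesis using x(2)[OF q(1)] U_mono[of z q] q(2) by (meson less_imp_le order_trans)
    qed
    then show "\<exists>x\<in>{..c}. x \<le> c \<and> (\<forall>z. U z b \<le> U x b + ereal (y * (z - x) + e))"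
      using x(1) by auto
  qed simp
  then show ?L by auto
qed

end

section \<open>Subsets of prescribed weight in a nonatomic space\<close>

text \<open>
  Sierpinski's intermediate value theorem, by exhaustion: enlarge a set step by step, each time
  by at least half of what is possible without exceeding \<open>c\<close>. If the union still fell short of
  \<open>c\<close>, a small set \<open>C\<close> could be added to it; then \<open>C\<close> was available at every step, so that every
  step gained at least half the measure of \<open>C\<close>, which is impossible. The total measure may
  be infinite, and therefore small subsets are required explicitly.
\<close>
lemma subset_of_prescribed_measure:
  fixes c :: real
  assumes D: "D \<in> sets M" "ennreal c \<le> emeasure M D" and c: "0 \<le> c"
    and small: "\<And>A e. A \<in> sets M \<Longrightarrow> 0 < emeasure M A \<Longrightarrow> 0 < e \<Longrightarrow>
      \<exists>A'\<in>sets M. A' \<subseteq> A \<and> 0 < emeasure M A' \<and> emeasure M A' \<le> ennreal e"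
  shows "\<exists>A\<in>sets M. A \<subseteq> D \<and> emeasure M A = ennreal c"
proof -
  let ?P = "\<lambda>A. A \<in> sets M \<and> A \<subseteq> D \<and> emeasure M A \<le> ennreal c"
  have fin: "emeasure M A \<noteq> \<infinity>" "measure M A \<le> c" if "?P A" for A
    using that c by (auto simp: measure_def intro: enn2real_leI dest: neq_top_trans[rotated])
  have step: "\<exists>A'. ?P A' \<and> A \<subseteq> A' \<and> (\<forall>C. ?P C \<longrightarrow> A \<subseteq> C \<longrightarrow>
      measure M C - measure M A \<le> 2 * (measure M A' - measure M A))" if A: "?P A" for A
  proof (cases "\<exists>C. ?P C \<and> A \<subseteq> C \<and> measure M A < measure M C")
    case False
    then show ?thesis using A by (intro exI[of _ A]) (auto simp: not_less)
  next
    case True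
    define S where "S = {measure M C |C. ?P C \<and> A \<subseteq> C}"
    have S: "S \<noteq> {}" "bdd_above S" using True fin(2) by (auto simp: S_def intro!: bdd_aboveI[of _ c])
    obtain C0 where "?P C0" "A \<subseteq> C0" "measure M A < measure M C0" using True by blast
    then have "measure M A < Sup S" using S by (auto simp: S_def less_cSup_iff)
    \<comment> \<open>Half of the largest possible gain is attained by some candidate.\<close>
    then have "(measure M A + Sup S) / 2 < Sup S" by simp
    then obtain A' where A': "?P A'" "A \<subseteq> A'" "(measure M A + Sup S) / 2 < measure M A'"
      using S unfolding less_cSup_iff[OF S] by (auto simp: S_def)
    have "measure M C - measure M A \<le> 2 * (measure M A' - measure M A)" if "?P C" "A \<subseteq> C" for C
    proof -
      have "measure M C \<le> Sup S" using that S(2) by (intro cSup_upper) (auto simp: S_def)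
      then show ?thesis using A'(3) by (simp add: field_simps)
    qed
    with A' show ?thesis by blast
  qed
  have "\<exists>F. \<forall>n::nat. ?P (F n) \<and> (F n \<subseteq> F (Suc n) \<and> (\<forall>C. ?P C \<longrightarrow> F n \<subseteq> C \<longrightarrow>
      measure M C - measure M (F n) \<le> 2 * (measure M (F (Suc n)) - measure M (F n))))"
    by (rule dependent_nat_choice) (use step in \<open>auto intro!: exI[of _ "{}"]\<close>)
  then obtain F where F: "\<And>n::nat. ?P (F n)" "\<And>n. F n \<subseteq> F (Suc n)"
    "\<And>n C. ?P C \<Longrightarrow> F n \<subseteq> C \<Longrightarrow>
      measure M C - measure M (F n) \<le> 2 * (measure M (F (Suc n)) - measure M (F n))"
    by metis
  define A where "A = (\<Union>n. F n)"
  have [measurable]: "A \<in> sets M" "D \<in> sets M" using F(1) D by (auto simp: A_def)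
  have lim: "(\<lambda>n. emeasure M (F n)) \<longlonglongrightarrow> emeasure M A"
    unfolding A_def using F(1,2) by (intro Lim_emeasure_incseq) (auto simp: incseq_Suc_iff)
  then have "emeasure M A \<le> ennreal c"
    by (rule LIMSEQ_le_const2) (use F(1) in auto)
  then have A: "?P A" using F(1) by (auto simp: A_def)
  moreover have "emeasure M A = ennreal c"
  proof (rule ccontr)
    assume "emeasure M A \<noteq> ennreal c"
    then have less: "emeasure M A < ennreal c" using A by (simp add: less_le)
    have mA: "emeasure M A = ennreal (measure M A)" "measure M A < c"
      using fin(1)[OF A] less by (auto simp: emeasure_eq_ennreal_measure ennreal_less_iff)
    have "emeasure M A < emeasure M D" using less D(2) by order
    then have "0 < emeasure M (D - A)"
      using A by (subst emeasure_Diff) (auto simp: diff_gr0_ennreal fin)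
    then obtain C where C: "C \<in> sets M" "C \<subseteq> D - A" "0 < emeasure M C"
      "emeasure M C \<le> ennreal (c - measure M A)"
      using small[of "D - A" "c - measure M A"] mA(2) by auto
    have eq: "emeasure M (A \<union> C) = emeasure M A + emeasure M C"
      using C by (intro plus_emeasure[symmetric]) auto
    also have "\<dots> \<le> ennreal (measure M A) + ennreal (c - measure M A)"
      using C(4) mA(1) by (intro add_mono) auto
    also have "\<dots> = ennreal c" using mA(2) by (simp flip: ennreal_plus)
    finally have AC: "?P (A \<union> C)" using C A by auto
    have "emeasure M C < \<infinity>" using le_less_trans[OF C(4)] by simp
    then have mC: "measure M (A \<union> C) = measure M A + measure M C" "0 < measure M C"
      using C(3) eq fin(1)[OF A] by (auto simp: measure_def enn2real_plus less_top enn2real_positive_iff)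
    have limr: "(\<lambda>n. measure M (F n)) \<longlonglongrightarrow> measure M A"
      unfolding measure_def using lim mA(1) by (intro tendsto_enn2real) auto
    have "(\<lambda>n. 2 * (measure M (F (Suc n)) - measure M (F n))) \<longlonglongrightarrow> 2 * (measure M A - measure M A)"
      by (intro tendsto_intros limr LIMSEQ_Suc)
    moreover have "measure M C \<le> 2 * (measure M (F (Suc n)) - measure M (F n))" for n
    proof -
      have "F n \<subseteq> A" by (auto simp: A_def)
      then have "measure M (F n) \<le> measure M A"
        using A fin(1)[OF A] by (intro measure_mono_fmeasurable) (auto simp: fmeasurable_def less_top F(1))
      moreover have "measure M (A \<union> C) - measure M (F n) \<le> 2 * (measure M (F (Suc n)) - measure M (F n))"
        using \<open>F n \<subseteq> A\<close> by (intro F(3)[OF AC]) auto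
      ultimately show ?thesis using mC(1) by linarith
    qed
    ultimately have "measure M C \<le> 0" by (intro LIMSEQ_le_const) auto
    with mC(2) show False by simp
  qed
  ultimately show ?thesis by blast
qed

text \<open>
  Of the two parts into which a set can be split, one has at most half of the measure; iterate.
\<close>
lemma nonatomic_small_subset:
  assumes "finite_measure M" "nonatomic M" "A \<in> sets M" "0 < measure M A" "0 < e"
  shows "\<exists>A'\<in>sets M. A' \<subseteq> A \<and> 0 < measure M A' \<and> measure M A' \<le> e"
proof -
  interpret finite_measure M by fact
  have half: "\<exists>A'\<in>sets M. A' \<subseteq> C \<and> 0 < measure M A' \<and> measure M A' \<le> measure M C / 2"
    if C: "C \<in> sets M" "0 < measure M C" for C
  proof -
    obtain A' where A': "A' \<in> sets M" "A' \<subseteq> C" "0 < measure M A'" "measure M A' < measure M C"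
      using assms(2) C unfolding nonatomic_def by blast
    have "measure M (C - A') = measure M C - measure M A'"
      using A' C by (intro finite_measure_Diff) auto
    moreover have "C - A' \<in> sets M" "C - A' \<subseteq> C" using A' C by auto
    ultimately show ?thesis
      using A' by (cases "measure M A' \<le> measure M C / 2") (auto intro: bexI[of _ A'] bexI[of _ "C - A'"])
  qed
  have "\<exists>A'\<in>sets M. A' \<subseteq> A \<and> 0 < measure M A' \<and> measure M A' \<le> measure M A / 2 ^ n" for n
  proof (induction n)
    case 0
    then show ?case using assms(3,4) by auto
  next
    case (Suc n)
    then obtain C where C: "C \<in> sets M" "C \<subseteq> A" "0 < measure M C" "measure M C \<le> measure M A / 2 ^ n"
      by blast
    from half[OF C(1,3)] obtain A' where
      "A' \<in> sets M" "A' \<subseteq> C" "0 < measure M A'" "measure M A' \<le> measure M C / 2" by blast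
    with C show ?case by (intro bexI[of _ A']) auto
  qed
  moreover obtain n where "measure M A / 2 ^ n < e"
  proof -
    have "(\<lambda>n::nat. measure M A / 2 ^ n) \<longlonglongrightarrow> 0" by real_asymp
    from order_tendstoD(2)[OF this assms(5)] that show thesis
      unfolding eventually_sequentially by blast
  qed
  ultimately show ?thesis by (meson less_imp_le order_trans)
qed

text \<open>
  Sierpinski's theorem for the measure with density \<open>f\<close>. On the part of a set where \<open>0 < f \<le> n\<close>,
  smallness for \<open>M\<close> implies smallness for the weighted measure.
\<close>
lemma nonatomic_prescribed_integral:
  fixes f :: "'a \<Rightarrow> real"
  assumes M: "finite_measure M" "nonatomic M"
    and f[measurable]: "f \<in> borel_measurable M" and nonneg: "\<And>x. x \<in> space M \<Longrightarrow> 0 \<le> f x"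
    and D: "D \<in> sets M" and c: "0 \<le> c" "ennreal c \<le> (\<integral>\<^sup>+x. ennreal (f x) * indicator D x \<partial>M)"
  obtains A where "A \<in> sets M" "A \<subseteq> D"
    "has_bochner_integral M (\<lambda>x. f x * indicator A x) c"
proof -
  interpret finite_measure M by fact
  let ?N = "density M (\<lambda>x. ennreal (f x))"
  have em: "emeasure ?N A = (\<integral>\<^sup>+x. ennreal (f x) * indicator A x \<partial>M)" if "A \<in> sets M" for A
    using that by (simp add: emeasure_density)
  have "\<exists>A\<in>sets ?N. A \<subseteq> D \<and> emeasure ?N A = ennreal c"
  proof (rule subset_of_prescribed_measure)
    fix A and e :: real assume A: "A \<in> sets ?N" "0 < emeasure ?N A" and e: "0 < e"
    then have [measurable]: "A \<in> sets M" by simp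
    let ?A = "\<lambda>n::nat. {x\<in>A. 0 < f x \<and> f x \<le> real n}"
    have [measurable]: "?A n \<in> sets M" for n
    proof -
      have "?A n = A \<inter> {x\<in>space M. 0 < f x \<and> f x \<le> real n}"
        using sets.sets_into_space[OF \<open>A \<in> sets M\<close>] by auto
      then show ?thesis by simp
    qed
    have "\<exists>n. 0 < measure M (?A n)"
    proof (rule ccontr)
      assume "\<not> ?thesis"
      then have "\<And>n. measure M (?A n) = 0" by (meson not_less_iff_gr_or_eq measure_nonneg leD)
      then have "\<And>n. ?A n \<in> null_sets M" by (intro null_setsI) (simp_all add: emeasure_eq_measure)
      then have "AE x in M. \<forall>n. x \<notin> ?A n"
        unfolding AE_all_countable using AE_not_in by blast
      then have "AE x in M. ennreal (f x) * indicator A x = 0"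
      proof eventually_elim
        case (elim x)
        obtain n where "f x \<le> real n" using real_arch_simple by blast
        with elim show ?case by (auto simp: indicator_def ennreal_neg not_less)
      qed
      then have "emeasure ?N A = 0" by (simp add: em nn_integral_0_iff_AE)
      with A(2) show False by simp
    qed
    then obtain n where n: "0 < measure M (?A n)" by blast
    obtain A' where A': "A' \<in> sets M" "A' \<subseteq> ?A n" "0 < measure M A'" "measure M A' \<le> e / (real n + 1)"
      using nonatomic_small_subset[OF M _ n, of "e / (real n + 1)"] e by auto
    have "emeasure ?N A' \<le> (\<integral>\<^sup>+x. ennreal (real n) * indicator A' x \<partial>M)"
      unfolding em[OF A'(1)] using A'(2)
      by (intro nn_integral_mono) (auto simp: indicator_def intro!: ennreal_leI)
    also have "\<dots> = ennreal (real n * measure M A')"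
      using A'(1) by (simp add: nn_integral_cmult_indicator emeasure_eq_measure ennreal_mult)
    also have "\<dots> \<le> ennreal e"
    proof (rule ennreal_leI)
      have "real n * measure M A' \<le> (real n + 1) * (e / (real n + 1))"
        using A'(3,4) by (intro mult_mono) auto
      then show "real n * measure M A' \<le> e" by simp
    qed
    finally have "emeasure ?N A' \<le> ennreal e" .
    moreover have "emeasure ?N A' \<noteq> 0"
    proof
      assume "emeasure ?N A' = 0"
      then have "AE x in M. ennreal (f x) * indicator A' x = 0"
        using A'(1) by (simp add: em nn_integral_0_iff_AE)
      then have "AE x in M. x \<notin> A'"
        by eventually_elim (use A'(2) in \<open>auto simp: indicator_def split: if_splits\<close>)
      then have "A' \<in> null_sets M" using A'(1) by (simp add: AE_iff_null_sets)
      then have "measure M A' = 0" by (simp add: null_sets_def measure_def)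
      with A'(3) show False by simp
    qed
    ultimately show "\<exists>A'\<in>sets ?N. A' \<subseteq> A \<and> 0 < emeasure ?N A' \<and> emeasure ?N A' \<le> ennreal e"
      using A'(1,2) by (intro bexI[of _ A']) (auto simp: zero_less_iff_neq_zero)
  qed (use D c em in auto)
  then obtain A where A: "A \<in> sets M" "A \<subseteq> D" "(\<integral>\<^sup>+x. ennreal (f x) * indicator A x \<partial>M) = ennreal c"
    using em by auto
  have "(\<integral>\<^sup>+x. ennreal (f x * indicator A x) \<partial>M) = ennreal c"
    unfolding A(3)[symmetric] by (intro nn_integral_cong) (auto simp: indicator_def)
  then have "has_bochner_integral M (\<lambda>x. f x * indicator A x) c"
    using A(1) c(1) nonneg
    by (intro has_bochner_integral_nn_integral) (auto simp: indicator_def)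
  with that A(1,2) show ?thesis by blast
qed

section \<open>Extended expectations of quasi-integrable functions\<close>

lemma pos_expectation_ereal: "pos_expectation M (\<lambda>x. ereal (f x)) = (\<integral>\<^sup>+x. ennreal (f x) \<partial>M)"
proof -
  have "e2ennreal (max 0 (ereal r)) = ennreal r" for r
    by (cases "0 \<le> r") (auto simp: max_def zero_ereal_def e2ennreal_ereal ennreal_neg e2ennreal_neg)
  then show ?thesis by (simp add: pos_expectation_def)
qed

lemma neg_expectation_ereal: "neg_expectation M (\<lambda>x. ereal (f x)) = (\<integral>\<^sup>+x. ennreal (- f x) \<partial>M)"
  using pos_expectation_ereal[of M "\<lambda>x. - f x"] by (simp add: neg_expectation_def pos_expectation_def)

lemma pos_expectation_cong_AE:
  "AE x in M. f x = g x \<Longrightarrow> pos_expectation M f = pos_expectation M g"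
  unfolding pos_expectation_def by (intro nn_integral_cong_AE) auto

lemma neg_expectation_cong_AE:
  "AE x in M. f x = g x \<Longrightarrow> neg_expectation M f = neg_expectation M g"
  unfolding neg_expectation_def by (intro nn_integral_cong_AE) auto

lemma ext_expectation_cong_AE:
  "AE x in M. f x = g x \<Longrightarrow> ext_expectation M f = ext_expectation M g"
  unfolding ext_expectation_def using pos_expectation_cong_AE neg_expectation_cong_AE by metis

text \<open>
  This includes the convention \<open>\<infinity> - \<infinity> = \<infinity>\<close>: if the positive part of \<open>f\<close> has infinite
  expectation, then so has that of \<open>g\<close>, and both sides are \<open>\<infinity>\<close>.
\<close>
lemma ext_expectation_mono_AE:
  assumes "AE x in M. f x \<le> g x" shows "ext_expectation M f \<le> ext_expectation M g"
proof -
  have "pos_expectation M f \<le> pos_expectation M g"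
    unfolding pos_expectation_def
    by (rule nn_integral_mono_AE) (use assms in eventually_elim, auto intro!: e2ennreal_mono max.mono)
  moreover have "neg_expectation M g \<le> neg_expectation M f"
    unfolding neg_expectation_def
    by (rule nn_integral_mono_AE) (use assms in eventually_elim, auto intro!: e2ennreal_mono max.mono)
  ultimately show ?thesis
    unfolding ext_expectation_def
    by (intro ereal_minus_mono) (auto simp: less_eq_ennreal.rep_eq)
qed

text \<open>
  For these functions \<open>ext_expectation\<close> is the Lebesgue integral if it exists, and \<open>\<infinity>\<close> otherwise.
  Costs and the utilities of feasible solutions are of this kind.
\<close>
definition quasi_integrable :: "'a measure \<Rightarrow> ('a \<Rightarrow> real) \<Rightarrow> bool" where
  "quasi_integrable M f \<longleftrightarrow> f \<in> borel_measurable M \<and> (\<integral>\<^sup>+x. ennreal (- f x) \<partial>M) < \<infinity>"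

lemma ext_expectation_integrable:
  assumes "integrable M f"
  shows "ext_expectation M (\<lambda>x. ereal (f x)) = ereal (integral\<^sup>L M f)"
proof -
  obtain p n where "(\<integral>\<^sup>+x. ennreal (f x) \<partial>M) = ennreal p" "(\<integral>\<^sup>+x. ennreal (- f x) \<partial>M) = ennreal n"
    "0 \<le> p" "0 \<le> n"
    using assms unfolding real_integrable_def by (metis ennreal_cases infinity_ennreal_def)
  then show ?thesis
    by (simp add: ext_expectation_def pos_expectation_ereal neg_expectation_ereal
        real_lebesgue_integral_def[OF assms] enn2ereal_ennreal)
qed

lemma ext_expectation_quasi_integrable:
  assumes "quasi_integrable M f" "\<not> integrable M f"
  shows "ext_expectation M (\<lambda>x. ereal (f x)) = \<infinity>"
proof -
  have "(\<integral>\<^sup>+x. ennreal (f x) \<partial>M) = \<infinity>"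
    using assms by (auto simp: quasi_integrable_def real_integrable_def less_top[symmetric])
  moreover obtain n where "(\<integral>\<^sup>+x. ennreal (- f x) \<partial>M) = ennreal n" "0 \<le> n"
    using assms unfolding quasi_integrable_def by (metis ennreal_cases less_irrefl infinity_ennreal_def)
  ultimately show ?thesis
    by (simp add: ext_expectation_def pos_expectation_ereal neg_expectation_ereal enn2ereal_ennreal)
qed

lemma quasi_integrable_mono:
  assumes "quasi_integrable M f" "g \<in> borel_measurable M" "AE x in M. f x \<le> g x"
  shows "quasi_integrable M g"
proof -
  have "(\<integral>\<^sup>+x. ennreal (- g x) \<partial>M) \<le> (\<integral>\<^sup>+x. ennreal (- f x) \<partial>M)"
    by (rule nn_integral_mono_AE) (use assms(3) in eventually_elim, auto intro!: ennreal_leI)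
  with assms(1,2) show ?thesis unfolding quasi_integrable_def by (auto intro: le_less_trans)
qed

lemma quasi_integrable_add:
  assumes "quasi_integrable M f" "integrable M g"
  shows "quasi_integrable M (\<lambda>x. f x + g x)"
proof -
  have [measurable]: "f \<in> borel_measurable M" "g \<in> borel_measurable M"
    using assms by (auto simp: quasi_integrable_def)
  have "(\<integral>\<^sup>+x. ennreal (- (f x + g x)) \<partial>M) \<le> (\<integral>\<^sup>+x. ennreal (- f x) + ennreal (- g x) \<partial>M)"
  proof (rule nn_integral_mono)
    fix x show "ennreal (- (f x + g x)) \<le> ennreal (- f x) + ennreal (- g x)"
      by (cases "f x \<le> 0"; cases "g x \<le> 0")
        (auto simp: ennreal_neg ennreal_plus[symmetric] simp del: ennreal_plus intro!: ennreal_leI)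
  qed
  also have "\<dots> = (\<integral>\<^sup>+x. ennreal (- f x) \<partial>M) + (\<integral>\<^sup>+x. ennreal (- g x) \<partial>M)"
    by (rule nn_integral_add) auto
  also have "\<dots> < \<infinity>"
    using assms by (auto simp: quasi_integrable_def real_integrable_def less_top)
  finally show ?thesis by (simp add: quasi_integrable_def)
qed

lemma ext_expectation_add:
  assumes "quasi_integrable M f" "integrable M g"
  shows "ext_expectation M (\<lambda>x. ereal (f x + g x)) =
    ext_expectation M (\<lambda>x. ereal (f x)) + ereal (integral\<^sup>L M g)"
proof (cases "integrable M f")
  case True
  then show ?thesis using assms(2) by (simp add: ext_expectation_integrable)
next
  case False
  have "\<not> integrable M (\<lambda>x. f x + g x)"
    using False Bochner_Integration.integrable_diff[OF _ assms(2), of "\<lambda>x. f x + g x"] by auto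
  then show ?thesis
    using False assms by (simp add: ext_expectation_quasi_integrable quasi_integrable_add)
qed

lemma ext_expectation_gt_MInf:
  "quasi_integrable M f \<Longrightarrow> ext_expectation M (\<lambda>x. ereal (f x)) > -\<infinity>"
  using ext_expectation_integrable[of M f] ext_expectation_quasi_integrable[of M f] by force

lemma quasi_integrable_iff_integrable:
  assumes "quasi_integrable M f"
  shows "integrable M f \<longleftrightarrow> ext_expectation M (\<lambda>x. ereal (f x)) < \<infinity>"
  using ext_expectation_integrable[of M f] ext_expectation_quasi_integrable[OF assms] by force

lemma quasi_integrableI_expectation:
  assumes [measurable]: "f \<in> borel_measurable M"
    and "expectation_exists M (\<lambda>x. ereal (f x))" "ext_expectation M (\<lambda>x. ereal (f x)) > -\<infinity>"
  shows "quasi_integrable M f"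
proof (rule ccontr)
  assume "\<not> ?thesis"
  then have n: "neg_expectation M (\<lambda>x. ereal (f x)) = \<infinity>"
    by (auto simp: quasi_integrable_def neg_expectation_ereal less_top[symmetric])
  then have "pos_expectation M (\<lambda>x. ereal (f x)) < \<infinity>" using assms(2) by (auto simp: expectation_exists_def)
  then obtain p where "pos_expectation M (\<lambda>x. ereal (f x)) = ennreal p" "0 \<le> p"
    by (metis ennreal_cases infinity_ennreal_def less_irrefl)
  then have "ext_expectation M (\<lambda>x. ereal (f x)) = -\<infinity>"
    using n by (simp add: ext_expectation_def enn2ereal_ennreal)
  with assms(3) show False by simp
qed

section \<open>Measurability and cost of the least and greatest maximizers\<close>

locale utility_problem =
  fixes M :: "'a measure" and N :: "'e measure"
    and \<xi> :: "'a \<Rightarrow> real" and B :: "'a \<Rightarrow> 'e" and U :: "real \<Rightarrow> 'e \<Rightarrow> ereal"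
  assumes model: "utility_model M N \<xi> B U"
    and standing: "standing_assumption M N \<xi> B U"
begin

sublocale prob_space M
  using model by (simp add: utility_model_def)

lemma measurable_xi [measurable]: "\<xi> \<in> borel_measurable M"
  and measurable_B [measurable]: "B \<in> measurable M N"
  and xi_pos: "\<omega> \<in> space M \<Longrightarrow> 0 < \<xi> \<omega>"
  and measurable_U_fixed [measurable]: "(\<lambda>b. U x b) \<in> borel_measurable N"
  using model standing by (auto simp: utility_model_def standing_assumption_def)

lemma state: "\<omega> \<in> space M \<Longrightarrow> state_utility U (B \<omega>)"
  using model standing measurable_space[OF measurable_B]
  unfolding utility_model_def standing_assumption_def state_utility_def by blast

lemma measurable_U [measurable]:
  assumes [measurable]: "X \<in> borel_measurable M"
  shows "(\<lambda>\<omega>. U (X \<omega>) (B \<omega>)) \<in> borel_measurable M"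
proof -
  have "(\<lambda>\<omega>. INF q\<in>\<rat>. if X \<omega> < q then U q (B \<omega>) else \<infinity>) \<in> borel_measurable M"
    by (intro borel_measurable_INF countable_rat) measurable
  then show ?thesis
    by (subst measurable_cong[OF state_utility.U_eq_INF[OF state]]) auto
qed

text \<open>
  Real-valued versions of the extended-real quantities. The first one equals
  \<open>dom_inf U (B \<omega>)\<close>, and for \<open>l > 0\<close> the next two equal the least and the greatest maximizer.
  Infinite values become \<open>0\<close>; this affects \<open>low 0\<close> in states without a finite bliss point, and
  \<open>utility\<close> outside the domain of \<open>U\<close>.
\<close>
definition lowest :: "'a \<Rightarrow> real" where
  "lowest \<omega> = real_of_ereal (dom_inf U (B \<omega>))"

definition low :: "real \<Rightarrow> 'a \<Rightarrow> real" where
  "low l \<omega> = real_of_ereal (conj_lower U (B \<omega>) (ereal l * ereal (\<xi> \<omega>)))"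

definition upp :: "real \<Rightarrow> 'a \<Rightarrow> real" where
  "upp l \<omega> = real_of_ereal (conj_upper U (B \<omega>) (ereal l * ereal (\<xi> \<omega>)))"

definition utility :: "('a \<Rightarrow> real) \<Rightarrow> 'a \<Rightarrow> real" where
  "utility X \<omega> = real_of_ereal (U (X \<omega>) (B \<omega>))"

lemma lowest_eq: "\<omega> \<in> space M \<Longrightarrow> dom_inf U (B \<omega>) = ereal (lowest \<omega>)"
  using state_utility.dom_inf_eq[OF state] by (simp add: lowest_def)

lemma lowest_le: "\<omega> \<in> space M \<Longrightarrow> U x (B \<omega>) > -\<infinity> \<Longrightarrow> lowest \<omega> \<le> x"
  using state_utility.dom_bound_le[OF state] state_utility.dom_inf_eq[OF state] by (simp add: lowest_def)

lemma above_lowest: "\<omega> \<in> space M \<Longrightarrow> lowest \<omega> < x \<Longrightarrow> U x (B \<omega>) > -\<infinity>"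
  using state_utility.above_dom_bound[OF state] state_utility.dom_inf_eq[OF state] by (simp add: lowest_def)

lemma low_properties:
  assumes "\<omega> \<in> space M" "0 < l"
  shows low_eq: "conj_lower U (B \<omega>) (ereal l * ereal (\<xi> \<omega>)) = ereal (low l \<omega>)"
    and low_maximizer: "maximizer U (B \<omega>) (l * \<xi> \<omega>) (low l \<omega>)"
    and low_least: "maximizer U (B \<omega>) (l * \<xi> \<omega>) x \<Longrightarrow> low l \<omega> \<le> x"
proof -
  have "0 < l * \<xi> \<omega>" using assms xi_pos by simp
  then obtain z where "maximizer U (B \<omega>) (l * \<xi> \<omega>) z"
    "\<And>x. maximizer U (B \<omega>) (l * \<xi> \<omega>) x \<Longrightarrow> z \<le> x"
    "conj_lower U (B \<omega>) (ereal (l * \<xi> \<omega>)) = ereal z"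
    using state_utility.conj_lower_pos[OF state[OF assms(1)]] by metis
  then show "conj_lower U (B \<omega>) (ereal l * ereal (\<xi> \<omega>)) = ereal (low l \<omega>)"
    "maximizer U (B \<omega>) (l * \<xi> \<omega>) (low l \<omega>)"
    "maximizer U (B \<omega>) (l * \<xi> \<omega>) x \<Longrightarrow> low l \<omega> \<le> x"
    by (simp_all add: low_def)
qed

lemma upp_properties:
  assumes "\<omega> \<in> space M" "0 < l"
  shows upp_eq: "conj_upper U (B \<omega>) (ereal l * ereal (\<xi> \<omega>)) = ereal (upp l \<omega>)"
    and upp_maximizer: "maximizer U (B \<omega>) (l * \<xi> \<omega>) (upp l \<omega>)"
    and upp_greatest: "maximizer U (B \<omega>) (l * \<xi> \<omega>) x \<Longrightarrow> x \<le> upp l \<omega>"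
proof -
  have "0 < l * \<xi> \<omega>" using assms xi_pos by simp
  then obtain z where "maximizer U (B \<omega>) (l * \<xi> \<omega>) z"
    "\<And>x. maximizer U (B \<omega>) (l * \<xi> \<omega>) x \<Longrightarrow> x \<le> z"
    "conj_upper U (B \<omega>) (ereal (l * \<xi> \<omega>)) = ereal z"
    using state_utility.conj_upper_pos[OF state[OF assms(1)]] by metis
  then show "conj_upper U (B \<omega>) (ereal l * ereal (\<xi> \<omega>)) = ereal (upp l \<omega>)"
    "maximizer U (B \<omega>) (l * \<xi> \<omega>) (upp l \<omega>)"
    "maximizer U (B \<omega>) (l * \<xi> \<omega>) x \<Longrightarrow> x \<le> upp l \<omega>"
    by (simp_all add: upp_def)
qed

lemma lowest_le_maximizer: "\<omega> \<in> space M \<Longrightarrow> maximizer U (B \<omega>) y x \<Longrightarrow> lowest \<omega> \<le> x"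
  using state_utility.maximizer_finite[OF state] lowest_le by blast

lemma low_le_upp: "\<omega> \<in> space M \<Longrightarrow> 0 < l \<Longrightarrow> low l \<omega> \<le> upp l \<omega>"
  by (intro low_least upp_maximizer)

lemma upp_le_low:
  assumes "\<omega> \<in> space M" "0 < l'" "l' < l" shows "upp l \<omega> \<le> low l' \<omega>"
  using assms xi_pos[OF assms(1)]
  by (intro state_utility.maximizer_antimono[OF state low_maximizer upp_maximizer]) auto

lemma low_antimono:
  assumes "\<omega> \<in> space M" "0 < l'" "l' \<le> l" shows "low l \<omega> \<le> low l' \<omega>"
  using upp_le_low[of \<omega> l' l] low_le_upp[of \<omega> l] assms by (cases "l = l'") auto

lemma measurable_conj_lower [measurable]:
  assumes "0 \<le> l"
  shows "(\<lambda>\<omega>. conj_lower U (B \<omega>) (ereal l * ereal (\<xi> \<omega>))) \<in> borel_measurable M"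
  unfolding borel_measurable_iff_Iic_ereal
proof
  fix a :: ereal
  let ?f = "\<lambda>\<omega>. conj_lower U (B \<omega>) (ereal l * ereal (\<xi> \<omega>))"
  show "?f -` {..a} \<inter> space M \<in> sets M"
  proof (cases a)
    case (real c)
    have "?f -` {..a} \<inter> space M = {\<omega>\<in>space M. \<forall>n::nat. \<exists>x\<in>insert c \<rat>. x \<le> c \<and>
      (\<forall>z\<in>\<rat>. U z (B \<omega>) \<le> U x (B \<omega>) + ereal (l * \<xi> \<omega> * (z - x) + 1 / (real n + 1)))}"
    proof -
      have "(?f \<omega> \<le> a) = (\<forall>n::nat. \<exists>x\<in>insert c \<rat>. x \<le> c \<and>
        (\<forall>z\<in>\<rat>. U z (B \<omega>) \<le> U x (B \<omega>) + ereal (l * \<xi> \<omega> * (z - x) + 1 / (real n + 1))))"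
        if "\<omega> \<in> space M" for \<omega>
        using state_utility.maximizer_atMost_iff_countable[OF state[OF that], of "l * \<xi> \<omega>" c]
          state_utility.conj_lower_le_iff[OF state[OF that], of "l * \<xi> \<omega>" c]
          assms xi_pos[OF that] real by simp
      then show ?thesis by auto
    qed
    also have "\<dots> \<in> sets M"
    proof -
      have [simp]: "countable (insert c \<rat>)" using countable_rat by simp
      have "Measurable.pred M (\<lambda>\<omega>. \<forall>n::nat. \<exists>x\<in>insert c \<rat>. x \<le> c \<and>
          (\<forall>z\<in>\<rat>. U z (B \<omega>) \<le> U x (B \<omega>) + ereal (l * \<xi> \<omega> * (z - x) + 1 / (real n + 1))))"
      proof (intro pred_intros_countable measurable_pred_countable(2) pred_intros_logic(3)
            measurable_pred_countable(1) countable_rat)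
        fix x z :: real and n :: nat
        show "Measurable.pred M (\<lambda>\<omega>. U z (B \<omega>) \<le> U x (B \<omega>) + ereal (l * \<xi> \<omega> * (z - x) + 1 / (real n + 1)))"
          by measurable
      qed (auto intro: countable_rat)
      then show ?thesis by (simp only: pred_def)
    qed
    finally show ?thesis .
  next
    case MInf
    have "-\<infinity> < ?f \<omega>" if "\<omega> \<in> space M" for \<omega>
      using state_utility.dom_inf_le_conj_lower[OF state[OF that], of "l * \<xi> \<omega>"] lowest_eq[OF that]
      by (cases "?f \<omega>") auto
    then have "?f -` {..a} \<inter> space M = {}" using MInf by force
    then show ?thesis by (metis sets.empty_sets)
  next
    case PInf
    then have "?f -` {..a} \<inter> space M = space M" by auto
    then show ?thesis by (metis sets.top)
  qed
qed

lemma measurable_low [measurable]: "0 \<le> l \<Longrightarrow> low l \<in> borel_measurable M"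
  unfolding low_def[abs_def] by (intro borel_measurable_real_of_ereal measurable_conj_lower)

lemma measurable_lowest [measurable]: "lowest \<in> borel_measurable M"
proof -
  have "(\<lambda>\<omega>. INF q\<in>\<rat>. if U q (B \<omega>) > -\<infinity> then ereal q else \<infinity>) \<in> borel_measurable M"
    by (intro borel_measurable_INF countable_rat) measurable
  then have "(\<lambda>\<omega>. dom_inf U (B \<omega>)) \<in> borel_measurable M"
    by (subst measurable_cong[OF state_utility.dom_inf_eq_INF[OF state]]) auto
  then show ?thesis unfolding lowest_def[abs_def] by (rule borel_measurable_real_of_ereal)
qed

lemma measurable_utility [measurable]: "X \<in> borel_measurable M \<Longrightarrow> utility X \<in> borel_measurable M"
  unfolding utility_def[abs_def] by (intro borel_measurable_real_of_ereal measurable_U)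

lemma low_tendsto_upp:
  assumes \<omega>: "\<omega> \<in> space M" and s: "\<And>n. 0 < s n" "\<And>n. s n < l" "s \<longlonglongrightarrow> l"
  shows "(\<lambda>n. low (s n) \<omega>) \<longlonglongrightarrow> upp l \<omega>"
proof -
  have l: "0 < l" using s(1,2) less_trans by blast
  have "filterlim (\<lambda>n. s n * \<xi> \<omega>) (at_left (l * \<xi> \<omega>)) sequentially"
    unfolding filterlim_at using s xi_pos[OF \<omega>] by (auto intro!: always_eventually tendsto_intros)
  from filterlim_compose[OF state_utility.conj_lower_at_left[OF state[OF \<omega>]] this]
  have "(\<lambda>n. conj_lower U (B \<omega>) (ereal (s n * \<xi> \<omega>))) \<longlonglongrightarrow> conj_upper U (B \<omega>) (ereal (l * \<xi> \<omega>))"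
    using l xi_pos[OF \<omega>] by simp
  then show ?thesis
    using low_eq[OF \<omega> s(1)] upp_eq[OF \<omega> l] by simp
qed

lemma low_tendsto_lowest:
  assumes \<omega>: "\<omega> \<in> space M" and s: "\<And>n. 0 < s n" "filterlim s at_top sequentially"
  shows "(\<lambda>n. low (s n) \<omega>) \<longlonglongrightarrow> lowest \<omega>"
proof -
  have "filterlim (\<lambda>n. s n * \<xi> \<omega>) at_top sequentially"
    using s(2) xi_pos[OF \<omega>] by (simp add: filterlim_at_top_mult_tendsto_pos mult.commute[of "s _"] 
        filterlim_tendsto_pos_mult_at_top[OF tendsto_const])
  from filterlim_compose[OF state_utility.conj_lower_at_top[OF state[OF \<omega>]] this]
  have "(\<lambda>n. conj_lower U (B \<omega>) (ereal (s n * \<xi> \<omega>))) \<longlonglongrightarrow> dom_inf U (B \<omega>)" .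
  then show ?thesis
    using low_eq[OF \<omega> s(1)] lowest_eq[OF \<omega>] by simp
qed

text \<open>
  The greatest maximizer inherits measurability as a limit of least maximizers.
\<close>
lemma measurable_upp [measurable]:
  assumes "0 < l" shows "upp l \<in> borel_measurable M"
proof (rule borel_measurable_LIMSEQ_real)
  let ?s = "\<lambda>n. l * (1 - 1 / (real n + 2))"
  show "(\<lambda>n. low (?s n) \<omega>) \<longlonglongrightarrow> upp l \<omega>" if "\<omega> \<in> space M" for \<omega>
  proof (rule low_tendsto_upp[OF that])
    show "?s \<longlonglongrightarrow> l" by real_asymp
  qed (use assms in auto)
  show "low (?s n) \<in> borel_measurable M" for n
    using assms by (intro measurable_low) auto
qed

lemma quasi_integrable_lowest: "quasi_integrable M (\<lambda>\<omega>. \<xi> \<omega> * lowest \<omega>)"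
proof -
  have "neg_expectation M (\<lambda>\<omega>. ereal (\<xi> \<omega>) * dom_inf U (B \<omega>)) = neg_expectation M (\<lambda>\<omega>. ereal (\<xi> \<omega> * lowest \<omega>))"
    by (intro neg_expectation_cong_AE AE_I2) (simp add: lowest_eq)
  then show ?thesis
    using standing by (simp add: quasi_integrable_def standing_assumption_def neg_expectation_ereal)
qed

lemma quasi_integrable_ge_lowest:
  assumes "X \<in> borel_measurable M" "AE \<omega> in M. lowest \<omega> \<le> X \<omega>"
  shows "quasi_integrable M (\<lambda>\<omega>. \<xi> \<omega> * X \<omega>)"
proof (rule quasi_integrable_mono[OF quasi_integrable_lowest])
  show "AE \<omega> in M. \<xi> \<omega> * lowest \<omega> \<le> \<xi> \<omega> * X \<omega>"
    using assms(2) AE_space by eventually_elim (use xi_pos less_imp_le in \<open>auto intro!: mult_left_mono\<close>)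
qed (use assms(1) in measurable)

lemma lower_cost_eq: "0 < l \<Longrightarrow> lower_cost M \<xi> B U (ereal l) = ext_expectation M (\<lambda>\<omega>. ereal (\<xi> \<omega> * low l \<omega>))"
  unfolding lower_cost_def by (intro ext_expectation_cong_AE AE_I2) (subst low_eq, auto)

lemma upper_cost_eq: "0 < l \<Longrightarrow> upper_cost M \<xi> B U (ereal l) = ext_expectation M (\<lambda>\<omega>. ereal (\<xi> \<omega> * upp l \<omega>))"
  unfolding upper_cost_def by (intro ext_expectation_cong_AE AE_I2) (subst upp_eq, auto)

lemma cost_at_infinity:
  "lower_cost M \<xi> B U \<infinity> = ext_expectation M (\<lambda>\<omega>. ereal (\<xi> \<omega> * lowest \<omega>))"
  unfolding lower_cost_def
proof (intro ext_expectation_cong_AE AE_I2)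
  fix \<omega> assume \<omega>: "\<omega> \<in> space M"
  have "\<infinity> * ereal (\<xi> \<omega>) = \<infinity>" using xi_pos[OF \<omega>] by simp
  then show "ereal (\<xi> \<omega>) * conj_lower U (B \<omega>) (\<infinity> * ereal (\<xi> \<omega>)) = ereal (\<xi> \<omega> * lowest \<omega>)"
    by (simp only: conj_lower_def conjugate_set_def if_True) (simp add: lowest_eq[OF \<omega>])
qed

lemma quasi_integrable_low: "0 < l \<Longrightarrow> quasi_integrable M (\<lambda>\<omega>. \<xi> \<omega> * low l \<omega>)"
  using lowest_le_maximizer[OF _ low_maximizer] by (intro quasi_integrable_ge_lowest AE_I2) auto

lemma quasi_integrable_upp: "0 < l \<Longrightarrow> quasi_integrable M (\<lambda>\<omega>. \<xi> \<omega> * upp l \<omega>)"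
  using lowest_le_maximizer[OF _ upp_maximizer] by (intro quasi_integrable_ge_lowest AE_I2) auto

text \<open>
  Admissible positions are bounded below by \<open>lowest\<close>, so their cost has an integrable negative
  part, and the budget constraint makes it integrable.
\<close>
lemma admissible_iff:
  "admissible M \<xi> B U x0 X \<longleftrightarrow> X \<in> borel_measurable M \<and> (AE \<omega> in M. U (X \<omega>) (B \<omega>) > -\<infinity>) \<and>
    integrable M (\<lambda>\<omega>. \<xi> \<omega> * X \<omega>) \<and> (\<integral>\<omega>. \<xi> \<omega> * X \<omega> \<partial>M) \<le> x0"
proof -
  have "ext_expectation M (\<lambda>\<omega>. ereal (\<xi> \<omega> * X \<omega>)) \<le> ereal x0 \<longleftrightarrow>
      integrable M (\<lambda>\<omega>. \<xi> \<omega> * X \<omega>) \<and> (\<integral>\<omega>. \<xi> \<omega> * X \<omega> \<partial>M) \<le> x0"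
    if X: "X \<in> borel_measurable M" "AE \<omega> in M. U (X \<omega>) (B \<omega>) > -\<infinity>"
  proof -
    have "AE \<omega> in M. lowest \<omega> \<le> X \<omega>"
      using X(2) AE_space by eventually_elim (rule lowest_le)
    note q = quasi_integrable_ge_lowest[OF X(1) this]
    show ?thesis
      using ext_expectation_integrable[of M "\<lambda>\<omega>. \<xi> \<omega> * X \<omega>"] ext_expectation_quasi_integrable[OF q] by force
  qed
  then show ?thesis unfolding admissible_def by blast
qed

lemma expected_utility_eq:
  assumes "AE \<omega> in M. U (X \<omega>) (B \<omega>) > -\<infinity>"
  shows "expected_utility M B U X = ext_expectation M (\<lambda>\<omega>. ereal (utility X \<omega>))"
    and "expectation_exists M (\<lambda>\<omega>. U (X \<omega>) (B \<omega>)) \<longleftrightarrow> expectation_exists M (\<lambda>\<omega>. ereal (utility X \<omega>))"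
proof -
  have *: "AE \<omega> in M. U (X \<omega>) (B \<omega>) = ereal (utility X \<omega>)"
    using assms AE_space
  proof eventually_elim
    case (elim \<omega>)
    then show ?case using state_utility.U_finite[OF state[OF elim(2)], of "X \<omega>"]
      by (cases "U (X \<omega>) (B \<omega>)") (auto simp: utility_def)
  qed
  show "expected_utility M B U X = ext_expectation M (\<lambda>\<omega>. ereal (utility X \<omega>))"
    unfolding expected_utility_def by (rule ext_expectation_cong_AE[OF *])
  show "expectation_exists M (\<lambda>\<omega>. U (X \<omega>) (B \<omega>)) \<longleftrightarrow> expectation_exists M (\<lambda>\<omega>. ereal (utility X \<omega>))"
    unfolding expectation_exists_def
    using pos_expectation_cong_AE[OF *] neg_expectation_cong_AE[OF *] by simp
qed

lemma utility_le:
  assumes "\<omega> \<in> space M" "maximizer U (B \<omega>) y (X' \<omega>)" "U (X \<omega>) (B \<omega>) > -\<infinity>"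
  shows "utility X \<omega> \<le> utility X' \<omega> + y * (X \<omega> - X' \<omega>)"
proof -
  interpret S: state_utility U "B \<omega>" by (rule state) fact
  have "U (X \<omega>) (B \<omega>) \<le> U (X' \<omega>) (B \<omega>) + ereal (y * (X \<omega> - X' \<omega>))"
    using assms(2) unfolding maximizer_def by blast
  then show ?thesis
    using S.U_finite[of "X \<omega>"] S.U_finite[of "X' \<omega>"] assms(3)
    by (cases "U (X \<omega>) (B \<omega>)"; cases "U (X' \<omega>) (B \<omega>)") (auto simp: utility_def)
qed

text \<open>
  \<open>X\<close> maximizes the Lagrangian \<open>U(X, B) - l \<xi> X\<close> in almost every state.
\<close>
definition dual_optimal :: "real \<Rightarrow> ('a \<Rightarrow> real) \<Rightarrow> bool" where
  "dual_optimal l X \<longleftrightarrow> X \<in> borel_measurable M \<and> (AE \<omega> in M. maximizer U (B \<omega>) (l * \<xi> \<omega>) (X \<omega>))"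

lemma dual_optimal_low: "0 < l \<Longrightarrow> dual_optimal l (low l)"
  unfolding dual_optimal_def using low_maximizer by auto

lemma dual_optimal_upp: "0 < l \<Longrightarrow> dual_optimal l (upp l)"
  unfolding dual_optimal_def using upp_maximizer by auto

lemma dual_optimal_finite:
  assumes "dual_optimal l X" shows "AE \<omega> in M. U (X \<omega>) (B \<omega>) > -\<infinity>"
proof -
  have "AE \<omega> in M. maximizer U (B \<omega>) (l * \<xi> \<omega>) (X \<omega>)" using assms by (simp add: dual_optimal_def)
  with AE_space show ?thesis
    by eventually_elim (rule state_utility.maximizer_finite[OF state])
qed

lemma dual_optimal_utility_le:
  assumes "dual_optimal l X'" "AE \<omega> in M. U (X \<omega>) (B \<omega>) > -\<infinity>"
  shows "AE \<omega> in M. utility X \<omega> \<le> utility X' \<omega> + (l * (\<xi> \<omega> * X \<omega>) - l * (\<xi> \<omega> * X' \<omega>))"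
proof -
  have "AE \<omega> in M. maximizer U (B \<omega>) (l * \<xi> \<omega>) (X' \<omega>)" using assms(1) by (simp add: dual_optimal_def)
  with assms(2) AE_space show ?thesis
  proof eventually_elim
    case (elim \<omega>)
    from utility_le[where X = X and X' = X', OF elim(2,3,1)] show ?case by (simp add: algebra_simps)
  qed
qed

text \<open>
  The least maximizers decrease along increasing multipliers, so their costs are dominated by
  those of the first one and of the lower ends of the domains. The latter is integrable as
  it has an integrable negative part and lies below an integrable function.
\<close>
lemma lower_cost_tendsto:
  assumes s: "incseq s" "\<And>n. 0 < s n" and int: "integrable M (\<lambda>\<omega>. \<xi> \<omega> * low (s 0) \<omega>)"
    and T [measurable]: "T \<in> borel_measurable M"
    and lim: "\<And>\<omega>. \<omega> \<in> space M \<Longrightarrow> (\<lambda>n. low (s n) \<omega>) \<longlonglongrightarrow> T \<omega>"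
  shows "(\<lambda>n. lower_cost M \<xi> B U (ereal (s n))) \<longlonglongrightarrow> ext_expectation M (\<lambda>\<omega>. ereal (\<xi> \<omega> * T \<omega>))"
proof -
  have [measurable]: "low (s n) \<in> borel_measurable M" for n using s(2)[of n] by simp
  have between: "\<xi> \<omega> * lowest \<omega> \<le> \<xi> \<omega> * low (s n) \<omega>" "\<xi> \<omega> * low (s n) \<omega> \<le> \<xi> \<omega> * low (s 0) \<omega>"
    if "\<omega> \<in> space M" for \<omega> n
    using lowest_le_maximizer[OF that low_maximizer[OF that s(2)[of n]]]
      low_antimono[OF that s(2)[of 0] incseqD[OF s(1), of 0 n]] xi_pos[OF that]
    by (auto intro: mult_left_mono)
  have "ext_expectation M (\<lambda>\<omega>. ereal (\<xi> \<omega> * lowest \<omega>)) \<le> ext_expectation M (\<lambda>\<omega>. ereal (\<xi> \<omega> * low (s 0) \<omega>))"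
    using between by (intro ext_expectation_mono_AE AE_I2) auto
  also have "\<dots> < \<infinity>" using int by (simp add: ext_expectation_integrable)
  finally have int_lowest: "integrable M (\<lambda>\<omega>. \<xi> \<omega> * lowest \<omega>)"
    using quasi_integrable_iff_integrable[OF quasi_integrable_lowest] by simp
  let ?w = "\<lambda>\<omega>. \<bar>\<xi> \<omega> * lowest \<omega>\<bar> + \<bar>\<xi> \<omega> * low (s 0) \<omega>\<bar>"
  have w: "integrable M ?w" using int int_lowest by auto
  have lim': "AE \<omega> in M. (\<lambda>n. \<xi> \<omega> * low (s n) \<omega>) \<longlonglongrightarrow> \<xi> \<omega> * T \<omega>"
    using lim by (intro AE_I2 tendsto_intros) auto
  have bound: "AE \<omega> in M. norm (\<xi> \<omega> * low (s n) \<omega>) \<le> ?w \<omega>" for n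
    using between[of _ n] by (intro AE_I2) (force simp: abs_le_iff)
  have meas: "(\<lambda>\<omega>. \<xi> \<omega> * T \<omega>) \<in> borel_measurable M" "\<And>n. (\<lambda>\<omega>. \<xi> \<omega> * low (s n) \<omega>) \<in> borel_measurable M"
    by measurable
  have "(\<lambda>n. \<integral>\<omega>. \<xi> \<omega> * low (s n) \<omega> \<partial>M) \<longlonglongrightarrow> (\<integral>\<omega>. \<xi> \<omega> * T \<omega> \<partial>M)"
    by (rule integral_dominated_convergence[OF meas w lim' bound])
  moreover have "integrable M (\<lambda>\<omega>. \<xi> \<omega> * T \<omega>)" "\<And>n. integrable M (\<lambda>\<omega>. \<xi> \<omega> * low (s n) \<omega>)"
    using integrable_dominated_convergence[OF meas w lim' bound]
      integrable_dominated_convergence2[OF meas w lim' bound] by auto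
  ultimately show ?thesis
    using s(2) by (simp add: lower_cost_eq ext_expectation_integrable)
qed

end

section \<open>Improvements at infinite cost, and left limits of the cost\<close>

context utility_problem
begin

lemma admissible_quasi_integrable:
  assumes "well_defined_problem M \<xi> B U x0" "admissible M \<xi> B U x0 X" "expected_utility M B U X > -\<infinity>"
  shows "quasi_integrable M (utility X)"
proof -
  have f: "AE \<omega> in M. U (X \<omega>) (B \<omega>) > -\<infinity>" and [measurable]: "X \<in> borel_measurable M"
    using assms(2) by (auto simp: admissible_iff)
  show ?thesis
    using assms expected_utility_eq[OF f]
    by (intro quasi_integrableI_expectation) (auto simp: well_defined_problem_def)
qed

text \<open>
  Since the cost of the least maximizer at \<open>l\<close> is infinite, raising \<open>Y\<close> to it wherever it lies
  above \<open>Y\<close> costs an infinite amount. A set on which this costs exactly \<open>d\<close> is then available,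
  and maximality in these states bounds the gain of utility from below by \<open>l\<close> times the cost.
\<close>
lemma expensive_improvement:
  assumes na: "nonatomic M" and l: "0 < l" "lower_cost M \<xi> B U (ereal l) = \<infinity>"
    and Y [measurable]: "Y \<in> borel_measurable M" and fin: "AE \<omega> in M. U (Y \<omega>) (B \<omega>) > -\<infinity>"
    and int: "integrable M (\<lambda>\<omega>. \<xi> \<omega> * Y \<omega>)" and d: "0 \<le> d"
  obtains Z where "Z \<in> borel_measurable M" "AE \<omega> in M. U (Z \<omega>) (B \<omega>) > -\<infinity>"
    "integrable M (\<lambda>\<omega>. \<xi> \<omega> * Z \<omega>)" "(\<integral>\<omega>. \<xi> \<omega> * Z \<omega> \<partial>M) = (\<integral>\<omega>. \<xi> \<omega> * Y \<omega> \<partial>M) + d"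
    "\<And>\<omega>. Y \<omega> \<le> Z \<omega>" "\<And>\<omega>. Z \<omega> \<le> max (Y \<omega>) (low l \<omega>)"
    "AE \<omega> in M. utility Y \<omega> + l * (\<xi> \<omega> * Z \<omega> - \<xi> \<omega> * Y \<omega>) \<le> utility Z \<omega>"
proof -
  have [measurable]: "low l \<in> borel_measurable M" using l(1) by simp
  define f where "f \<omega> = \<xi> \<omega> * max 0 (low l \<omega> - Y \<omega>)" for \<omega>
  have f[measurable]: "f \<in> borel_measurable M" unfolding f_def[abs_def] by measurable
  have f_nonneg: "0 \<le> f \<omega>" if "\<omega> \<in> space M" for \<omega>
    using xi_pos[OF that] by (auto simp: f_def)
  have "(\<integral>\<^sup>+\<omega>. ennreal (f \<omega>) \<partial>M) = \<infinity>"
  proof (rule ccontr)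
    assume "\<not> ?thesis"
    then have "integrable M f"
      using f_nonneg by (intro integrableI_nonneg AE_I2) (auto simp: less_top)
    then have int': "integrable M (\<lambda>\<omega>. \<xi> \<omega> * Y \<omega> + f \<omega>)" using int by simp
    have "lower_cost M \<xi> B U (ereal l) \<le> ext_expectation M (\<lambda>\<omega>. ereal (\<xi> \<omega> * Y \<omega> + f \<omega>))"
      unfolding lower_cost_eq[OF l(1)]
    proof (intro ext_expectation_mono_AE AE_I2)
      fix \<omega> assume "\<omega> \<in> space M"
      then have "\<xi> \<omega> * low l \<omega> \<le> \<xi> \<omega> * (Y \<omega> + max 0 (low l \<omega> - Y \<omega>))"
        using xi_pos by (intro mult_left_mono) (auto intro: less_imp_le)
      then show "ereal (\<xi> \<omega> * low l \<omega>) \<le> ereal (\<xi> \<omega> * Y \<omega> + f \<omega>)"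
        by (simp add: f_def algebra_simps)
    qed
    also have "\<dots> < \<infinity>" by (simp add: ext_expectation_integrable[OF int'])
    finally show False using l(2) by simp
  qed
  then have "(\<integral>\<^sup>+\<omega>. ennreal (f \<omega>) * indicator (space M) \<omega> \<partial>M) = \<infinity>"
    by (subst nn_integral_cong[where v = "\<lambda>\<omega>. ennreal (f \<omega>)"]) auto
  then have d_le: "ennreal d \<le> (\<integral>\<^sup>+\<omega>. ennreal (f \<omega>) * indicator (space M) \<omega> \<partial>M)" by simp
  obtain A where A: "A \<in> sets M" "A \<subseteq> space M" "has_bochner_integral M (\<lambda>\<omega>. f \<omega> * indicator A \<omega>) d"
    by (rule nonatomic_prescribed_integral[OF finite_measure_axioms na f _ sets.top d])
      (use f_nonneg d_le in auto)
  define Z where "Z \<omega> = Y \<omega> + max 0 (low l \<omega> - Y \<omega>) * indicator A \<omega>" for \<omega>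
  have Z: "\<xi> \<omega> * Z \<omega> = \<xi> \<omega> * Y \<omega> + f \<omega> * indicator A \<omega>" for \<omega>
    by (simp add: Z_def f_def algebra_simps)
  have cases: "Z \<omega> = Y \<omega> \<or> Z \<omega> = low l \<omega>" for \<omega>
    by (auto simp: Z_def indicator_def max_def)
  have "AE \<omega> in M. U (Z \<omega>) (B \<omega>) > -\<infinity> \<and>
      utility Y \<omega> + l * (\<xi> \<omega> * Z \<omega> - \<xi> \<omega> * Y \<omega>) \<le> utility Z \<omega>"
    using fin AE_space
  proof eventually_elim
    case (elim \<omega>)
    show ?case
    proof (cases "Z \<omega> = Y \<omega>")
      case False
      then have m: "maximizer U (B \<omega>) (l * \<xi> \<omega>) (Z \<omega>)"
        using cases[of \<omega>] low_maximizer[OF elim(2) l(1)] by metis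
      from utility_le[where X = Y and X' = Z, OF elim(2) m elim(1)]
      show ?thesis
        using state_utility.maximizer_finite[OF state[OF elim(2)] m] by (simp add: algebra_simps)
    qed (use elim in \<open>auto simp: utility_def\<close>)
  qed
  then have "AE \<omega> in M. U (Z \<omega>) (B \<omega>) > -\<infinity>"
    "AE \<omega> in M. utility Y \<omega> + l * (\<xi> \<omega> * Z \<omega> - \<xi> \<omega> * Y \<omega>) \<le> utility Z \<omega>" by auto
  moreover have "Z \<in> borel_measurable M" unfolding Z_def[abs_def] using A(1) by measurable
  moreover have "has_bochner_integral M (\<lambda>\<omega>. \<xi> \<omega> * Z \<omega>) ((\<integral>\<omega>. \<xi> \<omega> * Y \<omega> \<partial>M) + d)"
    unfolding Z using int A(3) by (intro has_bochner_integral_add has_bochner_integral_integrable)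
  then have "integrable M (\<lambda>\<omega>. \<xi> \<omega> * Z \<omega>)" "(\<integral>\<omega>. \<xi> \<omega> * Z \<omega> \<partial>M) = (\<integral>\<omega>. \<xi> \<omega> * Y \<omega> \<partial>M) + d"
    by (auto simp: has_bochner_integral_iff)
  moreover have "Y \<omega> \<le> Z \<omega>" "Z \<omega> \<le> max (Y \<omega>) (low l \<omega>)" for \<omega>
    by (auto simp: Z_def indicator_def)
  ultimately show ?thesis using that by blast
qed

text \<open>
  Stated for an arbitrary statewise limit \<open>T\<close> in order to cover finite multipliers, where \<open>T\<close>
  is the greatest maximizer, and the multiplier \<open>\<infinity>\<close>, where \<open>T\<close> is the lower end of the domain.
\<close>
lemma lower_cost_at_left:
  assumes l: "0 \<le> l0" "ereal l0 < l" and fin: "\<And>l'::real. l0 < l' \<Longrightarrow> lower_cost M \<xi> B U (ereal l') < \<infinity>"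
    and T: "T \<in> borel_measurable M"
    and lim: "\<And>s \<omega>. \<omega> \<in> space M \<Longrightarrow> (\<And>n. 0 < s n) \<Longrightarrow> (\<And>n. ereal (s n) < l) \<Longrightarrow>
      (\<lambda>n. ereal (s n)) \<longlonglongrightarrow> l \<Longrightarrow> (\<lambda>n. low (s n) \<omega>) \<longlonglongrightarrow> T \<omega>"
  shows "Lim (at_left l) (lower_cost M \<xi> B U) = ext_expectation M (\<lambda>\<omega>. ereal (\<xi> \<omega> * T \<omega>))"
proof (rule tendsto_Lim)
  show "\<not> trivial_limit (at_left l)"
  proof
    assume "trivial_limit (at_left l)"
    then have "eventually (\<lambda>_. False) (at_left l)" by simp
    then obtain c where "c < l" "\<forall>y>c. y < l \<longrightarrow> False"
      unfolding eventually_at_left[OF l(2)] by auto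
    then show False using dense[of c l] by blast
  qed
  show "(lower_cost M \<xi> B U \<longlongrightarrow> ext_expectation M (\<lambda>\<omega>. ereal (\<xi> \<omega> * T \<omega>))) (at_left l)"
  proof (rule tendsto_at_left_sequentially[OF l(2)])
    fix S :: "nat \<Rightarrow> ereal" assume S: "\<And>n. S n < l" "\<And>n. ereal l0 < S n" "incseq S" "S \<longlonglongrightarrow> l"
    define s where "s n = real_of_ereal (S n)" for n
    have Ss: "S n = ereal (s n)" for n
      using S(1,2)[of n] by (cases "S n") (auto simp: s_def)
    have Ss_fun: "S = (\<lambda>n. ereal (s n))" using Ss by auto
    have s: "l0 < s n" "0 < s n" for n using S(2)[of n] l(1) by (auto simp: Ss)
    have "integrable M (\<lambda>\<omega>. \<xi> \<omega> * low (s 0) \<omega>)"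
      using quasi_integrable_iff_integrable[OF quasi_integrable_low[OF s(2)[of 0]]] fin[OF s(1)[of 0]] s(2)[of 0]
      by (simp add: lower_cost_eq)
    moreover have "incseq s" using S(3) by (auto simp: incseq_def Ss)
    moreover have "(\<lambda>n. ereal (s n)) \<longlonglongrightarrow> l" using S(4) by (subst (asm) Ss_fun)
    then have "(\<lambda>n. low (s n) \<omega>) \<longlonglongrightarrow> T \<omega>" if "\<omega> \<in> space M" for \<omega>
      using S(1) s(2) by (intro lim that) (simp_all add: Ss)
    ultimately show "(\<lambda>n. lower_cost M \<xi> B U (S n)) \<longlonglongrightarrow> ext_expectation M (\<lambda>\<omega>. ereal (\<xi> \<omega> * T \<omega>))"
      unfolding Ss using s(2) T by (intro lower_cost_tendsto)
  qed
qed

lemma lower_cost_at_left_real: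
  assumes "0 \<le> l0" "l0 < l" "\<And>l'::real. l0 < l' \<Longrightarrow> lower_cost M \<xi> B U (ereal l') < \<infinity>"
  shows "Lim (at_left (ereal l)) (lower_cost M \<xi> B U) = upper_cost M \<xi> B U (ereal l)"
proof -
  have "0 < l" using assms by simp
  then show ?thesis
    unfolding upper_cost_eq[OF \<open>0 < l\<close>]
    using assms by (intro lower_cost_at_left[of l0] low_tendsto_upp) auto
qed

lemma lower_cost_at_left_infinity:
  assumes "0 \<le> l0" "\<And>l'::real. l0 < l' \<Longrightarrow> lower_cost M \<xi> B U (ereal l') < \<infinity>"
  shows "Lim (at_left \<infinity>) (lower_cost M \<xi> B U) = lower_cost M \<xi> B U \<infinity>"
  unfolding cost_at_infinity
  using assms by (intro lower_cost_at_left[of l0] low_tendsto_lowest) (auto simp: tendsto_PInfty_eq_at_top)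

end

section \<open>Weak duality\<close>

locale feasible_problem = utility_problem +
  fixes x0 :: real
  assumes x0_feasible: "x0 \<in> feasible_set M \<xi> B U"
    and well_defined: "well_defined_problem M \<xi> B U x0"
begin

lemma feasible_solution:
  obtains X where "X \<in> borel_measurable M" "AE \<omega> in M. U (X \<omega>) (B \<omega>) > -\<infinity>"
    "integrable M (\<lambda>\<omega>. \<xi> \<omega> * X \<omega>)" "(\<integral>\<omega>. \<xi> \<omega> * X \<omega> \<partial>M) \<le> x0" "quasi_integrable M (utility X)"
proof -
  obtain X where X: "admissible M \<xi> B U x0 X" "expected_utility M B U X > -\<infinity>"
    using x0_feasible by (auto simp: feasible_set_def)
  from admissible_quasi_integrable[OF well_defined X] X(1) show ?thesis
    by (intro that[of X]) (auto simp: admissible_iff)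
qed

text \<open>
  A feasible solution exists, and its utility, corrected by the integrable difference of the
  costs, is a lower bound for the utility of \<open>X'\<close>.
\<close>
lemma dual_optimal_quasi_integrable:
  assumes X': "dual_optimal l X'" and int: "integrable M (\<lambda>\<omega>. \<xi> \<omega> * X' \<omega>)"
  shows "quasi_integrable M (utility X')"
proof -
  obtain X where X: "X \<in> borel_measurable M" "AE \<omega> in M. U (X \<omega>) (B \<omega>) > -\<infinity>"
    "integrable M (\<lambda>\<omega>. \<xi> \<omega> * X \<omega>)" "quasi_integrable M (utility X)" using feasible_solution by metis
  have "quasi_integrable M (\<lambda>\<omega>. utility X \<omega> + (l * (\<xi> \<omega> * X' \<omega>) - l * (\<xi> \<omega> * X \<omega>)))"
    using X(3,4) int by (intro quasi_integrable_add) auto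
  then show ?thesis
  proof (rule quasi_integrable_mono)
    show "AE \<omega> in M. utility X \<omega> + (l * (\<xi> \<omega> * X' \<omega>) - l * (\<xi> \<omega> * X \<omega>)) \<le> utility X' \<omega>"
      using dual_optimal_utility_le[OF X' X(2)] by eventually_elim simp
  qed (use X' in \<open>auto simp: dual_optimal_def\<close>)
qed

lemma weak_duality:
  assumes X': "dual_optimal l X'" and int: "integrable M (\<lambda>\<omega>. \<xi> \<omega> * X' \<omega>)"
    and X: "admissible M \<xi> B U x0 X"
  shows "expected_utility M B U X \<le>
    expected_utility M B U X' + ereal (l * ((\<integral>\<omega>. \<xi> \<omega> * X \<omega> \<partial>M) - (\<integral>\<omega>. \<xi> \<omega> * X' \<omega> \<partial>M)))"
proof -
  have X1: "AE \<omega> in M. U (X \<omega>) (B \<omega>) > -\<infinity>" and X2: "integrable M (\<lambda>\<omega>. \<xi> \<omega> * X \<omega>)"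
    using X by (auto simp: admissible_iff)
  have "expected_utility M B U X \<le>
      ext_expectation M (\<lambda>\<omega>. ereal (utility X' \<omega> + (l * (\<xi> \<omega> * X \<omega>) - l * (\<xi> \<omega> * X' \<omega>))))"
    unfolding expected_utility_eq(1)[OF X1]
    by (rule ext_expectation_mono_AE) (use dual_optimal_utility_le[OF X' X1] in eventually_elim, simp)
  also have "\<dots> = expected_utility M B U X' +
      ereal (\<integral>\<omega>. l * (\<xi> \<omega> * X \<omega>) - l * (\<xi> \<omega> * X' \<omega>) \<partial>M)"
    unfolding expected_utility_eq(1)[OF dual_optimal_finite[OF X']]
    using X2 int by (intro ext_expectation_add dual_optimal_quasi_integrable[OF X']) auto
  finally show ?thesis
    using X2 int by (simp add: right_diff_distrib)
qed

text \<open>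
  Weak duality with the cost of the competitor replaced by the budget; this is where the sign of
  the multiplier matters.
\<close>
lemma value_le:
  assumes "dual_optimal l X'" "integrable M (\<lambda>\<omega>. \<xi> \<omega> * X' \<omega>)" "0 \<le> l"
  shows "problem_value M \<xi> B U x0 \<le>
    expected_utility M B U X' + ereal (l * (x0 - (\<integral>\<omega>. \<xi> \<omega> * X' \<omega> \<partial>M)))"
  unfolding problem_value_def
proof (rule SUP_least)
  fix X assume "X \<in> {X. admissible M \<xi> B U x0 X}"
  then have X: "admissible M \<xi> B U x0 X" by simp
  have "l * ((\<integral>\<omega>. \<xi> \<omega> * X \<omega> \<partial>M) - (\<integral>\<omega>. \<xi> \<omega> * X' \<omega> \<partial>M)) \<le> l * (x0 - (\<integral>\<omega>. \<xi> \<omega> * X' \<omega> \<partial>M))"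
    using X assms(3) by (intro mult_left_mono) (auto simp: admissible_iff)
  then show "expected_utility M B U X \<le>
      expected_utility M B U X' + ereal (l * (x0 - (\<integral>\<omega>. \<xi> \<omega> * X' \<omega> \<partial>M)))"
    using weak_duality[OF assms(1,2) X] by (meson add_left_mono ereal_less_eq(3) order_trans)
qed

lemma value_ge: "admissible M \<xi> B U x0 X \<Longrightarrow> expected_utility M B U X \<le> problem_value M \<xi> B U x0"
  unfolding problem_value_def by (rule SUP_upper) simp

lemma optimal_if_dual_optimal:
  assumes "dual_optimal l X'" "0 \<le> l"
    and "integrable M (\<lambda>\<omega>. \<xi> \<omega> * X' \<omega>)" "(\<integral>\<omega>. \<xi> \<omega> * X' \<omega> \<partial>M) = x0"
  shows "optimal_solution M \<xi> B U x0 X'"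
proof -
  have "admissible M \<xi> B U x0 X'"
    using assms dual_optimal_finite[OF assms(1)] by (auto simp: admissible_iff dual_optimal_def)
  with value_le[OF assms(1,3,2)] value_ge show ?thesis
    using assms(4) by (auto simp: optimal_solution_def zero_ereal_def[symmetric] intro: antisym)
qed

text \<open>
  Switch from \<open>X1\<close> to \<open>X2\<close> on a set \<open>A\<close> whose extra cost \<open>c\<close> exhausts the budget. As \<open>c\<close> is less
  than the extra cost of switching everywhere, the complement of \<open>A\<close> also carries some extra
  cost, and any sufficiently small amount \<open>t\<close> of it can be traded against the same amount inside
  \<open>A\<close>. The amount left inside \<open>A\<close> tells the resulting solutions apart.
\<close>
lemma infinitely_many_between:
  assumes na: "nonatomic M" and l: "0 \<le> l"
    and X: "dual_optimal l X1" "dual_optimal l X2" and le: "\<And>\<omega>. \<omega> \<in> space M \<Longrightarrow> X1 \<omega> \<le> X2 \<omega>"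
    and int: "integrable M (\<lambda>\<omega>. \<xi> \<omega> * X1 \<omega>)" and less: "(\<integral>\<omega>. \<xi> \<omega> * X1 \<omega> \<partial>M) < x0"
    and X2_less: "ereal x0 < ext_expectation M (\<lambda>\<omega>. ereal (\<xi> \<omega> * X2 \<omega>))"
  shows "infinitely_many_optimal_solutions M \<xi> B U x0"
proof -
  have [measurable]: "X1 \<in> borel_measurable M" "X2 \<in> borel_measurable M"
    using X by (auto simp: dual_optimal_def)
  define f where "f \<omega> = \<xi> \<omega> * (X2 \<omega> - X1 \<omega>)" for \<omega>
  have f[measurable]: "f \<in> borel_measurable M" unfolding f_def[abs_def] by measurable
  have f_nonneg: "0 \<le> f \<omega>" if "\<omega> \<in> space M" for \<omega>
    using xi_pos[OF that] le[OF that] by (auto simp: f_def)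
  define c where "c = x0 - (\<integral>\<omega>. \<xi> \<omega> * X1 \<omega> \<partial>M)"
  have c: "0 < c" using less by (simp add: c_def)
  have f_gt: "ennreal c < (\<integral>\<^sup>+\<omega>. ennreal (f \<omega>) \<partial>M)"
  proof (cases "(\<integral>\<^sup>+\<omega>. ennreal (f \<omega>) \<partial>M) = \<infinity>")
    case False
    then have int_f: "integrable M f"
      using f_nonneg by (intro integrableI_nonneg AE_I2) (auto simp: less_top)
    have "(\<lambda>\<omega>. ereal (\<xi> \<omega> * X2 \<omega>)) = (\<lambda>\<omega>. ereal (\<xi> \<omega> * X1 \<omega> + f \<omega>))"
      by (simp add: f_def algebra_simps)
    then have "ext_expectation M (\<lambda>\<omega>. ereal (\<xi> \<omega> * X2 \<omega>)) = ereal ((\<integral>\<omega>. \<xi> \<omega> * X1 \<omega> \<partial>M) + (\<integral>\<omega>. f \<omega> \<partial>M))"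
      using int int_f by (simp add: ext_expectation_integrable)
    then have "c < (\<integral>\<omega>. f \<omega> \<partial>M)" using X2_less by (simp add: c_def)
    then show ?thesis
      using int_f f_nonneg c by (subst nn_integral_eq_integral) (auto simp: ennreal_less_iff)
  qed (auto simp: less_top)
  have "(\<integral>\<^sup>+\<omega>. ennreal (f \<omega>) * indicator (space M) \<omega> \<partial>M) = (\<integral>\<^sup>+\<omega>. ennreal (f \<omega>) \<partial>M)"
    by (intro nn_integral_cong) auto
  with f_gt have c_le: "ennreal c \<le> (\<integral>\<^sup>+\<omega>. ennreal (f \<omega>) * indicator (space M) \<omega> \<partial>M)" by simp
  obtain A where A: "A \<in> sets M" "A \<subseteq> space M" "has_bochner_integral M (\<lambda>\<omega>. f \<omega> * indicator A \<omega>) c"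
    by (rule nonatomic_prescribed_integral[OF finite_measure_axioms na f _ sets.top less_imp_le[OF c]])
      (use f_nonneg c_le in auto)
  have A_eq: "(\<integral>\<^sup>+\<omega>. ennreal (f \<omega>) * indicator A \<omega> \<partial>M) = ennreal c"
  proof -
    have "(\<integral>\<^sup>+\<omega>. ennreal (f \<omega> * indicator A \<omega>) \<partial>M) = ennreal c"
      using A(1,3) f_nonneg by (subst nn_integral_eq_integral) (auto simp: has_bochner_integral_iff indicator_def)
    then show ?thesis by (simp add: ennreal_mult'' ennreal_indicator)
  qed
  define D where "D = space M - A"
  have D: "D \<in> sets M" "A \<inter> D = {}" using A by (auto simp: D_def)
  have "(\<integral>\<^sup>+\<omega>. ennreal (f \<omega>) \<partial>M) =
      (\<integral>\<^sup>+\<omega>. ennreal (f \<omega>) * indicator A \<omega> + ennreal (f \<omega>) * indicator D \<omega> \<partial>M)"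
    by (intro nn_integral_cong) (auto simp: D_def indicator_def)
  also have "\<dots> = ennreal c + (\<integral>\<^sup>+\<omega>. ennreal (f \<omega>) * indicator D \<omega> \<partial>M)"
    using A(1) D(1) by (subst nn_integral_add) (auto simp: A_eq)
  finally have "0 < (\<integral>\<^sup>+\<omega>. ennreal (f \<omega>) * indicator D \<omega> \<partial>M)"
    using f_gt by (auto simp: zero_less_iff_neq_zero)
  then have "0 < min (ennreal c) (\<integral>\<^sup>+\<omega>. ennreal (f \<omega>) * indicator D \<omega> \<partial>M)"
    using c by simp
  then obtain d' where d': "0 < d'" "d' < min (ennreal c) (\<integral>\<^sup>+\<omega>. ennreal (f \<omega>) * indicator D \<omega> \<partial>M)"
    using dense by blast
  then obtain d where "d' = ennreal d" "0 \<le> d" by (cases d') auto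
  with d' have d: "0 < d" "d < c" "ennreal d < (\<integral>\<^sup>+\<omega>. ennreal (f \<omega>) * indicator D \<omega> \<partial>M)"
    by (auto simp: ennreal_less_iff)
  \<comment> \<open>Remove weight \<open>t\<close> from \<open>A\<close> and add the same weight from the complement.\<close>
  have "\<exists>E. E \<in> sets M \<and> has_bochner_integral M (\<lambda>\<omega>. f \<omega> * indicator E \<omega>) c \<and>
      has_bochner_integral M (\<lambda>\<omega>. f \<omega> * indicator (E \<inter> A) \<omega>) (c - t)" if t: "t \<in> {0..d}" for t
  proof -
    have ct_le: "ennreal (c - t) \<le> (\<integral>\<^sup>+\<omega>. ennreal (f \<omega>) * indicator A \<omega> \<partial>M)"
      unfolding A_eq using t d by (intro ennreal_leI) auto
    obtain A' where A': "A' \<in> sets M" "A' \<subseteq> A" "has_bochner_integral M (\<lambda>\<omega>. f \<omega> * indicator A' \<omega>) (c - t)"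
      by (rule nonatomic_prescribed_integral[OF finite_measure_axioms na f _ A(1), of "c - t"])
        (use t d f_nonneg ct_le in auto)
    have "ennreal t \<le> ennreal d" using t by (intro ennreal_leI) auto
    then have t_le: "ennreal t \<le> (\<integral>\<^sup>+\<omega>. ennreal (f \<omega>) * indicator D \<omega> \<partial>M)" using d(3) by order
    obtain D' where D': "D' \<in> sets M" "D' \<subseteq> D" "has_bochner_integral M (\<lambda>\<omega>. f \<omega> * indicator D' \<omega>) t"
      by (rule nonatomic_prescribed_integral[OF finite_measure_axioms na f _ D(1), of t])
        (use t f_nonneg t_le in auto)
    have "(\<lambda>\<omega>. f \<omega> * indicator (A' \<union> D') \<omega>) = (\<lambda>\<omega>. f \<omega> * indicator A' \<omega> + f \<omega> * indicator D' \<omega>)"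
    proof
      fix \<omega>
      have "\<not> (\<omega> \<in> A' \<and> \<omega> \<in> D')" using A'(2) D'(2) D(2) by auto
      then show "f \<omega> * indicator (A' \<union> D') \<omega> = f \<omega> * indicator A' \<omega> + f \<omega> * indicator D' \<omega>"
        by (cases "\<omega> \<in> A'"; cases "\<omega> \<in> D'") auto
    qed
    with has_bochner_integral_add[OF A'(3) D'(3)]
    have "has_bochner_integral M (\<lambda>\<omega>. f \<omega> * indicator (A' \<union> D') \<omega>) c" by simp
    moreover have "(A' \<union> D') \<inter> A = A'" using A'(2) D'(2) D(2) by auto
    ultimately show ?thesis using A'(1,3) D'(1) by (intro exI[of _ "A' \<union> D'"]) auto
  qed
  then obtain E where E: "\<And>t. t \<in> {0..d} \<Longrightarrow> E t \<in> sets M"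
    "\<And>t. t \<in> {0..d} \<Longrightarrow> has_bochner_integral M (\<lambda>\<omega>. f \<omega> * indicator (E t) \<omega>) c"
    "\<And>t. t \<in> {0..d} \<Longrightarrow> has_bochner_integral M (\<lambda>\<omega>. f \<omega> * indicator (E t \<inter> A) \<omega>) (c - t)"
    by metis
  define X where "X t \<omega> = X1 \<omega> + (X2 \<omega> - X1 \<omega>) * indicator (E t) \<omega>" for t \<omega>
  have opt: "optimal_solution M \<xi> B U x0 (X t)" if t: "t \<in> {0..d}" for t
  proof (rule optimal_if_dual_optimal[OF _ l])
    have "AE \<omega> in M. maximizer U (B \<omega>) (l * \<xi> \<omega>) (X1 \<omega>)" "AE \<omega> in M. maximizer U (B \<omega>) (l * \<xi> \<omega>) (X2 \<omega>)"
      using X by (auto simp: dual_optimal_def)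
    then have "AE \<omega> in M. maximizer U (B \<omega>) (l * \<xi> \<omega>) (X t \<omega>)"
      by eventually_elim (auto simp: X_def indicator_def)
    then show "dual_optimal l (X t)"
      unfolding dual_optimal_def X_def[abs_def] using E(1)[OF t] by auto
    have "has_bochner_integral M (\<lambda>\<omega>. \<xi> \<omega> * X1 \<omega> + f \<omega> * indicator (E t) \<omega>) ((\<integral>\<omega>. \<xi> \<omega> * X1 \<omega> \<partial>M) + c)"
      using int by (intro has_bochner_integral_add has_bochner_integral_integrable E(2) t)
    moreover have "(\<lambda>\<omega>. \<xi> \<omega> * X1 \<omega> + f \<omega> * indicator (E t) \<omega>) = (\<lambda>\<omega>. \<xi> \<omega> * X t \<omega>)"
      by (auto simp: X_def f_def algebra_simps)
    ultimately show "integrable M (\<lambda>\<omega>. \<xi> \<omega> * X t \<omega>)" "(\<integral>\<omega>. \<xi> \<omega> * X t \<omega> \<partial>M) = x0"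
      by (auto simp: has_bochner_integral_iff c_def)
  qed
  have distinct: "t = s" if ts: "t \<in> {0..d}" "s \<in> {0..d}" and eq: "AE \<omega> in M. X t \<omega> = X s \<omega>" for t s
  proof -
    have "AE \<omega> in M. f \<omega> * indicator (E t \<inter> A) \<omega> = f \<omega> * indicator (E s \<inter> A) \<omega>"
      using eq by eventually_elim (auto simp: X_def f_def indicator_def split: if_splits)
    then have "(\<integral>\<omega>. f \<omega> * indicator (E t \<inter> A) \<omega> \<partial>M) = (\<integral>\<omega>. f \<omega> * indicator (E s \<inter> A) \<omega> \<partial>M)"
      using E(1)[OF ts(1)] E(1)[OF ts(2)] A(1) by (intro integral_cong_AE) auto
    with E(3)[OF ts(1)] E(3)[OF ts(2)] show ?thesis by (simp add: has_bochner_integral_iff)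
  qed
  let ?R = "{(X, Y). AE \<omega> in M. X \<omega> = (Y \<omega> :: real)}"
  have "inj_on (\<lambda>t. ?R `` {X t}) {0..d}"
  proof (rule inj_onI)
    fix t s assume ts: "t \<in> {0..d}" "s \<in> {0..d}" and eq: "?R `` {X t} = ?R `` {X s}"
    have "X s \<in> ?R `` {X s}" by simp
    then have "X s \<in> ?R `` {X t}" unfolding eq .
    then show "t = s" by (intro distinct[OF ts]) simp
  qed
  then have "infinite ((\<lambda>t. ?R `` {X t}) ` {0..d})"
    using d(1) by (simp add: finite_image_iff)
  moreover have "(\<lambda>t. ?R `` {X t}) ` {0..d} \<subseteq> {X. optimal_solution M \<xi> B U x0 X} // ?R"
    using opt by (intro image_subsetI quotientI) simp
  ultimately show ?thesis
    unfolding infinitely_many_optimal_solutions_def using infinite_super by blast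
qed

end

section \<open>Budgets outside the range of the costs\<close>

context utility_problem
begin

lemma expected_utility_improvement:
  assumes qi: "quasi_integrable M (utility Y)"
    and fin: "AE \<omega> in M. U (Y \<omega>) (B \<omega>) > -\<infinity>" "AE \<omega> in M. U (Z \<omega>) (B \<omega>) > -\<infinity>"
    and int: "integrable M (\<lambda>\<omega>. \<xi> \<omega> * Y \<omega>)" "integrable M (\<lambda>\<omega>. \<xi> \<omega> * Z \<omega>)"
    and le: "AE \<omega> in M. utility Y \<omega> + l * (\<xi> \<omega> * Z \<omega> - \<xi> \<omega> * Y \<omega>) \<le> utility Z \<omega>"
  shows "expected_utility M B U Y + ereal (l * ((\<integral>\<omega>. \<xi> \<omega> * Z \<omega> \<partial>M) - (\<integral>\<omega>. \<xi> \<omega> * Y \<omega> \<partial>M)))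
    \<le> expected_utility M B U Z"
proof -
  have "expected_utility M B U Y + ereal (\<integral>\<omega>. l * (\<xi> \<omega> * Z \<omega> - \<xi> \<omega> * Y \<omega>) \<partial>M) =
      ext_expectation M (\<lambda>\<omega>. ereal (utility Y \<omega> + l * (\<xi> \<omega> * Z \<omega> - \<xi> \<omega> * Y \<omega>)))"
    unfolding expected_utility_eq(1)[OF fin(1)] using int by (intro ext_expectation_add[symmetric] qi) auto
  also have "\<dots> \<le> expected_utility M B U Z"
    unfolding expected_utility_eq(1)[OF fin(2)]
    by (rule ext_expectation_mono_AE) (use le in eventually_elim, simp)
  finally show ?thesis using int by simp
qed

text \<open>
  Equality in the statewise duality bound means that \<open>X\<close> is a maximizer too.
\<close>
lemma maximizer_transfer:
  assumes "\<omega> \<in> space M" "maximizer U (B \<omega>) y (X' \<omega>)" "U (X \<omega>) (B \<omega>) > -\<infinity>"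
    and eq: "utility X \<omega> = utility X' \<omega> + y * (X \<omega> - X' \<omega>)"
  shows "maximizer U (B \<omega>) y (X \<omega>)"
proof -
  interpret S: state_utility U "B \<omega>" by (rule state) fact
  have U: "U (X \<omega>) (B \<omega>) = ereal (utility X \<omega>)" "U (X' \<omega>) (B \<omega>) = ereal (utility X' \<omega>)"
    using S.U_finite[of "X \<omega>"] S.U_finite[of "X' \<omega>"] assms(3) S.maximizer_finite[OF assms(2)]
    by (auto simp: utility_def ereal_real)
  show ?thesis
    using assms(2) unfolding maximizer_def U eq by (simp add: algebra_simps)
qed

end

context feasible_problem
begin

text \<open>
  If a feasible solution \<open>X\<close> uses the whole budget, then the assumption forces \<open>X > lowest\<close> with
  positive probability. Moving halfway down to \<open>lowest\<close> stays in the interior of the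
  domain, and on a set where the utility at the midpoint is bounded below this spoils neither
  feasibility nor quasi-integrability, while it releases a positive amount.
\<close>
lemma solution_below_budget:
  assumes ne: "ereal x0 \<noteq> ext_expectation M (\<lambda>\<omega>. ereal (\<xi> \<omega>) * dom_inf U (B \<omega>))"
  obtains Y where "Y \<in> borel_measurable M" "AE \<omega> in M. U (Y \<omega>) (B \<omega>) > -\<infinity>"
    "integrable M (\<lambda>\<omega>. \<xi> \<omega> * Y \<omega>)" "(\<integral>\<omega>. \<xi> \<omega> * Y \<omega> \<partial>M) < x0" "quasi_integrable M (utility Y)"
proof -
  obtain X where X: "X \<in> borel_measurable M" "AE \<omega> in M. U (X \<omega>) (B \<omega>) > -\<infinity>"
    "integrable M (\<lambda>\<omega>. \<xi> \<omega> * X \<omega>)" "(\<integral>\<omega>. \<xi> \<omega> * X \<omega> \<partial>M) \<le> x0" "quasi_integrable M (utility X)"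
    using feasible_solution by metis
  show ?thesis
  proof (cases "(\<integral>\<omega>. \<xi> \<omega> * X \<omega> \<partial>M) < x0")
    case True
    with X that show ?thesis by blast
  next
    case False
    then have cost: "(\<integral>\<omega>. \<xi> \<omega> * X \<omega> \<partial>M) = x0" using X(4) by simp
    note X(1)[measurable]
    have ge: "AE \<omega> in M. lowest \<omega> \<le> X \<omega>"
      using X(2) AE_space by eventually_elim (rule lowest_le)
    define W where "W \<omega> = (X \<omega> + lowest \<omega>) / 2" for \<omega>
    have [measurable]: "W \<in> borel_measurable M" unfolding W_def[abs_def] by measurable
    \<comment> \<open>The states in which moving to the midpoint \<open>W\<close> leaves a utility of at least \<open>-n\<close>.\<close>
    define G where "G n = {\<omega>\<in>space M. lowest \<omega> < X \<omega> \<and> ereal (- real n) \<le> U (W \<omega>) (B \<omega>)}" for n :: nat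
    have [measurable]: "G n \<in> sets M" for n unfolding G_def by measurable
    have "\<exists>n. G n \<notin> null_sets M"
    proof (rule ccontr)
      assume "\<not> ?thesis"
      then have "AE \<omega> in M. \<forall>n. \<omega> \<notin> G n"
        unfolding AE_all_countable using AE_not_in by blast
      then have "AE \<omega> in M. ereal (\<xi> \<omega>) * dom_inf U (B \<omega>) = ereal (\<xi> \<omega> * X \<omega>)"
        using ge AE_space
      proof eventually_elim
        case (elim \<omega>)
        have "\<not> lowest \<omega> < X \<omega>"
        proof
          assume less: "lowest \<omega> < X \<omega>"
          then have "U (W \<omega>) (B \<omega>) > -\<infinity>" using elim(3) by (intro above_lowest) (auto simp: W_def)
          then obtain n where "ereal (- real n) \<le> U (W \<omega>) (B \<omega>)"
          proof (cases "U (W \<omega>) (B \<omega>)")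
            case (real u)
            obtain n where "- u \<le> real n" using real_arch_simple by blast
            then show thesis using real by (intro that[of n]) auto
          qed auto
          with less elim(1,3) show False by (auto simp: G_def)
        qed
        with elim(2) lowest_eq[OF elim(3)] show ?case by simp
      qed
      then have "ext_expectation M (\<lambda>\<omega>. ereal (\<xi> \<omega>) * dom_inf U (B \<omega>)) = ext_expectation M (\<lambda>\<omega>. ereal (\<xi> \<omega> * X \<omega>))"
        by (rule ext_expectation_cong_AE)
      with ne show False by (simp add: ext_expectation_integrable[OF X(3)] cost)
    qed
    then obtain n where n: "G n \<notin> null_sets M" by blast
    define Y where "Y \<omega> = (if \<omega> \<in> G n then W \<omega> else X \<omega>)" for \<omega>
    have [measurable]: "Y \<in> borel_measurable M" unfolding Y_def[abs_def] by measurable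
    have Y_ge: "AE \<omega> in M. lowest \<omega> \<le> Y \<omega>"
      using ge by eventually_elim (auto simp: Y_def W_def)
    have Y_less: "Y \<omega> < X \<omega>" if "\<omega> \<in> G n" for \<omega> using that by (auto simp: Y_def W_def G_def)
    have xY_le: "\<xi> \<omega> * Y \<omega> \<le> \<xi> \<omega> * X \<omega>" if "\<omega> \<in> space M" for \<omega>
      using xi_pos[OF that] Y_less[of \<omega>] by (intro mult_left_mono) (auto simp: Y_def)
    have "ext_expectation M (\<lambda>\<omega>. ereal (\<xi> \<omega> * Y \<omega>)) \<le> ext_expectation M (\<lambda>\<omega>. ereal (\<xi> \<omega> * X \<omega>))"
      using xY_le by (intro ext_expectation_mono_AE AE_I2) auto
    also have "\<dots> < \<infinity>" by (simp add: ext_expectation_integrable[OF X(3)])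
    finally have int: "integrable M (\<lambda>\<omega>. \<xi> \<omega> * Y \<omega>)"
      using quasi_integrable_iff_integrable[OF quasi_integrable_ge_lowest[OF _ Y_ge]] by simp
    have "(\<integral>\<omega>. \<xi> \<omega> * Y \<omega> \<partial>M) < (\<integral>\<omega>. \<xi> \<omega> * X \<omega> \<partial>M)"
    proof (rule integral_less_AE[OF int X(3)])
      show "emeasure M (G n) \<noteq> 0" "G n \<in> sets M" using n by (auto simp: null_sets_def)
      show "AE \<omega> in M. \<omega> \<in> G n \<longrightarrow> \<xi> \<omega> * Y \<omega> \<noteq> \<xi> \<omega> * X \<omega>"
        using Y_less xi_pos by (intro AE_I2) force
      show "AE \<omega> in M. \<xi> \<omega> * Y \<omega> \<le> \<xi> \<omega> * X \<omega>" using xY_le by (intro AE_I2)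
    qed
    moreover have fin: "AE \<omega> in M. U (Y \<omega>) (B \<omega>) > -\<infinity>"
      using X(2) by eventually_elim (auto simp: Y_def G_def)
    moreover have "quasi_integrable M (utility Y)"
    proof (rule quasi_integrable_mono)
      have "quasi_integrable M (\<lambda>\<omega>. - max 0 (- utility X \<omega>))"
      proof -
        have "ennreal (max 0 (- utility X \<omega>)) = ennreal (- utility X \<omega>)" for \<omega>
          by (auto simp: max_def ennreal_neg)
        then show ?thesis using X(5) by (simp add: quasi_integrable_def)
      qed
      then show "quasi_integrable M (\<lambda>\<omega>. - max 0 (- utility X \<omega>) + (- real n))"
        by (rule quasi_integrable_add) simp
      show "AE \<omega> in M. - max 0 (- utility X \<omega>) + (- real n) \<le> utility Y \<omega>"
        using AE_space
      proof eventually_elim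
        case (elim \<omega>)
        show ?case
        proof (cases "\<omega> \<in> G n")
          case True
          then have "- real n \<le> utility Y \<omega>"
            using state_utility.U_finite[OF state[OF elim], of "W \<omega>"]
            by (cases "U (W \<omega>) (B \<omega>)") (auto simp: G_def Y_def utility_def)
          then show ?thesis by simp
        next
          case False
          then have "utility Y \<omega> = utility X \<omega>" by (simp add: Y_def utility_def)
          then show ?thesis by simp
        qed
      qed
    qed simp
    ultimately show ?thesis using int cost by (intro that[of Y]) auto
  qed
qed

text \<open>
  The unspent amount \<open>d\<close> buys at least \<open>l * d\<close> of expected utility for every multiplier \<open>l\<close>.
\<close>
lemma value_infinite:
  assumes na: "nonatomic M"
    and inf: "\<And>l::real. 0 < l \<Longrightarrow> lower_cost M \<xi> B U (ereal l) = \<infinity>"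
    and ne: "ereal x0 \<noteq> ext_expectation M (\<lambda>\<omega>. ereal (\<xi> \<omega>) * dom_inf U (B \<omega>))"
  shows "problem_value M \<xi> B U x0 = \<infinity>"
proof -
  obtain Y where Y: "Y \<in> borel_measurable M" "AE \<omega> in M. U (Y \<omega>) (B \<omega>) > -\<infinity>"
    "integrable M (\<lambda>\<omega>. \<xi> \<omega> * Y \<omega>)" "(\<integral>\<omega>. \<xi> \<omega> * Y \<omega> \<partial>M) < x0" "quasi_integrable M (utility Y)"
    using solution_below_budget[OF ne] by metis
  define d where "d = x0 - (\<integral>\<omega>. \<xi> \<omega> * Y \<omega> \<partial>M)"
  have d: "0 < d" using Y(4) by (simp add: d_def)
  have ge: "expected_utility M B U Y + ereal (l * d) \<le> problem_value M \<xi> B U x0" if l: "0 < l" for l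
  proof -
    obtain Z where Z: "Z \<in> borel_measurable M" "AE \<omega> in M. U (Z \<omega>) (B \<omega>) > -\<infinity>"
      "integrable M (\<lambda>\<omega>. \<xi> \<omega> * Z \<omega>)" "(\<integral>\<omega>. \<xi> \<omega> * Z \<omega> \<partial>M) = (\<integral>\<omega>. \<xi> \<omega> * Y \<omega> \<partial>M) + d"
      "AE \<omega> in M. utility Y \<omega> + l * (\<xi> \<omega> * Z \<omega> - \<xi> \<omega> * Y \<omega>) \<le> utility Z \<omega>"
      by (rule expensive_improvement[OF na l inf[OF l] Y(1,2,3) less_imp_le[OF d]])
    have "expected_utility M B U Y + ereal (l * d) \<le> expected_utility M B U Z"
      using expected_utility_improvement[OF Y(5,2) Z(2) Y(3) Z(3,5)] Z(4) by simp
    also have "\<dots> \<le> problem_value M \<xi> B U x0"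
      using Z Y(4) by (intro value_ge) (simp add: admissible_iff d_def)
    finally show ?thesis .
  qed
  have "expected_utility M B U Y > -\<infinity>"
    unfolding expected_utility_eq(1)[OF Y(2)] by (rule ext_expectation_gt_MInf[OF Y(5)])
  then show ?thesis
  proof (cases "expected_utility M B U Y")
    case (real r)
    have "ereal c \<le> problem_value M \<xi> B U x0" for c
    proof -
      define l where "l = max 1 ((c - r) / d)"
      have "(c - r) / d \<le> l" "0 < l" by (auto simp: l_def)
      then have "c - r \<le> l * d" using d by (simp add: pos_divide_le_eq)
      then have "ereal c \<le> ereal r + ereal (l * d)" by simp
      also have "\<dots> \<le> problem_value M \<xi> B U x0" using ge[OF \<open>0 < l\<close>] real by simp
      finally show ?thesis .
    qed
    then show ?thesis by (rule ereal_top)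
  next
    case PInf
    then show ?thesis using ge[of 1] by simp
  qed auto
qed

text \<open>
  Invest the surplus over the cost of the greatest maximizer at \<open>l0\<close> by means of multipliers
  \<open>s k\<close> that increase to \<open>l0\<close>. The gains are at least \<open>s k\<close> times the surplus, whereas weak duality
  at \<open>l0\<close> bounds them by \<open>l0\<close> times the surplus. Convergence of the positions is
  automatic, because they lie between the maximizers at \<open>l0\<close> and at \<open>s k\<close>.
\<close>
lemma surplus_budget:
  assumes na: "nonatomic M" and l0: "0 < l0"
    and inf: "\<And>l::real. 0 < l \<Longrightarrow> l < l0 \<Longrightarrow> lower_cost M \<xi> B U (ereal l) = \<infinity>"
    and int: "integrable M (\<lambda>\<omega>. \<xi> \<omega> * upp l0 \<omega>)" and less: "(\<integral>\<omega>. \<xi> \<omega> * upp l0 \<omega> \<partial>M) < x0"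
  obtains Z :: "nat \<Rightarrow> 'a \<Rightarrow> real" where
    "\<And>k. admissible M \<xi> B U x0 (Z k)" "\<And>k. (\<integral>\<omega>. \<xi> \<omega> * Z k \<omega> \<partial>M) = x0"
    "\<And>\<omega>. \<omega> \<in> space M \<Longrightarrow> (\<lambda>k. Z k \<omega>) \<longlonglongrightarrow> upp l0 \<omega>"
    "(\<lambda>k. expected_utility M B U (Z k)) \<longlonglongrightarrow> problem_value M \<xi> B U x0"
    "problem_value M \<xi> B U x0 =
      expected_utility M B U (upp l0) + ereal (l0 * (x0 - (\<integral>\<omega>. \<xi> \<omega> * upp l0 \<omega> \<partial>M)))"
proof -
  define d where "d = x0 - (\<integral>\<omega>. \<xi> \<omega> * upp l0 \<omega> \<partial>M)"
  have d: "0 \<le> d" using less by (simp add: d_def)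
  \<comment> \<open>The denominator starts at \<open>2\<close> so that every multiplier is positive.\<close>
  define s where "s k = l0 * (1 - 1 / (real k + 2))" for k :: nat
  have s: "0 < s k" "s k < l0" for k using l0 by (auto simp: s_def)
  have s_lim: "s \<longlonglongrightarrow> l0" unfolding s_def by real_asymp
  note dual = dual_optimal_upp[OF l0]
  note fin = dual_optimal_finite[OF dual]
  have [measurable]: "upp l0 \<in> borel_measurable M" using l0 by simp
  define good where "good k Z \<longleftrightarrow> Z \<in> borel_measurable M \<and> (AE \<omega> in M. U (Z \<omega>) (B \<omega>) > -\<infinity>) \<and>
      integrable M (\<lambda>\<omega>. \<xi> \<omega> * Z \<omega>) \<and> (\<integral>\<omega>. \<xi> \<omega> * Z \<omega> \<partial>M) = x0 \<and>
      (\<forall>\<omega>. upp l0 \<omega> \<le> Z \<omega> \<and> Z \<omega> \<le> max (upp l0 \<omega>) (low (s k) \<omega>)) \<and>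
      (AE \<omega> in M. utility (upp l0) \<omega> + s k * (\<xi> \<omega> * Z \<omega> - \<xi> \<omega> * upp l0 \<omega>) \<le> utility Z \<omega>)" for k Z
  have "\<exists>Z. good k Z" for k
    unfolding good_def
    by (rule expensive_improvement[OF na s(1)[of k] inf[OF s] _ fin int d]) (auto simp: d_def)
  then obtain Z where "\<And>k. good k (Z k)" by metis
  then have Z: "\<And>k. Z k \<in> borel_measurable M" "\<And>k. AE \<omega> in M. U (Z k \<omega>) (B \<omega>) > -\<infinity>"
    "\<And>k. integrable M (\<lambda>\<omega>. \<xi> \<omega> * Z k \<omega>)" "\<And>k. (\<integral>\<omega>. \<xi> \<omega> * Z k \<omega> \<partial>M) = x0"
    "\<And>k \<omega>. upp l0 \<omega> \<le> Z k \<omega>" "\<And>k \<omega>. Z k \<omega> \<le> max (upp l0 \<omega>) (low (s k) \<omega>)"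
    "\<And>k. AE \<omega> in M. utility (upp l0) \<omega> + s k * (\<xi> \<omega> * Z k \<omega> - \<xi> \<omega> * upp l0 \<omega>) \<le> utility (Z k) \<omega>"
    unfolding good_def by blast+
  have adm: "admissible M \<xi> B U x0 (Z k)" for k using Z(1-4)[of k] by (simp add: admissible_iff)
  have lim: "(\<lambda>k. Z k \<omega>) \<longlonglongrightarrow> upp l0 \<omega>" if "\<omega> \<in> space M" for \<omega>
  proof (rule tendsto_sandwich[where f = "\<lambda>_. upp l0 \<omega>"])
    have "(\<lambda>k. max (upp l0 \<omega>) (low (s k) \<omega>)) \<longlonglongrightarrow> max (upp l0 \<omega>) (upp l0 \<omega>)"
      by (intro tendsto_max tendsto_const low_tendsto_upp that s s_lim)
    then show "(\<lambda>k. max (upp l0 \<omega>) (low (s k) \<omega>)) \<longlonglongrightarrow> upp l0 \<omega>" by simp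
  qed (use Z(5,6) in auto)
  let ?u = "expected_utility M B U (upp l0)"
  have upper: "problem_value M \<xi> B U x0 \<le> ?u + ereal (l0 * d)"
    using value_le[OF dual int] l0 by (simp add: d_def)
  have lower: "?u + ereal (s k * d) \<le> expected_utility M B U (Z k)" for k
    using expected_utility_improvement[OF dual_optimal_quasi_integrable[OF dual int] fin Z(2) int Z(3,7), of k]
    by (simp add: Z(4) d_def)
  have low_lim: "(\<lambda>k. ?u + ereal (s k * d)) \<longlonglongrightarrow> ?u + ereal (l0 * d)"
    by (intro tendsto_add_ereal_general1 tendsto_const tendsto_ereal tendsto_intros s_lim) simp
  have up_ev: "\<forall>\<^sub>F k in sequentially. expected_utility M B U (Z k) \<le> ?u + ereal (l0 * d)"
    using value_ge[OF adm] upper by (intro always_eventually allI) (rule order_trans)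
  have tend: "(\<lambda>k. expected_utility M B U (Z k)) \<longlonglongrightarrow> ?u + ereal (l0 * d)"
    by (rule tendsto_sandwich[OF always_eventually[OF allI[OF lower]] up_ev low_lim tendsto_const])
  then have "?u + ereal (l0 * d) \<le> problem_value M \<xi> B U x0"
    by (rule LIMSEQ_le_const2) (intro exI allI impI value_ge[OF adm])
  with upper have eq: "problem_value M \<xi> B U x0 = ?u + ereal (l0 * d)" by (rule antisym)
  show ?thesis
    using tend eq by (intro that[OF adm Z(4) lim]) (simp_all add: d_def)
qed

text \<open>
  A finite optimum would have zero duality gap at the multiplier \<open>l0\<close>. It would then consist of
  maximizers at \<open>l0\<close> and spend the whole budget, but the greatest maximizer spends less.
\<close>
lemma no_finite_optimum:
  assumes l0: "0 < l0"
    and int: "integrable M (\<lambda>\<omega>. \<xi> \<omega> * upp l0 \<omega>)" and less: "(\<integral>\<omega>. \<xi> \<omega> * upp l0 \<omega> \<partial>M) < x0"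
    and val: "problem_value M \<xi> B U x0 =
      expected_utility M B U (upp l0) + ereal (l0 * (x0 - (\<integral>\<omega>. \<xi> \<omega> * upp l0 \<omega> \<partial>M)))"
    and opt: "optimal_solution M \<xi> B U x0 X"
  shows "expected_utility M B U X = \<infinity>"
proof (rule ccontr)
  assume "expected_utility M B U X \<noteq> \<infinity>"
  note dual = dual_optimal_upp[OF l0]
  note fin = dual_optimal_finite[OF dual]
  note qi = dual_optimal_quasi_integrable[OF dual int]
  let ?P = "upp l0"
  have X: "admissible M \<xi> B U x0 X"
    "expected_utility M B U X = expected_utility M B U ?P + ereal (l0 * (x0 - (\<integral>\<omega>. \<xi> \<omega> * ?P \<omega> \<partial>M)))"
    using opt val by (auto simp: optimal_solution_def)
  have X1: "AE \<omega> in M. U (X \<omega>) (B \<omega>) > -\<infinity>" and [measurable]: "X \<in> borel_measurable M"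
    and X_int: "integrable M (\<lambda>\<omega>. \<xi> \<omega> * X \<omega>)" and X_cost: "(\<integral>\<omega>. \<xi> \<omega> * X \<omega> \<partial>M) \<le> x0"
    using X(1) by (auto simp: admissible_iff)
  have "expected_utility M B U ?P < \<infinity>"
    using X(2) \<open>expected_utility M B U X \<noteq> \<infinity>\<close> by (cases "expected_utility M B U ?P") auto
  then have P_int: "integrable M (utility ?P)"
    using quasi_integrable_iff_integrable[OF qi] expected_utility_eq(1)[OF fin] by simp
  then have P_eu: "expected_utility M B U ?P = ereal (\<integral>\<omega>. utility ?P \<omega> \<partial>M)"
    by (simp add: expected_utility_eq(1)[OF fin] ext_expectation_integrable)
  then have "expected_utility M B U X > -\<infinity>" using X(2) by simp
  note qiX = admissible_quasi_integrable[OF well_defined X(1) this]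
  have XU_int: "integrable M (utility X)"
    using quasi_integrable_iff_integrable[OF qiX] expected_utility_eq(1)[OF X1]
      \<open>expected_utility M B U X \<noteq> \<infinity>\<close> by simp
  then have X_eu: "(\<integral>\<omega>. utility X \<omega> \<partial>M) =
      (\<integral>\<omega>. utility ?P \<omega> \<partial>M) + l0 * (x0 - (\<integral>\<omega>. \<xi> \<omega> * ?P \<omega> \<partial>M))"
    using X(2) P_eu by (simp add: expected_utility_eq(1)[OF X1] ext_expectation_integrable)
  \<comment> \<open>The statewise duality gap.\<close>
  let ?h = "\<lambda>\<omega>. utility ?P \<omega> + (l0 * (\<xi> \<omega> * X \<omega>) - l0 * (\<xi> \<omega> * ?P \<omega>)) - utility X \<omega>"
  have h_int: "integrable M ?h" using P_int XU_int X_int int by simp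
  have h_nonneg: "AE \<omega> in M. 0 \<le> ?h \<omega>"
    using dual_optimal_utility_le[OF dual X1] by eventually_elim simp
  have h_eq: "(\<integral>\<omega>. ?h \<omega> \<partial>M) = l0 * ((\<integral>\<omega>. \<xi> \<omega> * X \<omega> \<partial>M) - x0)"
    using P_int XU_int X_int int by (simp add: X_eu algebra_simps)
  moreover have "l0 * ((\<integral>\<omega>. \<xi> \<omega> * X \<omega> \<partial>M) - x0) \<le> 0"
    using l0 X_cost by (intro mult_nonneg_nonpos) auto
  ultimately have h0: "(\<integral>\<omega>. ?h \<omega> \<partial>M) = 0" using integral_nonneg_AE[OF h_nonneg] by linarith
  then have cost: "(\<integral>\<omega>. \<xi> \<omega> * X \<omega> \<partial>M) = x0" using h_eq l0 by simp
  have "AE \<omega> in M. ?h \<omega> = 0"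
    using h0 integral_nonneg_eq_0_iff_AE[OF h_int h_nonneg] by simp
  then have "AE \<omega> in M. X \<omega> \<le> ?P \<omega>"
    using X1 AE_space
  proof eventually_elim
    case (elim \<omega>)
    have "maximizer U (B \<omega>) (l0 * \<xi> \<omega>) (X \<omega>)"
      using elim(1) by (intro maximizer_transfer[where X = X and X' = ?P, OF elim(3) upp_maximizer[OF elim(3) l0] elim(2)])
        (simp add: algebra_simps)
    then show ?case by (rule upp_greatest[OF elim(3) l0])
  qed
  then have "AE \<omega> in M. \<xi> \<omega> * X \<omega> \<le> \<xi> \<omega> * ?P \<omega>"
    using AE_space by eventually_elim (use xi_pos in \<open>auto intro!: mult_left_mono less_imp_le\<close>)
  then have "x0 \<le> (\<integral>\<omega>. \<xi> \<omega> * ?P \<omega> \<partial>M)"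
    unfolding cost[symmetric] using X_int int by (intro integral_mono_AE)
  with less show False by simp
qed

end

section \<open>Optimal, bliss and approximating solutions\<close>

context utility_problem
begin

lemma lower_cost_integrable:
  assumes "0 < l" "lower_cost M \<xi> B U (ereal l) < \<infinity>"
  shows "integrable M (\<lambda>\<omega>. \<xi> \<omega> * low l \<omega>)"
    and "lower_cost M \<xi> B U (ereal l) = ereal (\<integral>\<omega>. \<xi> \<omega> * low l \<omega> \<partial>M)"
proof -
  show "integrable M (\<lambda>\<omega>. \<xi> \<omega> * low l \<omega>)"
    using quasi_integrable_iff_integrable[OF quasi_integrable_low] assms by (simp add: lower_cost_eq)
  then show "lower_cost M \<xi> B U (ereal l) = ereal (\<integral>\<omega>. \<xi> \<omega> * low l \<omega> \<partial>M)"
    using assms(1) by (simp add: lower_cost_eq ext_expectation_integrable)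
qed

lemma upper_cost_integrable:
  assumes "0 < l" "upper_cost M \<xi> B U (ereal l) < \<infinity>"
  shows "integrable M (\<lambda>\<omega>. \<xi> \<omega> * upp l \<omega>)"
    and "upper_cost M \<xi> B U (ereal l) = ereal (\<integral>\<omega>. \<xi> \<omega> * upp l \<omega> \<partial>M)"
proof -
  show "integrable M (\<lambda>\<omega>. \<xi> \<omega> * upp l \<omega>)"
    using quasi_integrable_iff_integrable[OF quasi_integrable_upp] assms by (simp add: upper_cost_eq)
  then show "upper_cost M \<xi> B U (ereal l) = ereal (\<integral>\<omega>. \<xi> \<omega> * upp l \<omega> \<partial>M)"
    using assms(1) by (simp add: upper_cost_eq ext_expectation_integrable)
qed

text \<open>
  At the multiplier \<open>0\<close> the least maximizer is the bliss point, which can be infinite; finite cost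
  excludes this outside a null set.
\<close>
lemma bliss_policy:
  assumes fin: "lower_cost M \<xi> B U 0 < \<infinity>"
  shows "AE \<omega> in M. \<bar>conj_lower U (B \<omega>) 0\<bar> \<noteq> \<infinity>"
    and "dual_optimal 0 (low 0)"
    and "integrable M (\<lambda>\<omega>. \<xi> \<omega> * low 0 \<omega>)"
    and "lower_cost M \<xi> B U 0 = ereal (\<integral>\<omega>. \<xi> \<omega> * low 0 \<omega> \<partial>M)"
proof -
  let ?X = "\<lambda>\<omega>. conj_lower U (B \<omega>) 0"
  have meas: "?X \<in> borel_measurable M"
    using measurable_conj_lower[of 0] by (simp add: zero_ereal_def[symmetric])
  have low0: "low 0 \<omega> = real_of_ereal (?X \<omega>)" for \<omega> by (simp add: low_def zero_ereal_def[symmetric])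
  have [measurable]: "low 0 \<in> borel_measurable M" by simp
  have not_MInf: "?X \<omega> \<noteq> -\<infinity>" if "\<omega> \<in> space M" for \<omega>
    using state_utility.dom_inf_le_conj_lower[OF state[OF that], of 0] lowest_eq[OF that]
    by (auto simp: zero_ereal_def[symmetric])
  have cost: "lower_cost M \<xi> B U 0 = ext_expectation M (\<lambda>\<omega>. ereal (\<xi> \<omega>) * ?X \<omega>)"
    by (simp add: lower_cost_def)
  have "AE \<omega> in M. ?X \<omega> \<noteq> \<infinity>"
  proof (rule ccontr)
    assume not_AE: "\<not> ?thesis"
    let ?A = "{\<omega>\<in>space M. ?X \<omega> = \<infinity>}"
    have A: "?A \<in> sets M" using meas by measurable
    have "?A \<notin> null_sets M" using not_AE AE_iff_null_sets[OF A] by (auto elim: AE_mp)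
    then have "\<infinity> * emeasure M ?A = \<infinity>" using A by (simp add: null_sets_def ennreal_top_mult)
    then have "(\<integral>\<^sup>+\<omega>. \<infinity> * indicator ?A \<omega> \<partial>M) = \<infinity>"
      unfolding nn_integral_cmult_indicator[OF A] .
    moreover have "(\<integral>\<^sup>+\<omega>. \<infinity> * indicator ?A \<omega> \<partial>M) \<le> pos_expectation M (\<lambda>\<omega>. ereal (\<xi> \<omega>) * ?X \<omega>)"
      unfolding pos_expectation_def
      by (intro nn_integral_mono) (auto simp: indicator_def dest: xi_pos)
    ultimately have "pos_expectation M (\<lambda>\<omega>. ereal (\<xi> \<omega>) * ?X \<omega>) = \<infinity>" by (simp add: top_unique)
    then show False using fin unfolding cost ext_expectation_def by simp
  qed
  then show finite: "AE \<omega> in M. \<bar>?X \<omega>\<bar> \<noteq> \<infinity>"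
    using AE_space by eventually_elim (use not_MInf in \<open>auto simp: abs_eq_infinity_cases\<close>)
  have max: "AE \<omega> in M. maximizer U (B \<omega>) (0 * \<xi> \<omega>) (low 0 \<omega>)"
    using finite AE_space
  proof eventually_elim
    case (elim \<omega>)
    show ?case
    proof (rule state_utility.conj_lower_cases[OF state[OF elim(2)], of 0])
      fix x assume "maximizer U (B \<omega>) 0 x" "conj_lower U (B \<omega>) (ereal 0) = ereal x"
      then show ?thesis by (simp add: low_def zero_ereal_def)
    qed (use elim(1) in \<open>simp add: zero_ereal_def\<close>)
  qed
  then show dual: "dual_optimal 0 (low 0)" by (simp add: dual_optimal_def)
  have "AE \<omega> in M. lowest \<omega> \<le> low 0 \<omega>"
    using max AE_space by eventually_elim (rule lowest_le_maximizer)
  then have qi: "quasi_integrable M (\<lambda>\<omega>. \<xi> \<omega> * low 0 \<omega>)"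
    by (intro quasi_integrable_ge_lowest) auto
  have cost': "lower_cost M \<xi> B U 0 = ext_expectation M (\<lambda>\<omega>. ereal (\<xi> \<omega> * low 0 \<omega>))"
    unfolding cost
  proof (rule ext_expectation_cong_AE)
    show "AE \<omega> in M. ereal (\<xi> \<omega>) * ?X \<omega> = ereal (\<xi> \<omega> * low 0 \<omega>)"
      using finite
    proof eventually_elim
      case (elim \<omega>)
      then have "?X \<omega> = ereal (low 0 \<omega>)" unfolding low0 by (simp add: ereal_real')
      then show ?case by simp
    qed
  qed
  then show int: "integrable M (\<lambda>\<omega>. \<xi> \<omega> * low 0 \<omega>)"
    using quasi_integrable_iff_integrable[OF qi] fin by simp
  then show "lower_cost M \<xi> B U 0 = ereal (\<integral>\<omega>. \<xi> \<omega> * low 0 \<omega> \<partial>M)"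
    using cost' by (simp add: ext_expectation_integrable)
qed

text \<open>
  If the least and the greatest maximizer agreed almost surely, so would their costs.
\<close>
lemma positive_probability_not_singleton:
  assumes l: "0 < l" and ne: "lower_cost M \<xi> B U (ereal l) \<noteq> upper_cost M \<xi> B U (ereal l)"
  shows "0 < measure M {\<omega>\<in>space M. \<not> is_singleton (conjugate_set U (B \<omega>) (ereal l * ereal (\<xi> \<omega>)))}"
proof -
  let ?A = "{\<omega>\<in>space M. low l \<omega> \<noteq> upp l \<omega>}"
  have [measurable]: "low l \<in> borel_measurable M" "upp l \<in> borel_measurable M" using l by auto
  have A: "?A \<in> sets M" by measurable
  have "is_singleton (conjugate_set U (B \<omega>) (ereal l * ereal (\<xi> \<omega>))) \<longleftrightarrow> low l \<omega> = upp l \<omega>"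
    if "\<omega> \<in> space M" for \<omega>
    using state_utility.is_singleton_conjugate_set[OF state[OF that], of "l * \<xi> \<omega>"]
      low_eq[OF that l] upp_eq[OF that l] xi_pos[OF that] l by simp
  then have eq: "{\<omega>\<in>space M. \<not> is_singleton (conjugate_set U (B \<omega>) (ereal l * ereal (\<xi> \<omega>)))} = ?A"
    by auto
  have "measure M ?A \<noteq> 0"
  proof
    assume "measure M ?A = 0"
    then have AE_eq: "AE \<omega> in M. low l \<omega> = upp l \<omega>"
      using A by (intro AE_I'[of ?A]) (auto simp: null_sets_def emeasure_eq_measure)
    have "lower_cost M \<xi> B U (ereal l) = upper_cost M \<xi> B U (ereal l)"
      unfolding lower_cost_eq[OF l] upper_cost_eq[OF l]
      by (rule ext_expectation_cong_AE) (use AE_eq in eventually_elim, simp)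
    with ne show False by simp
  qed
  then show ?thesis unfolding eq by (simp add: zero_less_measure_iff)
qed

end

context feasible_problem
begin

lemma optimal_solution_extI:
  assumes "AE \<omega> in M. \<bar>X \<omega>\<bar> \<noteq> \<infinity>" "optimal_solution M \<xi> B U x0 (\<lambda>\<omega>. real_of_ereal (X \<omega>))"
  shows "optimal_solution_ext M \<xi> B U x0 X"
  using assms by (simp add: optimal_solution_ext_def)

lemma optimal_low:
  assumes "0 \<le> l" "lower_cost M \<xi> B U (ereal l) = ereal x0"
  shows "optimal_solution_ext M \<xi> B U x0 (\<lambda>\<omega>. conj_lower U (B \<omega>) (ereal l * ereal (\<xi> \<omega>)))"
proof (rule optimal_solution_extI)
  have *: "(AE \<omega> in M. \<bar>conj_lower U (B \<omega>) (ereal l * ereal (\<xi> \<omega>))\<bar> \<noteq> \<infinity>) \<and> dual_optimal l (low l) \<and>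
      integrable M (\<lambda>\<omega>. \<xi> \<omega> * low l \<omega>) \<and> (\<integral>\<omega>. \<xi> \<omega> * low l \<omega> \<partial>M) = x0"
  proof (cases "l = 0")
    case True
    have l0: "lower_cost M \<xi> B U 0 = ereal x0" using assms(2) True by (simp add: zero_ereal_def)
    then have "lower_cost M \<xi> B U 0 < \<infinity>" by simp
    from bliss_policy[OF this] l0 True show ?thesis by (simp flip: zero_ereal_def)
  next
    case False
    then have "0 < l" using assms(1) by simp
    moreover have "AE \<omega> in M. \<bar>conj_lower U (B \<omega>) (ereal l * ereal (\<xi> \<omega>))\<bar> \<noteq> \<infinity>"
      by (intro AE_I2) (subst low_eq, use \<open>0 < l\<close> in auto)
    ultimately show ?thesis
      using lower_cost_integrable[of l] dual_optimal_low[of l] assms(2) by simp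
  qed
  then show "AE \<omega> in M. \<bar>conj_lower U (B \<omega>) (ereal l * ereal (\<xi> \<omega>))\<bar> \<noteq> \<infinity>" by blast
  from * show "optimal_solution M \<xi> B U x0 (\<lambda>\<omega>. real_of_ereal (conj_lower U (B \<omega>) (ereal l * ereal (\<xi> \<omega>))))"
    unfolding low_def[symmetric] using assms(1) by (intro optimal_if_dual_optimal) auto
qed

lemma optimal_upp:
  assumes l: "0 < l" and "upper_cost M \<xi> B U (ereal l) = ereal x0"
  shows "optimal_solution_ext M \<xi> B U x0 (\<lambda>\<omega>. conj_upper U (B \<omega>) (ereal l * ereal (\<xi> \<omega>)))"
proof (rule optimal_solution_extI)
  show "AE \<omega> in M. \<bar>conj_upper U (B \<omega>) (ereal l * ereal (\<xi> \<omega>))\<bar> \<noteq> \<infinity>"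
    by (intro AE_I2) (subst upp_eq, use l in auto)
  show "optimal_solution M \<xi> B U x0 (\<lambda>\<omega>. real_of_ereal (conj_upper U (B \<omega>) (ereal l * ereal (\<xi> \<omega>))))"
    unfolding upp_def[symmetric]
    using upper_cost_integrable[of l] assms dual_optimal_upp[OF l]
    by (intro optimal_if_dual_optimal[of l]) auto
qed

lemma infinitely_many_low_upp:
  assumes "nonatomic M" and l: "0 < l" and "lower_cost M \<xi> B U (ereal l) < ereal x0"
    "ereal x0 < upper_cost M \<xi> B U (ereal l)"
  shows "infinitely_many_optimal_solutions M \<xi> B U x0"
proof (rule infinitely_many_between[OF assms(1) less_imp_le[OF l] dual_optimal_low[OF l] dual_optimal_upp[OF l] low_le_upp[OF _ l]])
  have "lower_cost M \<xi> B U (ereal l) < \<infinity>" using assms(3) by (rule less_trans) simp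
  from lower_cost_integrable[OF l this] assms(3)
  show "integrable M (\<lambda>\<omega>. \<xi> \<omega> * low l \<omega>)" "(\<integral>\<omega>. \<xi> \<omega> * low l \<omega> \<partial>M) < x0" by auto
  show "ereal x0 < ext_expectation M (\<lambda>\<omega>. ereal (\<xi> \<omega> * upp l \<omega>))"
    using assms(4) l by (simp add: upper_cost_eq)
qed

lemma bliss_solution_exists:
  assumes "lower_cost M \<xi> B U 0 \<le> ereal x0"
  shows "bliss_solution M \<xi> B U x0 (low 0)"
proof -
  have "lower_cost M \<xi> B U 0 < \<infinity>" using assms by (rule le_less_trans) simp
  note b = bliss_policy[OF this]
  have "(\<integral>\<omega>. \<xi> \<omega> * low 0 \<omega> \<partial>M) \<le> x0" using assms b(4) by simp
  then have "admissible M \<xi> B U x0 (low 0)"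
    using b(2,3) dual_optimal_finite[OF b(2)] by (simp add: admissible_iff dual_optimal_def)
  moreover have "AE \<omega> in M. bliss_point U (B \<omega>) \<le> ereal (low 0 \<omega>)"
    using b(1) AE_space
  proof eventually_elim
    case (elim \<omega>)
    then show ?case
      using state_utility.bliss_point_eq[OF state[OF elim(2)]]
      by (simp add: low_def ereal_real' flip: zero_ereal_def)
  qed
  ultimately show ?thesis by (simp add: bliss_solution_def)
qed

lemma between_left_limit:
  assumes na: "nonatomic M" and l: "0 \<le> l0" "ereal l0 < l"
    and fin: "\<And>l'::real. l0 < l' \<Longrightarrow> lower_cost M \<xi> B U (ereal l') < \<infinity>"
    and between: "lower_cost M \<xi> B U l < ereal x0" "ereal x0 \<le> Lim (at_left l) (lower_cost M \<xi> B U)"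
  shows "0 < measure M {\<omega>\<in>space M. \<not> is_singleton (conjugate_set U (B \<omega>) (l * ereal (\<xi> \<omega>)))}"
    and "ereal x0 = Lim (at_left l) (lower_cost M \<xi> B U) \<Longrightarrow>
      optimal_solution_ext M \<xi> B U x0 (\<lambda>\<omega>. conj_upper U (B \<omega>) (l * ereal (\<xi> \<omega>)))"
    and "ereal x0 < Lim (at_left l) (lower_cost M \<xi> B U) \<Longrightarrow> infinitely_many_optimal_solutions M \<xi> B U x0"
proof -
  \<comment> \<open>The cost is left continuous at \<open>\<infinity>\<close>, so there is no gap there.\<close>
  have "l \<noteq> \<infinity>"
  proof
    assume "l = \<infinity>"
    then have "Lim (at_left l) (lower_cost M \<xi> B U) = lower_cost M \<xi> B U l"
      using lower_cost_at_left_infinity[OF l(1) fin] by simp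
    with between show False by simp
  qed
  then obtain r where r: "l = ereal r" "l0 < r" using l(2) by (cases l) auto
  have r0: "0 < r" using r(2) l(1) by simp
  have lim: "Lim (at_left l) (lower_cost M \<xi> B U) = upper_cost M \<xi> B U (ereal r)"
    unfolding r(1) by (rule lower_cost_at_left_real[OF l(1) r(2) fin])
  show "0 < measure M {\<omega>\<in>space M. \<not> is_singleton (conjugate_set U (B \<omega>) (l * ereal (\<xi> \<omega>)))}"
    unfolding r(1) by (rule positive_probability_not_singleton[OF r0]) (use between lim r(1) in auto)
  show "optimal_solution_ext M \<xi> B U x0 (\<lambda>\<omega>. conj_upper U (B \<omega>) (l * ereal (\<xi> \<omega>)))"
    if "ereal x0 = Lim (at_left l) (lower_cost M \<xi> B U)"
    unfolding r(1) by (rule optimal_upp[OF r0]) (use that lim in simp)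
  show "infinitely_many_optimal_solutions M \<xi> B U x0" if "ereal x0 < Lim (at_left l) (lower_cost M \<xi> B U)"
    by (rule infinitely_many_low_upp[OF na r0]) (use that lim between r(1) in auto)
qed

lemma beyond_upper_cost:
  assumes na: "nonatomic M" and l0: "0 < l0"
    and inf: "\<And>l::real. 0 < l \<Longrightarrow> l < l0 \<Longrightarrow> lower_cost M \<xi> B U (ereal l) = \<infinity>"
    and less: "upper_cost M \<xi> B U (ereal l0) < ereal x0"
  defines "Xup \<equiv> \<lambda>\<omega>. conj_upper U (B \<omega>) (ereal l0 * ereal (\<xi> \<omega>))"
  shows "\<not> (\<exists>X. optimal_solution M \<xi> B U x0 X \<and> expected_utility M B U X < \<infinity>)"
    and "AE \<omega> in M. \<bar>Xup \<omega>\<bar> \<noteq> \<infinity>"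
    and "\<exists>Xhat :: nat \<Rightarrow> 'a \<Rightarrow> real.
      (\<forall>k\<ge>1. Xhat k \<in> borel_measurable M \<and>
         ext_expectation M (\<lambda>\<omega>. ereal (\<xi> \<omega> * Xhat k \<omega>)) = ereal x0 \<and>
         expectation_exists M (\<lambda>\<omega>. U (Xhat k \<omega>) (B \<omega>))) \<and>
      (AE \<omega> in M. (\<lambda>k. ereal (Xhat k \<omega>)) \<longlonglongrightarrow> Xup \<omega>) \<and>
      (\<lambda>k. expected_utility M B U (Xhat k)) \<longlonglongrightarrow> problem_value M \<xi> B U x0 \<and>
      problem_value M \<xi> B U x0 =
        expected_utility M B U (\<lambda>\<omega>. real_of_ereal (Xup \<omega>))
          + ereal l0 * (ereal x0 - upper_cost M \<xi> B U (ereal l0))"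
proof -
  have "upper_cost M \<xi> B U (ereal l0) < \<infinity>" using less by (rule less_trans) simp
  note int = upper_cost_integrable[OF l0 this]
  have less': "(\<integral>\<omega>. \<xi> \<omega> * upp l0 \<omega> \<partial>M) < x0" using less int(2) by simp
  have Xup: "Xup \<omega> = ereal (upp l0 \<omega>)" if "\<omega> \<in> space M" for \<omega>
    unfolding Xup_def by (rule upp_eq[OF that l0])
  have upp: "(\<lambda>\<omega>. real_of_ereal (Xup \<omega>)) = upp l0" by (simp add: Xup_def upp_def[abs_def])
  obtain Z :: "nat \<Rightarrow> 'a \<Rightarrow> real" where Z: "\<And>k. admissible M \<xi> B U x0 (Z k)" "\<And>k. (\<integral>\<omega>. \<xi> \<omega> * Z k \<omega> \<partial>M) = x0"
    "\<And>\<omega>. \<omega> \<in> space M \<Longrightarrow> (\<lambda>k. Z k \<omega>) \<longlonglongrightarrow> upp l0 \<omega>"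
    "(\<lambda>k. expected_utility M B U (Z k)) \<longlonglongrightarrow> problem_value M \<xi> B U x0"
    "problem_value M \<xi> B U x0 =
      expected_utility M B U (upp l0) + ereal (l0 * (x0 - (\<integral>\<omega>. \<xi> \<omega> * upp l0 \<omega> \<partial>M)))"
    by (rule surplus_budget[OF na l0 _ int(1) less']) (rule inf, assumption+, rule that)
  show "\<not> (\<exists>X. optimal_solution M \<xi> B U x0 X \<and> expected_utility M B U X < \<infinity>)"
    using no_finite_optimum[OF l0 int(1) less' Z(5)] by auto
  show "AE \<omega> in M. \<bar>Xup \<omega>\<bar> \<noteq> \<infinity>" by (intro AE_I2) (simp add: Xup)
  show "\<exists>Xhat :: nat \<Rightarrow> 'a \<Rightarrow> real.
      (\<forall>k\<ge>1. Xhat k \<in> borel_measurable M \<and>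
         ext_expectation M (\<lambda>\<omega>. ereal (\<xi> \<omega> * Xhat k \<omega>)) = ereal x0 \<and>
         expectation_exists M (\<lambda>\<omega>. U (Xhat k \<omega>) (B \<omega>))) \<and>
      (AE \<omega> in M. (\<lambda>k. ereal (Xhat k \<omega>)) \<longlonglongrightarrow> Xup \<omega>) \<and>
      (\<lambda>k. expected_utility M B U (Xhat k)) \<longlonglongrightarrow> problem_value M \<xi> B U x0 \<and>
      problem_value M \<xi> B U x0 =
        expected_utility M B U (\<lambda>\<omega>. real_of_ereal (Xup \<omega>))
          + ereal l0 * (ereal x0 - upper_cost M \<xi> B U (ereal l0))"
  proof (intro exI[of _ Z] conjI allI impI)
    fix k :: nat
    show "Z k \<in> borel_measurable M" using Z(1) by (simp add: admissible_iff)
    have "integrable M (\<lambda>\<omega>. \<xi> \<omega> * Z k \<omega>)" using Z(1) by (simp add: admissible_iff)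
    then show "ext_expectation M (\<lambda>\<omega>. ereal (\<xi> \<omega> * Z k \<omega>)) = ereal x0"
      by (simp add: ext_expectation_integrable Z(2))
    show "expectation_exists M (\<lambda>\<omega>. U (Z k \<omega>) (B \<omega>))"
      using well_defined Z(1) by (simp add: well_defined_problem_def)
  next
    show "AE \<omega> in M. (\<lambda>k. ereal (Z k \<omega>)) \<longlonglongrightarrow> Xup \<omega>"
      using Z(3) by (intro AE_I2) (simp add: Xup)
    show "problem_value M \<xi> B U x0 = expected_utility M B U (\<lambda>\<omega>. real_of_ereal (Xup \<omega>))
          + ereal l0 * (ereal x0 - upper_cost M \<xi> B U (ereal l0))"
      unfolding upp Z(5) int(2) by simp
  qed (rule Z(4))
qed

end

theorem theorem3:
  fixes M :: "'a measure" and N :: "'e measure"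
    and \<xi> :: "'a \<Rightarrow> real" and B :: "'a \<Rightarrow> 'e" and U :: "real \<Rightarrow> 'e \<Rightarrow> ereal"
  assumes "utility_model M N \<xi> B U"
    and "nonatomic M"
    and "standing_assumption M N \<xi> B U"
  shows
    "(case3 M \<xi> B U \<longrightarrow>
       (\<forall>x0 \<in> feasible_set M \<xi> B U.
          well_defined_problem M \<xi> B U x0 \<and>
          ereal x0 \<noteq> ext_expectation M (\<lambda>\<omega>. ereal (\<xi> \<omega>) * dom_inf U (B \<omega>)) \<longrightarrow>
          problem_value M \<xi> B U x0 = \<infinity>))
     \<and>
     (\<forall>l0::real. case1 M \<xi> B U l0 \<or> case2 M \<xi> B U l0 \<longrightarrow>
       (\<forall>x0 \<in> feasible_set M \<xi> B U. well_defined_problem M \<xi> B U x0 \<longrightarrow>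
         (\<forall>l::real. l \<ge> l0 \<and> lower_cost M \<xi> B U (ereal l) = ereal x0 \<longrightarrow>
            optimal_solution_ext M \<xi> B U x0 (\<lambda>\<omega>. conj_lower U (B \<omega>) (ereal l * ereal (\<xi> \<omega>))))
         \<and>
         (\<forall>l::ereal. l > ereal l0 \<and> \<not> isCont (lower_cost M \<xi> B U) l \<and>
              lower_cost M \<xi> B U l < ereal x0 \<and>
              ereal x0 \<le> Lim (at_left l) (lower_cost M \<xi> B U) \<longrightarrow>
            measure M {\<omega> \<in> space M.
               \<not> is_singleton (conjugate_set U (B \<omega>) (l * ereal (\<xi> \<omega>)))} > 0 \<and>
            (ereal x0 = Lim (at_left l) (lower_cost M \<xi> B U) \<longrightarrow>
               optimal_solution_ext M \<xi> B U x0 (\<lambda>\<omega>. conj_upper U (B \<omega>) (l * ereal (\<xi> \<omega>)))) \<and>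
            (ereal x0 < Lim (at_left l) (lower_cost M \<xi> B U) \<longrightarrow>
               infinitely_many_optimal_solutions M \<xi> B U x0))
         \<and>
         (case1 M \<xi> B U l0 \<and> ereal x0 \<ge> lower_cost M \<xi> B U (ereal l0) \<longrightarrow>
            (\<exists>X. bliss_solution M \<xi> B U x0 X))
         \<and>
         (case2 M \<xi> B U l0 \<longrightarrow>
           (let \<theta> = upper_cost M \<xi> B U (ereal l0);
                Xup = (\<lambda>\<omega>. conj_upper U (B \<omega>) (ereal l0 * ereal (\<xi> \<omega>)))
            in
              (ereal x0 = \<theta> \<longrightarrow> optimal_solution_ext M \<xi> B U x0 Xup) \<and>
              (lower_cost M \<xi> B U (ereal l0) < ereal x0 \<and> ereal x0 < \<theta> \<longrightarrow>
                 infinitely_many_optimal_solutions M \<xi> B U x0) \<and>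
              (ereal x0 > \<theta> \<longrightarrow>
                 \<not> (\<exists>X. optimal_solution M \<xi> B U x0 X \<and> expected_utility M B U X < \<infinity>) \<and>
                 (AE \<omega> in M. \<bar>Xup \<omega>\<bar> \<noteq> \<infinity>) \<and>
                 (\<exists>Xhat :: nat \<Rightarrow> 'a \<Rightarrow> real.
                    (\<forall>k\<ge>1. Xhat k \<in> borel_measurable M \<and>
                       ext_expectation M (\<lambda>\<omega>. ereal (\<xi> \<omega> * Xhat k \<omega>)) = ereal x0 \<and>
                       expectation_exists M (\<lambda>\<omega>. U (Xhat k \<omega>) (B \<omega>))) \<and>
                    (AE \<omega> in M. (\<lambda>k. ereal (Xhat k \<omega>)) \<longlonglongrightarrow> Xup \<omega>) \<and>
                    (\<lambda>k. expected_utility M B U (Xhat k)) \<longlonglongrightarrow> problem_value M \<xi> B U x0 \<and>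
                    problem_value M \<xi> B U x0 =
                      expected_utility M B U (\<lambda>\<omega>. real_of_ereal (Xup \<omega>))
                        + ereal l0 * (ereal x0 - \<theta>)))))))"
proof (rule conjI; intro impI ballI allI)
  fix x0 assume x0: "x0 \<in> feasible_set M \<xi> B U" and c3: "case3 M \<xi> B U"
    and *: "well_defined_problem M \<xi> B U x0 \<and>
      ereal x0 \<noteq> ext_expectation M (\<lambda>\<omega>. ereal (\<xi> \<omega>) * dom_inf U (B \<omega>))"
  interpret utility_problem M N \<xi> B U by unfold_locales (fact assms)+
  interpret feasible_problem M N \<xi> B U x0 using x0 * by unfold_locales auto
  show "problem_value M \<xi> B U x0 = \<infinity>"
    using c3 * by (intro value_infinite[OF assms(2)]) (auto simp: case3_def)
next
  fix l0 x0
  assume c: "case1 M \<xi> B U l0 \<or> case2 M \<xi> B U l0" and x0: "x0 \<in> feasible_set M \<xi> B U"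
    and wd: "well_defined_problem M \<xi> B U x0"
  interpret utility_problem M N \<xi> B U by unfold_locales (fact assms)+
  interpret feasible_problem M N \<xi> B U x0 using x0 wd by unfold_locales auto
  have l0: "0 \<le> l0" and fin: "\<And>l::real. l0 < l \<Longrightarrow> lower_cost M \<xi> B U (ereal l) < \<infinity>"
    using c by (auto simp: case1_def case2_def)
  note between = between_left_limit[OF assms(2) l0 _ fin]
  show "(\<forall>l::real. l \<ge> l0 \<and> lower_cost M \<xi> B U (ereal l) = ereal x0 \<longrightarrow>
            optimal_solution_ext M \<xi> B U x0 (\<lambda>\<omega>. conj_lower U (B \<omega>) (ereal l * ereal (\<xi> \<omega>))))
         \<and>
         (\<forall>l::ereal. l > ereal l0 \<and> \<not> isCont (lower_cost M \<xi> B U) l \<and>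
              lower_cost M \<xi> B U l < ereal x0 \<and>
              ereal x0 \<le> Lim (at_left l) (lower_cost M \<xi> B U) \<longrightarrow>
            measure M {\<omega> \<in> space M.
               \<not> is_singleton (conjugate_set U (B \<omega>) (l * ereal (\<xi> \<omega>)))} > 0 \<and>
            (ereal x0 = Lim (at_left l) (lower_cost M \<xi> B U) \<longrightarrow>
               optimal_solution_ext M \<xi> B U x0 (\<lambda>\<omega>. conj_upper U (B \<omega>) (l * ereal (\<xi> \<omega>)))) \<and>
            (ereal x0 < Lim (at_left l) (lower_cost M \<xi> B U) \<longrightarrow>
               infinitely_many_optimal_solutions M \<xi> B U x0))
         \<and>
         (case1 M \<xi> B U l0 \<and> ereal x0 \<ge> lower_cost M \<xi> B U (ereal l0) \<longrightarrow>
            (\<exists>X. bliss_solution M \<xi> B U x0 X))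
         \<and>
         (case2 M \<xi> B U l0 \<longrightarrow>
           (let \<theta> = upper_cost M \<xi> B U (ereal l0);
                Xup = (\<lambda>\<omega>. conj_upper U (B \<omega>) (ereal l0 * ereal (\<xi> \<omega>)))
            in
              (ereal x0 = \<theta> \<longrightarrow> optimal_solution_ext M \<xi> B U x0 Xup) \<and>
              (lower_cost M \<xi> B U (ereal l0) < ereal x0 \<and> ereal x0 < \<theta> \<longrightarrow>
                 infinitely_many_optimal_solutions M \<xi> B U x0) \<and>
              (ereal x0 > \<theta> \<longrightarrow>
                 \<not> (\<exists>X. optimal_solution M \<xi> B U x0 X \<and> expected_utility M B U X < \<infinity>) \<and>
                 (AE \<omega> in M. \<bar>Xup \<omega>\<bar> \<noteq> \<infinity>) \<and>
                 (\<exists>Xhat :: nat \<Rightarrow> 'a \<Rightarrow> real.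
                    (\<forall>k\<ge>1. Xhat k \<in> borel_measurable M \<and>
                       ext_expectation M (\<lambda>\<omega>. ereal (\<xi> \<omega> * Xhat k \<omega>)) = ereal x0 \<and>
                       expectation_exists M (\<lambda>\<omega>. U (Xhat k \<omega>) (B \<omega>))) \<and>
                    (AE \<omega> in M. (\<lambda>k. ereal (Xhat k \<omega>)) \<longlonglongrightarrow> Xup \<omega>) \<and>
                    (\<lambda>k. expected_utility M B U (Xhat k)) \<longlonglongrightarrow> problem_value M \<xi> B U x0 \<and>
                    problem_value M \<xi> B U x0 =
                      expected_utility M B U (\<lambda>\<omega>. real_of_ereal (Xup \<omega>))
                        + ereal l0 * (ereal x0 - \<theta>)))))"
    unfolding Let_def
  proof (intro conjI impI allI)
    fix l :: real assume "l \<ge> l0 \<and> lower_cost M \<xi> B U (ereal l) = ereal x0"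
    then show "optimal_solution_ext M \<xi> B U x0 (\<lambda>\<omega>. conj_lower U (B \<omega>) (ereal l * ereal (\<xi> \<omega>)))"
      using l0 by (intro optimal_low) auto
  next
    fix l assume l: "l > ereal l0 \<and> \<not> isCont (lower_cost M \<xi> B U) l \<and>
      lower_cost M \<xi> B U l < ereal x0 \<and> ereal x0 \<le> Lim (at_left l) (lower_cost M \<xi> B U)"
    then show "measure M {\<omega> \<in> space M. \<not> is_singleton (conjugate_set U (B \<omega>) (l * ereal (\<xi> \<omega>)))} > 0"
      by (intro between(1)) auto
    show "optimal_solution_ext M \<xi> B U x0 (\<lambda>\<omega>. conj_upper U (B \<omega>) (l * ereal (\<xi> \<omega>)))"
      if "ereal x0 = Lim (at_left l) (lower_cost M \<xi> B U)"
      using l that by (intro between(2)) auto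
    show "infinitely_many_optimal_solutions M \<xi> B U x0"
      if "ereal x0 < Lim (at_left l) (lower_cost M \<xi> B U)"
      using l that by (intro between(3)) auto
  next
    assume "case1 M \<xi> B U l0 \<and> ereal x0 \<ge> lower_cost M \<xi> B U (ereal l0)"
    then have "lower_cost M \<xi> B U 0 \<le> ereal x0" by (auto simp: case1_def simp flip: zero_ereal_def)
    then show "\<exists>X. bliss_solution M \<xi> B U x0 X" using bliss_solution_exists by blast
  next
    assume "case2 M \<xi> B U l0"
    then have pos: "0 < l0" by (simp add: case2_def)
    show "optimal_solution_ext M \<xi> B U x0 (\<lambda>\<omega>. conj_upper U (B \<omega>) (ereal l0 * ereal (\<xi> \<omega>)))"
      if "ereal x0 = upper_cost M \<xi> B U (ereal l0)"
      by (rule optimal_upp[OF pos that[symmetric]])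
    show "infinitely_many_optimal_solutions M \<xi> B U x0"
      if "lower_cost M \<xi> B U (ereal l0) < ereal x0 \<and> ereal x0 < upper_cost M \<xi> B U (ereal l0)"
      using that by (intro infinitely_many_low_upp[OF assms(2) pos]) auto
  next
    assume c2: "case2 M \<xi> B U l0" and less: "upper_cost M \<xi> B U (ereal l0) < ereal x0"
    have inf: "\<And>l::real. 0 < l \<Longrightarrow> l < l0 \<Longrightarrow> lower_cost M \<xi> B U (ereal l) = \<infinity>" and pos: "0 < l0"
      using c2 by (auto simp: case2_def)
    note beyond = beyond_upper_cost[OF assms(2) pos inf less]
    show "\<not> (\<exists>X. optimal_solution M \<xi> B U x0 X \<and> expected_utility M B U X < \<infinity>)" by (rule beyond(1))
    show "AE \<omega> in M. \<bar>conj_upper U (B \<omega>) (ereal l0 * ereal (\<xi> \<omega>))\<bar> \<noteq> \<infinity>" by (rule beyond(2))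
    from beyond(3) show "\<exists>Xhat :: nat \<Rightarrow> 'a \<Rightarrow> real.
        (\<forall>k\<ge>1. Xhat k \<in> borel_measurable M \<and>
           ext_expectation M (\<lambda>\<omega>. ereal (\<xi> \<omega> * Xhat k \<omega>)) = ereal x0 \<and>
           expectation_exists M (\<lambda>\<omega>. U (Xhat k \<omega>) (B \<omega>))) \<and>
        (AE \<omega> in M. (\<lambda>k. ereal (Xhat k \<omega>)) \<longlonglongrightarrow> conj_upper U (B \<omega>) (ereal l0 * ereal (\<xi> \<omega>))) \<and>
        (\<lambda>k. expected_utility M B U (Xhat k)) \<longlonglongrightarrow> problem_value M \<xi> B U x0 \<and>
        problem_value M \<xi> B U x0 =
          expected_utility M B U (\<lambda>\<omega>. real_of_ereal (conj_upper U (B \<omega>) (ereal l0 * ereal (\<xi> \<omega>))))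
            + ereal l0 * (ereal x0 - upper_cost M \<xi> B U (ereal l0))" .
  qed
qed

end
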